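(* Assume the Setup below. Let $m=\min(p,n-1)$, $M=\max(p,n-1)$ and $A_0=M-m$ (so $A_0=n-p-1$ when $n-1\ge p$). The double shrinkage estimator $\hat\Theta^{RLS}_{\hat a_S,\hat b_S}$ is minimax, i.e. $R(\Theta,\hat\Theta^{RLS}_{\hat a_S,\hat b_S})\le1$ for all $\Theta$, if either of the following holds: (i) $\hat\alpha=c\,\mathrm{tr}(W)$ with $c>0$ and $$(mA_0+m^2-16+4/m)c^2+\{(m+1)A_0+m^2-8m-18\}c+A_0-14\ge0;$$ (ii) $\hat\alpha=\mathrm{tr}(W)/m$ and $$A_0\ge\frac{-m^4+21m^3+18m^2+16m-4}{2m^2(m+1)}.$$
   Context: Setup. Let $n\ge 2$, $p\ge1$. Let $X=(x_1,\dots,x_n)$ be a random $p\times n$ matrix whose columns are independent with $x_i\sim\mathcal N_p(\theta_i,\Sigma)$, where $\Sigma$ is a known $p\times p$ positive definite matrix and $\Theta=(\theta_1,\dots,\theta_n)\in\mathbb R^{p\times n}$ is the unknown mean matrix. The loss of an estimator $\hat\Theta$ is $L(\Theta,\hat\Theta)=\frac{1}{np}\mathrm{tr}[(\hat\Theta-\Theta)^\top\Sigma^{-1}(\hat\Theta-\Theta)]$ and its risk is $R(\Theta,\hat\Theta)=E[L(\Theta,\hat\Theta)]$; $R(\Theta,X)=1$. Let $\bar x=n^{-1}\sum_j x_j$, $\bar X=\bar x\,1_n^\top$ with $1_n=(1,\dots,1)^\top$, and $W=(X-\bar X)(X-\bar X)^\top\Sigma^{-1}$. Here the ridge statistic is $\hat\alpha=c\,\mathrm{tr}(W)$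 with a constant $c>0$, and $c_0=c$. Put $V=(W+\hat\alpha I_p)^{-1}$. For (possibly data-dependent) weights $a,b$ the ridge-type linear shrinkage estimator is $$\hat\Theta^{RLS}_{a,b}=X-\Big\{aV+\frac{b}{\mathrm{tr}(W)}I_p\Big\}(X-\bar X).$$ The estimated weights are $$\hat a_S=\frac{(n-p-1)\mathrm{tr}(V)+\hat\alpha(\mathrm{tr}V)^2}{\mathrm{tr}(V^2W)}-(2c_0+1),\qquad \hat b_S=\{(n-1)p-2\}-\mathrm{tr}(VW)\,\hat a_S.$$ An estimator is called minimax if its risk is at most $1=R(\Theta,X)$ for every $\Theta$. *)

theory Defs
  imports "HOL-Probability.Probability"
begin

text \<open>Matrices: a p x n data matrix is of type real^'n^'p (p = CARD('p) rows,
 n = CARD('n) columns); column j of X is the observation x_j.\<close>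

definition pos_def_mat :: "real^'p^'p \<Rightarrow> bool" where
  "pos_def_mat S \<longleftrightarrow> transpose S = S \<and> (\<forall>x. x \<noteq> 0 \<longrightarrow> x \<bullet> (S *v x) > 0)"

definition mvn_density :: "real^'p^'p \<Rightarrow> real^'p \<Rightarrow> real^'p \<Rightarrow> real" where
  "mvn_density S mu x =
     (2 * pi) powr (- real CARD('p) / 2) * det S powr (- 1 / 2)
     * exp (- (1/2) * ((x - mu) \<bullet> (matrix_inv S *v (x - mu))))"

definition data_measure :: "real^'p^'p \<Rightarrow> real^'n^'p \<Rightarrow> (real^'n^'p) measure" where
  "data_measure S Th =
     density lborel (\<lambda>X. ennreal (\<Prod>j\<in>UNIV. mvn_density S (column j Th) (column j X)))"

definition mean_mat :: "real^'n^'p \<Rightarrow> real^'n^'p" where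
  "mean_mat X = (\<chi> i j. (\<Sum>k\<in>UNIV. X $ i $ k) / real CARD('n))"

definition W_mat :: "real^'p^'p \<Rightarrow> real^'n^'p \<Rightarrow> real^'p^'p" where
  "W_mat S X = (X - mean_mat X) ** transpose (X - mean_mat X) ** matrix_inv S"

definition V_mat :: "real \<Rightarrow> real^'p^'p \<Rightarrow> real^'n^'p \<Rightarrow> real^'p^'p" where
  "V_mat c S X = matrix_inv (W_mat S X + (c * trace (W_mat S X)) *\<^sub>R mat 1)"

definition RLS_est :: "real \<Rightarrow> real^'p^'p \<Rightarrow> real \<Rightarrow> real \<Rightarrow> real^'n^'p \<Rightarrow> real^'n^'p" where
  "RLS_est c S a b X =
     X - (a *\<^sub>R V_mat c S X + (b / trace (W_mat S X)) *\<^sub>R mat 1) ** (X - mean_mat X)"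

definition a_S :: "real \<Rightarrow> real^'p^'p \<Rightarrow> real^'n^'p \<Rightarrow> real" where
  "a_S c S X =
     (let W = W_mat S X; V = V_mat c S X; al = c * trace W;
          n = real CARD('n); p = real CARD('p)
      in ((n - p - 1) * trace V + al * (trace V)^2) / trace (V ** V ** W) - (2 * c + 1))"

definition b_S :: "real \<Rightarrow> real^'p^'p \<Rightarrow> real^'n^'p \<Rightarrow> real" where
  "b_S c S X =
     ((real CARD('n) - 1) * real CARD('p) - 2) - trace (V_mat c S X ** W_mat S X) * a_S c S X"

definition double_shrink_est :: "real \<Rightarrow> real^'p^'p \<Rightarrow> real^'n^'p \<Rightarrow> real^'n^'p" where
  "double_shrink_est c S X = RLS_est c S (a_S c S X) (b_S c S X) X"

definition loss :: "real^'p^'p \<Rightarrow> real^'n^'p \<Rightarrow> real^'n^'p \<Rightarrow> real" where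
  "loss S Th E = trace (transpose (E - Th) ** matrix_inv S ** (E - Th))
                  / (real CARD('n) * real CARD('p))"

text \<open>Risk as a (nonnegative) Lebesgue integral; the loss is nonnegative.\<close>
definition risk :: "real^'p^'p \<Rightarrow> real^'n^'p \<Rightarrow> (real^'n^'p \<Rightarrow> real^'n^'p) \<Rightarrow> ennreal" where
  "risk S Th est = (\<integral>\<^sup>+ X. ennreal (loss S Th (est X)) \<partial>data_measure S Th)"

end

theory Submission
  imports Defs
begin

text \<open>With \<open>Z = X - mean_mat X\<close>, \<open>T = trace W\<close>, \<open>K = trace (V W)\<close>, \<open>D = trace (V V W)\<close> and
  \<open>q = (n - 1) p - 2\<close>, the estimator is \<open>X - Phi\<close> with \<open>Phi = (a V + (b / T) I) Z\<close>, where \<open>a D\<close> is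
  exactly the divergence of \<open>V Z\<close> and \<open>b = q - K a\<close>. Since \<open>a\<close> and \<open>K\<close> are homogeneous of degree 0 in \<open>Z\<close>,
  Stein's unbiased estimate of (a multiple of) the risk difference is
  \<open>- b^2 / T - (a^2 D + 2 a'[V Z])\<close>, with \<open>a'[V Z]\<close> the derivative of \<open>a\<close> in direction \<open>V Z\<close>.
  The bracket is a function of the \<open>m\<close> possibly nonzero eigenvalues \<open>l\<close> of \<open>W\<close>. In terms of
  \<open>x = c T / (l + c T)\<close>, which satisfy \<open>0 < x \<le> 1\<close> and \<open>sum (1 / x) = m + 1 / c\<close>, it is nonnegative by
  Cauchy-Schwarz and elementary estimates; condition (ii) is condition (i) at \<open>c = 1 / m\<close>.

  The singularity of \<open>Phi\<close> at \<open>Z = 0\<close> is avoided by truncating: along \<open>Phi\<close> a cutoff increasing in \<open>T\<close>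
  has a derivative of the favourable sign because \<open>Phi\<close> has inner product \<open>q \<ge> 0\<close> with \<open>Z\<close>. Fatou's lemma
  then removes the cutoff, so no integrability of \<open>1 / T\<close> is needed.\<close>

subsection \<open>The eigenvalue inequality\<close>

text \<open>The constants of the estimator come from divergences. With \<open>t = trace V\<close>,
  the differential \<open>- V (dW + c dT) V\<close> of \<open>V\<close> contributes
  \<open>- t K\<close> and \<open>- D\<close> through the two factors \<open>Z\<close> of
  \<open>W\<close>, and \<open>- 2 c D\<close> through the ridge, which moves with the data. Since
  \<open>K = p - c T t\<close>, the total \<open>(n - 1) t - t K - (2 c + 1) D\<close> is the
  numerator of the fraction in \<open>a_S\<close> minus \<open>(2 c + 1) D\<close>, that is
  \<open>a D\<close>. The number \<open>q\<close> is the James-Stein constant: \<open>Z / T\<close>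
  has divergence \<open>q / T\<close>. The choice \<open>b = q - K a\<close> gives
  \<open>a K + b = q\<close>, which collapses all terms of the estimate containing \<open>b\<close>
  into \<open>- b^2 / T\<close>. The obstacle is the derivative of \<open>a\<close>, which has no
  sign of its own. It is outweighed because the constraint on the \<open>x\<close> forces their mean
  up to at least \<open>m c / (m c + 1)\<close>, hence the sum of \<open>x (1 - x)\<close> down to
  at most the fraction \<open>1 / (m c + 1)\<close> of the sum of the \<open>x\<close>. This gain,
  multiplied by \<open>A0\<close> plus the sum of the \<open>x\<close>, is what the quadratic
  condition in \<open>c\<close> bounds from below.\<close>

lemma shrinkage_inequality_aux:
  fixes \<tau> \<delta> \<epsilon> \<phi> \<kappa> A c m :: real
  assumes pos: "0 < \<tau>" "0 < \<delta>" "0 \<le> \<kappa>" "0 \<le> \<epsilon>" "0 < c" "1 \<le> m" "0 \<le> A"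
    and cond: "(m * A + m^2 - 16 + 4 / m) * c^2 + ((m + 1) * A + m^2 - 8 * m - 18) * c + A - 14 \<ge> 0"
    and am_hm: "m^2 * c \<le> \<tau> * (m * c + 1)"
    and \<delta>_le: "\<delta> * (m * c + 1) \<le> \<tau>"
    and \<sigma>: "\<sigma> = \<tau> - \<delta>" "0 \<le> \<sigma>"
    and cs: "\<delta>^2 \<le> \<kappa> * \<epsilon>"
    and \<kappa>_le: "c * \<kappa> \<le> (c + 1) * \<delta>"
    and \<epsilon>_le: "\<epsilon> \<le> \<delta> * \<tau>"
    and \<phi>1: "2 * \<phi> - \<epsilon> \<le> \<sigma> * \<delta>"
    and \<phi>2: "(2 * \<phi> - \<epsilon>) * (m * c + 1) \<le> (c + 1) * \<tau> * \<delta>"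
    and \<nu>: "\<nu> = \<tau> * (A + \<tau>)"
  shows "0 \<le> (\<nu> / \<delta> - (2 * c + 1))^2 * \<delta>
    + 2 * ((A + 2 * \<tau>) * (- 2 * \<epsilon> - 2 * c * \<kappa> * \<sigma>) + 2 * c * \<kappa> * \<tau>^2) / \<delta>
    + 4 * \<nu> * (\<epsilon> - 2 * \<phi> + 2 * c * \<kappa> * \<epsilon>) / \<delta>^2" (is "0 \<le> ?E")
proof -
  define B where "B = A + \<tau>"
  define k where "k = m * c + 1"
  have B: "0 < B" "\<tau> \<le> B" using pos by (auto simp: B_def)
  have k: "0 < k" using pos by (simp add: k_def add_pos_pos)
  \<comment> \<open>\<open>P\<close> is \<open>?E / \<nu>\<close>, sorted so that each term meets
    one hypothesis. The terms \<open>(2 * c + 1)^2 * \<delta> / \<nu>\<close> and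
    \<open>4 * c * \<kappa> / B\<close> are nonnegative and get dropped.\<close>
  define P where "P = \<nu> / \<delta> - 2 * (2 * c + 1) + (2 * c + 1)^2 * \<delta> / \<nu> + 4 * c * \<kappa> / B
     - 4 * ((1 / \<tau> + 1 / B) * (\<epsilon> / \<delta>)) - 4 * ((c * \<kappa> / \<delta>) * (\<sigma> / \<tau>)) - 4 * ((2 * \<phi> - \<epsilon>) / \<delta>^2) + 8 * c * (\<kappa> * \<epsilon> / \<delta>^2)"
  have \<nu>B: "\<nu> = \<tau> * B" using \<nu> B_def by simp
  have \<nu>0: "0 < \<nu>" using \<nu>B pos B by simp
  have AB: "A = B - \<tau>" by (simp add: B_def)
  have EP: "?E = \<nu> * P"
    unfolding P_def \<sigma> \<nu>B AB using pos B
    by (simp add: divide_simps power2_eq_square) algebra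
  have t1: "(1 / \<tau> + 1 / B) * (\<epsilon> / \<delta>) \<le> 2"
  proof -
    have "1 / B \<le> 1 / \<tau>" using B pos by (simp add: frac_le)
    then have "(1 / \<tau> + 1 / B) * (\<epsilon> / \<delta>) \<le> (2 / \<tau>) * (\<epsilon> / \<delta>)"
      using pos by (intro mult_right_mono) auto
    also have "\<dots> \<le> 2" using \<epsilon>_le pos by (simp add: divide_simps mult.commute)
    finally show ?thesis .
  qed
  have t2: "(c * \<kappa> / \<delta>) * (\<sigma> / \<tau>) \<le> c + 1"
  proof -
    have "(c * \<kappa> / \<delta>) * (\<sigma> / \<tau>) \<le> (c + 1) * 1"
      using pos \<kappa>_le \<sigma> by (intro mult_mono) (auto simp: divide_simps)
    then show ?thesis by simp
  qed
  have t3: "1 \<le> \<kappa> * \<epsilon> / \<delta>^2" using cs pos by (simp add: divide_simps)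
  have t4: "0 \<le> (2 * c + 1)^2 * \<delta> / \<nu>" "0 \<le> 4 * c * \<kappa> / B" using pos \<nu>0 B by auto
  have t5: "8 * c * 1 \<le> 8 * c * (\<kappa> * \<epsilon> / \<delta>^2)" using t3 pos by (intro mult_left_mono) auto
  \<comment> \<open>The constant is \<open>14 = 2 + 4 * 2 + 4\<close>. The multiples of
    \<open>c\<close> in \<open>2 * (2 * c + 1)\<close> and \<open>4 * (c + 1)\<close> add up to
    \<open>8 * c\<close> and are paid for by the Cauchy-Schwarz term \<open>t5\<close>.\<close>
  have P1: "P \<ge> \<nu> / \<delta> - 14 - 4 * ((2 * \<phi> - \<epsilon>) / \<delta>^2)"
    proof -
    have "a - 14 - 4 * g \<le> a - 2 * (2 * c + 1) + e + f - 4 * b - 4 * d - 4 * g + h"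
      if "8 * c * 1 \<le> h" "b \<le> 2" "d \<le> c + 1" "0 \<le> e" "0 \<le> f" for a b d e f g h :: real
      using that by simp
    then show "P \<ge> \<nu> / \<delta> - 14 - 4 * ((2 * \<phi> - \<epsilon>) / \<delta>^2)"
      unfolding P_def using t1 t2 t4 t5 by blast
  qed
  \<comment> \<open>The hypothesis \<open>cond\<close> is exactly the lower bound for
    \<open>L * (c + 1)\<close> below, and AM-HM gives \<open>L \<le> k * B\<close>. So
    \<open>cond\<close> bounds \<open>k * B\<close> from below, and with it the leading term
    \<open>\<nu> / \<delta> = B * (\<tau> / \<delta>)\<close>, because
    \<open>k \<le> \<tau> / \<delta>\<close>.\<close>
  define L where "L = A * k + m^2 * c"
  have L: "L * (c + 1) \<ge> (16 - 4/m) * c^2 + (8 * m + 18) * c + 14"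
    using cond pos unfolding L_def k_def by (simp add: algebra_simps power2_eq_square)
  have kB: "L \<le> k * B" using am_hm unfolding L_def B_def k_def by (simp add: algebra_simps)
  have m4: "0 < 4 / m" "4 / m \<le> 4" using pos by (auto simp: divide_simps)
  have tk: "k \<le> \<tau> / \<delta>" using \<delta>_le pos by (simp add: k_def divide_simps mult.commute)
  have "0 \<le> P"
  \<comment> \<open>The bounds \<open>\<phi>1\<close> and \<open>\<phi>2\<close> ask for
    \<open>4 * m * c + 14 \<le> L\<close> and \<open>4 * c + 18 \<le> L\<close> respectively.
    Neither polynomial comparison works for every \<open>c\<close>: the former fails for large
    \<open>c\<close> when \<open>m\<close> is large, the latter for small \<open>c\<close> because
    \<open>18 > 14\<close>.\<close>
  proof (cases "c \<le> 1")
    case True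
    have "0 \<le> c * ((16 - 4/m - 4 * m) * c + 4 * m + 4)"
    proof -
      have "0 \<le> (16 - 4/m) * c + 4 * m * (1 - c) + 4"
        using m4 True pos by (intro add_nonneg_nonneg mult_nonneg_nonneg) auto
      then show ?thesis using pos by (intro mult_nonneg_nonneg) (auto simp: algebra_simps)
    qed
    then have "(4 * m * c + 14) * (c + 1) \<le> L * (c + 1)"
      using L by (simp add: algebra_simps power2_eq_square)
    then have L1: "4 * m * c + 14 \<le> L" using pos by simp
    then have "4 * k \<le> B * k" using kB by (simp add: k_def algebra_simps)
    then have B4: "4 \<le> B" using k by simp
    have "(2 * \<phi> - \<epsilon>) / \<delta>^2 \<le> \<sigma> * \<delta> / \<delta>^2" using \<phi>1 pos by (intro divide_right_mono) auto
    also have "\<dots> = \<tau> / \<delta> - 1" using pos \<sigma> by (simp add: field_simps power2_eq_square)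
    finally have "(2 * \<phi> - \<epsilon>) / \<delta>\<^sup>2 \<le> \<tau> / \<delta> - 1" .
    moreover have "(B - 4) * (\<tau> / \<delta>) = \<nu> / \<delta> - 4 * (\<tau> / \<delta>)" by (simp add: \<nu>B algebra_simps)
    ultimately have "P \<ge> (B - 4) * (\<tau> / \<delta>) - 10" using P1 by linarith
    moreover have "(B - 4) * (\<tau> / \<delta>) \<ge> (B - 4) * k" using tk B4 by (intro mult_left_mono) auto
    ultimately show ?thesis using L1 kB by (simp add: algebra_simps k_def)
  next
    case False
    then have c1: "1 < c" by simp
    have "0 \<le> (12 - 4/m) * c^2 + (8 * m - 4) * c - 4"
    proof -
      have "8 * 1 \<le> (12 - 4/m) * c^2" using c1 m4 by (intro mult_mono) auto
      moreover have "0 \<le> (8 * m - 4) * c" using pos by auto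
      ultimately show ?thesis by simp
    qed
    then have "(4 * c + 18) * (c + 1) \<le> L * (c + 1)"
      using L by (simp add: algebra_simps power2_eq_square)
    then have L1: "4 * c + 18 \<le> L" using pos by simp
    then have "4 * (c + 1) \<le> B * k" using kB by (simp add: algebra_simps)
    then have B4: "4 * (c + 1) / k \<le> B" using k by (simp add: divide_simps mult.commute)
    have "(2 * \<phi> - \<epsilon>) / \<delta>^2 \<le> ((c + 1) * \<tau> * \<delta> / k) / \<delta>^2"
      using \<phi>2 pos k by (intro divide_right_mono) (auto simp: k_def divide_simps mult.commute)
    also have "\<dots> = (c + 1) / k * (\<tau> / \<delta>)" using pos \<sigma> k by (simp add: field_simps power2_eq_square)
    finally have "4 * ((2 * \<phi> - \<epsilon>) / \<delta>^2) \<le> 4 * ((c + 1) / k * (\<tau> / \<delta>))"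
      by (rule mult_left_mono) simp
    then have "4 * ((2 * \<phi> - \<epsilon>) / \<delta>^2) \<le> 4 * (c + 1) / k * (\<tau> / \<delta>)"
      by (metis mult.assoc times_divide_eq_right)
    moreover have "(B - 4 * (c + 1) / k) * (\<tau> / \<delta>) = \<nu> / \<delta> - 4 * (c + 1) / k * (\<tau> / \<delta>)"
    proof -
      have "\<nu> / \<delta> = B * (\<tau> / \<delta>)" by (simp add: \<nu>B)
      then show ?thesis by (simp only: left_diff_distrib)
    qed
    ultimately have "P \<ge> (B - 4 * (c + 1) / k) * (\<tau> / \<delta>) - 14"
      using P1 by linarith
    moreover have "(B - 4 * (c + 1) / k) * (\<tau> / \<delta>) \<ge> (B - 4 * (c + 1) / k) * k"
      using tk B4 by (intro mult_left_mono) auto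
    moreover have "(B - 4 * (c + 1) / k) * k = B * k - 4 * (c + 1)" using k by (simp add: field_simps)
    ultimately show ?thesis using L1 kB by (simp add: algebra_simps)
  qed
  then show ?thesis using EP \<nu>0 by simp
qed

text \<open>Each relation required by \<open>shrinkage_inequality_aux\<close> either rests on
  Cauchy-Schwarz or holds summand by summand with a nonnegative weight. In the second kind the
  constraint on the reciprocals enters only through a lower bound for every single
  \<open>x i\<close>.\<close>

lemma shrinkage_inequality:
  fixes x :: "'i \<Rightarrow> real" and c A :: real
  assumes fin: "finite I" and m: "m = real (card I)" "1 \<le> m"
    and x01: "\<And>i. i \<in> I \<Longrightarrow> 0 < x i \<and> x i \<le> 1"
    and c: "0 < c" and A: "0 \<le> A"
    and harm: "(\<Sum>i\<in>I. 1 / x i) = m + 1 / c"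
    and cond: "(m * A + m^2 - 16 + 4 / m) * c^2 + ((m + 1) * A + m^2 - 8 * m - 18) * c + A - 14 \<ge> 0"
    and \<tau>: "\<tau> = (\<Sum>i\<in>I. x i)" and \<sigma>: "\<sigma> = (\<Sum>i\<in>I. (x i)^2)"
    and \<delta>: "\<delta> = (\<Sum>i\<in>I. x i * (1 - x i))" and \<kappa>: "\<kappa> = (\<Sum>i\<in>I. 1 - x i)"
    and \<epsilon>: "\<epsilon> = (\<Sum>i\<in>I. (x i)^2 * (1 - x i))" and \<phi>: "\<phi> = (\<Sum>i\<in>I. (x i)^3 * (1 - x i))"
    and \<nu>: "\<nu> = \<tau> * (A + \<tau>)"
  shows "0 \<le> (\<nu> / \<delta> - (2 * c + 1))^2 * \<delta>
    + 2 * ((A + 2 * \<tau>) * (- 2 * \<epsilon> - 2 * c * \<kappa> * \<sigma>) + 2 * c * \<kappa> * \<tau>^2) / \<delta>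
    + 4 * \<nu> * (\<epsilon> - 2 * \<phi> + 2 * c * \<kappa> * \<epsilon>) / \<delta>^2"
proof (rule shrinkage_inequality_aux[where m = m])
  have I0: "I \<noteq> {}" using m by auto
  have xpos: "0 < x i" "x i \<le> 1" if "i \<in> I" for i using x01[OF that] by auto
  show "0 < \<tau>" unfolding \<tau> using I0 fin xpos by (intro sum_pos) auto
  then have \<tau>0: "0 < \<tau>" .
  have \<sigma>\<tau>: "\<sigma> = \<tau> - \<delta>"
    unfolding \<sigma> \<tau> \<delta> by (simp add: sum_subtractf[symmetric] algebra_simps power2_eq_square)
  then show "\<sigma> = \<tau> - \<delta>" .
  show "0 \<le> \<sigma>" unfolding \<sigma> by (simp add: sum_nonneg)
  show \<kappa>0: "0 \<le> \<kappa>" unfolding \<kappa> using xpos by (auto intro!: sum_nonneg)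
  show \<epsilon>0: "0 \<le> \<epsilon>" unfolding \<epsilon> using xpos by (auto intro!: sum_nonneg mult_nonneg_nonneg)
  have \<delta>0: "0 \<le> \<delta>" unfolding \<delta> using xpos by (auto intro!: sum_nonneg mult_nonneg_nonneg simp: less_imp_le)
  show "0 < \<delta>"
  proof (rule ccontr)
    assume "\<not> 0 < \<delta>"
    with \<delta>0 have "(\<Sum>i\<in>I. x i * (1 - x i)) = 0" unfolding \<delta> by simp
    then have "\<forall>i\<in>I. x i * (1 - x i) = 0"
      using sum_nonneg_eq_0_iff[OF fin, of "\<lambda>i. x i * (1 - x i)"] xpos by (force simp: less_imp_le)
    then have "\<forall>i\<in>I. x i = 1" using xpos by fastforce
    then have "(\<Sum>i\<in>I. 1 / x i) = m" using m by simp
    with harm c show False by simp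
  qed
  show "m\<^sup>2 * c \<le> \<tau> * (m * c + 1)"
  proof -
    have "(\<Sum>i\<in>I. sqrt (x i) * sqrt (1 / x i))\<^sup>2 \<le> (\<Sum>i\<in>I. (sqrt (x i))\<^sup>2) * (\<Sum>i\<in>I. (sqrt (1 / x i))\<^sup>2)"
      by (rule Cauchy_Schwarz_ineq_sum)
    also have "(\<Sum>i\<in>I. sqrt (x i) * sqrt (1 / x i)) = (\<Sum>i\<in>I. 1)"
      using xpos by (intro sum.cong) (auto simp: real_sqrt_mult[symmetric] less_imp_neq[symmetric])
    also have "(\<Sum>i\<in>I. (sqrt (x i))\<^sup>2) = \<tau>"
      unfolding \<tau> using xpos by (intro sum.cong) (auto simp: less_imp_le)
    also have "(\<Sum>i\<in>I. (sqrt (1 / x i))\<^sup>2) = (\<Sum>i\<in>I. 1 / x i)"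
      using xpos by (intro sum.cong) (auto simp: less_imp_le)
    finally have "m^2 \<le> \<tau> * (m + 1 / c)" using harm m by simp
    then have "m^2 * c \<le> \<tau> * (m + 1 / c) * c" using c by simp
    moreover have "(m + 1 / c) * c = m * c + 1" using c by (simp add: field_simps)
    ultimately show ?thesis by (simp add: mult.assoc)
  qed
  then have am: "m * m * c \<le> \<tau> * (m * c + 1)" by (simp add: power2_eq_square)
  \<comment> \<open>From \<open>\<sigma> \<ge> \<tau>^2 / m\<close> follows
    \<open>\<delta> \<le> \<tau> * (1 - \<tau> / m)\<close>, and AM-HM makes the last factor at most
    \<open>1 / (m * c + 1)\<close>.\<close>
  show "\<delta> * (m * c + 1) \<le> \<tau>"
  proof -
    have "(\<Sum>i\<in>I. x i * 1)\<^sup>2 \<le> (\<Sum>i\<in>I. (x i)\<^sup>2) * (\<Sum>i\<in>I. 1\<^sup>2)"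
      by (rule Cauchy_Schwarz_ineq_sum)
    then have "\<tau>^2 \<le> \<sigma> * m" using m by (simp add: \<tau> \<sigma>)
    then have "\<tau> * \<tau> \<le> (\<tau> - \<delta>) * m" using \<sigma>\<tau> by (simp add: power2_eq_square)
    then have "\<tau> * \<tau> * (m * c + 1) \<le> (\<tau> - \<delta>) * m * (m * c + 1)"
      using c m by (intro mult_right_mono) auto
    moreover have "\<tau> * (m * m * c) \<le> \<tau> * (\<tau> * (m * c + 1))" using am \<tau>0 by (intro mult_left_mono) auto
    ultimately have "m * (\<delta> * (m * c + 1)) \<le> m * \<tau>" by (simp add: algebra_simps)
    then show ?thesis using m by simp
  qed
  show "\<delta>\<^sup>2 \<le> \<kappa> * \<epsilon>"
  proof -
    have "(\<Sum>i\<in>I. sqrt (1 - x i) * (x i * sqrt (1 - x i)))\<^sup>2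
        \<le> (\<Sum>i\<in>I. (sqrt (1 - x i))\<^sup>2) * (\<Sum>i\<in>I. (x i * sqrt (1 - x i))\<^sup>2)"
      by (rule Cauchy_Schwarz_ineq_sum)
    also have "(\<Sum>i\<in>I. sqrt (1 - x i) * (x i * sqrt (1 - x i))) = \<delta>"
      unfolding \<delta> using xpos by (intro sum.cong) auto
    also have "(\<Sum>i\<in>I. (sqrt (1 - x i))\<^sup>2) = \<kappa>"
      unfolding \<kappa> using xpos by (intro sum.cong) auto
    also have "(\<Sum>i\<in>I. (x i * sqrt (1 - x i))\<^sup>2) = \<epsilon>"
      unfolding \<epsilon> using xpos by (intro sum.cong) (auto simp: power_mult_distrib)
    finally show ?thesis .
  qed
  \<comment> \<open>The other \<open>m - 1\<close> reciprocals are at least 1, which leaves at most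
    \<open>1 + 1 / c\<close> for \<open>1 / x i\<close>. Equality holds when all other
    \<open>x j\<close> are 1.\<close>
  have xlow: "c \<le> (c + 1) * x i" if i: "i \<in> I" for i
  proof -
    have "real (card (I - {i})) * 1 \<le> (\<Sum>j\<in>I - {i}. 1 / x j)"
      using xpos by (intro sum_bounded_below) (auto simp: divide_simps)
    moreover have "(\<Sum>j\<in>I. 1 / x j) = 1 / x i + (\<Sum>j\<in>I - {i}. 1 / x j)"
      using fin i by (rule sum.remove)
    moreover have "real (card (I - {i})) = m - 1" using m fin i by (simp add: card_Diff_singleton card_gt_0_iff of_nat_diff Suc_leI)
    ultimately have "1 / x i \<le> 1 + 1 / c" using harm by simp
    then show ?thesis using c xpos[OF i] by (simp add: field_simps)
  qed
  show "c * \<kappa> \<le> (c + 1) * \<delta>"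
    unfolding \<kappa> \<delta> sum_distrib_left
  proof (intro sum_mono)
    fix i assume i: "i \<in> I"
    have "c * (1 - x i) \<le> ((c + 1) * x i) * (1 - x i)" using xlow[OF i] xpos[OF i] by (intro mult_right_mono) auto
    then show "c * (1 - x i) \<le> (c + 1) * (x i * (1 - x i))" by (simp add: mult.assoc)
  qed
  have le\<tau>: "x i \<le> \<tau>" if i: "i \<in> I" for i
    unfolding \<tau> using fin i xpos by (intro member_le_sum) (auto simp: less_imp_le)
  have le\<sigma>: "(x i)^2 \<le> \<sigma>" if i: "i \<in> I" for i
    unfolding \<sigma> using fin i by (intro member_le_sum) auto
  show "\<epsilon> \<le> \<delta> * \<tau>"
    unfolding \<epsilon> \<delta> sum_distrib_right
  proof (intro sum_mono)
    fix i assume i: "i \<in> I"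
    have "(x i * (1 - x i)) * x i \<le> (x i * (1 - x i)) * \<tau>" using le\<tau>[OF i] xpos[OF i] by (intro mult_left_mono) auto
    then show "(x i)^2 * (1 - x i) \<le> x i * (1 - x i) * \<tau>" by (simp add: power2_eq_square algebra_simps)
  qed
  have \<phi>\<epsilon>: "2 * \<phi> - \<epsilon> = (\<Sum>i\<in>I. (x i * (1 - x i)) * (x i * (2 * x i - 1)))"
    unfolding \<phi> \<epsilon> sum_distrib_left sum_subtractf[symmetric]
    by (intro sum.cong) (auto simp: algebra_simps power2_eq_square power3_eq_cube)
  show "2 * \<phi> - \<epsilon> \<le> \<sigma> * \<delta>"
    unfolding \<phi>\<epsilon> \<delta> sum_distrib_left
  proof (intro sum_mono)
    fix i assume i: "i \<in> I"
    have "x i * (2 * x i - 1) \<le> x i * x i" using xpos[OF i] by (intro mult_left_mono) auto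
    also have "\<dots> \<le> \<sigma>" using le\<sigma>[OF i] by (simp add: power2_eq_square)
    finally have "(x i * (1 - x i)) * (x i * (2 * x i - 1)) \<le> (x i * (1 - x i)) * \<sigma>"
      using xpos[OF i] by (intro mult_left_mono) auto
    then show "(x i * (1 - x i)) * (x i * (2 * x i - 1)) \<le> \<sigma> * (x i * (1 - x i))" by (simp add: mult.commute)
  qed
  show "(2 * \<phi> - \<epsilon>) * (m * c + 1) \<le> (c + 1) * \<tau> * \<delta>"
    unfolding \<phi>\<epsilon> \<delta> sum_distrib_left sum_distrib_right
  proof (intro sum_mono)
    fix i assume i: "i \<in> I"
    \<comment> \<open>In \<open>(c + 1) * \<tau>\<close> every term but the \<open>i\<close>-th is
      replaced by its lower bound \<open>c\<close>; the result still dominates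
      \<open>x i * (m * c + 1)\<close> because \<open>x i \<le> 1\<close>.\<close>
    have "real (card (I - {i})) * c \<le> (\<Sum>j\<in>I - {i}. (c + 1) * x j)"
      using xlow by (intro sum_bounded_below) auto
    moreover have "(\<Sum>j\<in>I. (c + 1) * x j) = (c + 1) * x i + (\<Sum>j\<in>I - {i}. (c + 1) * x j)"
      using fin i by (rule sum.remove)
    moreover have "real (card (I - {i})) = m - 1" using m fin i by (simp add: card_Diff_singleton card_gt_0_iff of_nat_diff Suc_leI)
    moreover have "(\<Sum>j\<in>I. (c + 1) * x j) = (c + 1) * \<tau>" by (simp add: \<tau> sum_distrib_left)
    ultimately have t: "(c + 1) * x i + (m - 1) * c \<le> (c + 1) * \<tau>" by simp
    have "x i * (2 * x i - 1) \<le> x i * 1" using xpos[OF i] by (intro mult_left_mono) auto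
    then have "x i * (2 * x i - 1) * (m * c + 1) \<le> x i * (m * c + 1)"
      using c m by (intro mult_right_mono) auto
    also have "\<dots> \<le> (c + 1) * x i + (m - 1) * c"
    proof -
      have "x i * ((m - 1) * c) \<le> 1 * ((m - 1) * c)"
        using xpos[OF i] c m by (intro mult_right_mono) auto
      then show ?thesis by (simp add: algebra_simps)
    qed
    also note t
    finally have "(x i * (1 - x i)) * (x i * (2 * x i - 1) * (m * c + 1)) \<le> (x i * (1 - x i)) * ((c + 1) * \<tau>)"
      using xpos[OF i] by (intro mult_left_mono) auto
    then show "x i * (1 - x i) * (x i * (2 * x i - 1)) * (m * c + 1) \<le> (c + 1) * \<tau> * (x i * (1 - x i))"
      by (simp add: mult_ac)
  qed
qed (use assms in auto)

subsection \<open>Stein's identity for compactly supported fields\<close>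

lemma integrable_lborel_compact_support:
  fixes f :: "'a::euclidean_space \<Rightarrow> real"
  assumes "compact K" "continuous_on UNIV f" "\<And>x. x \<notin> K \<Longrightarrow> f x = 0"
  shows "integrable lborel f"
proof -
  have "integrable lborel (\<lambda>x. indicator K x *\<^sub>R f x)"
    using assms by (intro borel_integrable_compact) (auto intro: continuous_on_subset)
  also have "(\<lambda>x. indicator K x *\<^sub>R f x) = f"
    by (rule ext) (use assms(3) in \<open>auto simp: indicator_def\<close>)
  finally show ?thesis .
qed

text \<open>Lebesgue measure is translation invariant, so every difference quotient of
  \<open>f\<close> along \<open>v\<close> has integral 0, and dominated convergence passes to the
  derivative. Differentiability is asked only on \<open>U\<close>, because the fields of interest
  are singular elsewhere; near a point outside \<open>K\<close> the function vanishes.\<close>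

lemma integral_directional_derivative_zero:
  fixes f :: "'a::euclidean_space \<Rightarrow> real"
  assumes U: "open U" and K: "compact K" "K \<subseteq> U"
    and der: "\<And>x. x \<in> U \<Longrightarrow> (f has_derivative f' x) (at x)"
    and cont: "continuous_on U (\<lambda>x. f' x v)"
    and zero: "\<And>x. x \<notin> K \<Longrightarrow> f x = 0"
  shows "integrable lborel (\<lambda>x. indicator U x * f' x v)"
    and "(\<integral>x. indicator U x * f' x v \<partial>lborel) = 0"
proof -
  \<comment> \<open>The derivative is extended by 0. On the overlap of \<open>U\<close> with the
    complement of \<open>K\<close> both descriptions agree by uniqueness of derivatives, so
    continuity can be checked on two open sets that cover the space.\<close>
  define g where "g x = (if x \<in> U then f' x else (\<lambda>_. 0))" for x
  have oK: "open (- K)" using K(1) by (simp add: compact_imp_closed open_Compl)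
  have zK: "(f has_derivative (\<lambda>_. 0)) (at x)" if "x \<notin> K" for x
    by (rule has_derivative_transform_within_open[OF has_derivative_const[of 0] oK]) (use that zero in auto)
  have gder: "(f has_derivative g x) (at x)" for x
    using der zK K(2) by (auto simp: g_def)
  have gK: "g x h = 0" if "x \<notin> K" for x h
    using has_derivative_unique[OF gder zK] that by metis
  have fcont: "continuous_on UNIV f"
    using gder by (meson continuous_at_imp_continuous_on has_derivative_continuous)
  have "continuous_on (U \<union> - K) (\<lambda>x. g x v)"
  proof (rule continuous_on_open_Un[OF U oK])
    show "continuous_on U (\<lambda>x. g x v)"
      using cont by (rule continuous_on_eq) (simp add: g_def)
    show "continuous_on (- K) (\<lambda>x. g x v)"
      by (rule continuous_on_eq[of _ "\<lambda>_. 0"]) (auto simp: gK)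
  qed
  moreover have "U \<union> - K = UNIV" using K by auto
  ultimately have gcont: "continuous_on UNIV (\<lambda>x. g x v)" by simp
  have geq: "(\<lambda>x. indicator U x * f' x v) = (\<lambda>x. g x v)" by (auto simp: g_def)
  show "integrable lborel (\<lambda>x. indicator U x * f' x v)"
    unfolding geq using K(1) gcont gK by (rule integrable_lborel_compact_support)
  have fint: "integrable lborel f" using K(1) fcont zero by (rule integrable_lborel_compact_support)
  obtain M where M: "\<And>x. \<bar>g x v\<bar> \<le> M" "0 \<le> M"
  proof -
    have "compact ((\<lambda>x. g x v) ` K)"
      using K(1) gcont by (intro compact_continuous_image) (auto intro: continuous_on_subset)
    then obtain B where B: "\<And>y. y \<in> (\<lambda>x. g x v) ` K \<Longrightarrow> \<bar>y\<bar> \<le> B"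
      by (metis bounded_real compact_imp_bounded)
    have "\<bar>g x v\<bar> \<le> max B 0" for x
      by (cases "x \<in> K") (use B gK in \<open>auto simp: le_max_iff_disj\<close>)
    then show ?thesis using that[of "max B 0"] by simp
  qed
  obtain r where "\<forall>x\<in>K. norm x \<le> r"
    using compact_imp_bounded[OF K(1)] unfolding bounded_iff by blast
  then have r: "K \<subseteq> cball 0 r" by auto
  \<comment> \<open>Steps of length at most 1 keep the support of every quotient inside the ball of
    radius \<open>r + norm v\<close>, where a constant dominates.\<close>
  define e where "e k = 1 / (real k + 1)" for k :: nat
  have e: "0 < e k" "e k \<le> 1" for k by (auto simp: e_def)
  define s where "s k x = (f (x + e k *\<^sub>R v) - f x) / e k" for k x
  have line: "((\<lambda>t. f (x + t *\<^sub>R v)) has_real_derivative g (x + t *\<^sub>R v) v) (at t)" for x t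
  proof -
    have "((\<lambda>t. f (x + t *\<^sub>R v)) has_derivative (\<lambda>d. g (x + t *\<^sub>R v) (d *\<^sub>R v))) (at t)"
      by (rule has_derivative_compose[of "\<lambda>t. x + t *\<^sub>R v" "\<lambda>d. d *\<^sub>R v" t UNIV f "g (x + t *\<^sub>R v)", unfolded o_def])
        (auto intro!: derivative_eq_intros gder)
    moreover have "(\<lambda>d. g (x + t *\<^sub>R v) (d *\<^sub>R v)) = (*) (g (x + t *\<^sub>R v) v)"
      using linear_cmul[OF has_derivative_linear[OF gder]] by (auto simp: mult.commute)
    ultimately show ?thesis by (simp add: has_field_derivative_def)
  qed
  have "(\<lambda>k. \<integral>x. s k x \<partial>lborel) \<longlonglongrightarrow> (\<integral>x. g x v \<partial>lborel)"
  proof (rule integral_dominated_convergence)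
    show "(\<lambda>x. g x v) \<in> borel_measurable lborel"
      using gcont by (simp add: borel_measurable_continuous_onI)
    have [measurable]: "f \<in> borel_measurable borel" using fcont by (simp add: borel_measurable_continuous_onI)
    show "s k \<in> borel_measurable lborel" for k unfolding s_def by measurable
    show "integrable lborel (\<lambda>x. M * indicator (cball (0::'a) (r + norm v)) x)"
      by (intro integrable_mult_right integrable_real_indicator) (use emeasure_lborel_cball_finite[of "0::'a" "r + norm v"] in auto)
    show "AE x in lborel. (\<lambda>k. s k x) \<longlonglongrightarrow> g x v"
    proof (rule AE_I2)
      fix x
      have "((\<lambda>t. (f (x + t *\<^sub>R v) - f x) / t) \<longlongrightarrow> g x v) (at 0)"
        using line[of x 0] unfolding DERIV_def by simp
      moreover have "filterlim e (at 0) sequentially"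
        unfolding filterlim_at e_def
        using LIMSEQ_inverse_real_of_nat by (auto simp: inverse_eq_divide add.commute)
      ultimately show "(\<lambda>k. s k x) \<longlonglongrightarrow> g x v"
        unfolding s_def by (rule filterlim_compose)
    qed
    show "AE x in lborel. norm (s k x) \<le> M * indicator (cball (0::'a) (r + norm v)) x" for k
    proof (rule AE_I2)
      fix x
      have ev: "norm (e k *\<^sub>R v) \<le> norm v" using e[of k] by (simp add: mult_left_le_one_le)
      show "norm (s k x) \<le> M * indicator (cball (0::'a) (r + norm v)) x"
      proof (cases "x \<in> cball 0 (r + norm v)")
        case True
        have "norm (f (x + e k *\<^sub>R v) - f (x + 0 *\<^sub>R v)) \<le> M * norm (e k - 0)"
          by (rule field_differentiable_bound[of UNIV _ "\<lambda>t. g (x + t *\<^sub>R v) v"])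
            (use line M in auto)
        then show ?thesis using True e[of k] by (simp add: s_def divide_simps)
      next
        case False
        have "x \<notin> K"
        proof
          assume "x \<in> K"
          then have "norm x \<le> r" using r by auto
          then show False using False norm_ge_zero[of v] by simp
        qed
        moreover have "x + e k *\<^sub>R v \<notin> K"
        proof
          assume "x + e k *\<^sub>R v \<in> K"
          then have "norm (x + e k *\<^sub>R v) \<le> r" using r by auto
          then have "norm x \<le> r + norm v"
            using norm_triangle_ineq4[of "x + e k *\<^sub>R v" "e k *\<^sub>R v"] ev by simp
          then show False using False by simp
        qed
        ultimately show ?thesis using False zero by (simp add: s_def)
      qed
    qed
  qed
  moreover have "(\<integral>x. s k x \<partial>lborel) = 0" for k
  proof -
    have [measurable]: "f \<in> borel_measurable borel" using fcont by (simp add: borel_measurable_continuous_onI)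
    have i1: "(\<integral>x. f (x + e k *\<^sub>R v) \<partial>lborel) = (\<integral>x. f x \<partial>lborel)"
      using integral_distr[of "(+) (e k *\<^sub>R v)" lborel borel f] lborel_distr_plus[of "e k *\<^sub>R v"]
      by (simp add: add.commute)
    have i2: "integrable lborel (\<lambda>x. f (x + e k *\<^sub>R v))"
      using integrable_distr_eq[of "(+) (e k *\<^sub>R v)" lborel borel f] lborel_distr_plus[of "e k *\<^sub>R v"] fint
      by (simp add: add.commute)
    show ?thesis unfolding s_def using i1 i2 fint by simp
  qed
  ultimately show "(\<integral>x. indicator U x * f' x v \<partial>lborel) = 0"
    unfolding geq by (simp add: LIMSEQ_const_iff)
qed

section \<open>A calculus of continuously differentiable maps\<close>

text \<open>The derivative is explicit data and its continuity is asked direction by direction: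
  integrating directional derivatives requires no more, and no norm on linear maps is involved. It
  is the full derivative, not the one within \<open>U\<close>.\<close>

definition C1_on :: "'a set \<Rightarrow> ('a::euclidean_space \<Rightarrow> 'b::real_normed_vector) \<Rightarrow> ('a \<Rightarrow> 'a \<Rightarrow> 'b) \<Rightarrow> bool" where
  "C1_on U f f' \<longleftrightarrow> (\<forall>x\<in>U. (f has_derivative f' x) (at x)) \<and> (\<forall>h. continuous_on U (\<lambda>x. f' x h))"

lemma C1_on_der: "C1_on U f f' \<Longrightarrow> x \<in> U \<Longrightarrow> (f has_derivative f' x) (at x)"
  by (simp add: C1_on_def)

lemma C1_on_cont_der: "C1_on U f f' \<Longrightarrow> continuous_on U (\<lambda>x. f' x h)"
  by (simp add: C1_on_def)

lemma C1_on_cont: "C1_on U f f' \<Longrightarrow> continuous_on U f"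
  by (meson C1_on_der continuous_at_imp_continuous_on has_derivative_continuous)

lemma C1_on_const: "C1_on U (\<lambda>x. k) (\<lambda>x h. 0)"
  by (simp add: C1_on_def)

lemma C1_on_linear: "bounded_linear L \<Longrightarrow> C1_on U L (\<lambda>x. L)"
  by (auto simp: C1_on_def intro: bounded_linear_imp_has_derivative)

lemma C1_on_linear_comp:
  assumes "bounded_linear L" "C1_on U f f'"
  shows "C1_on U (\<lambda>x. L (f x)) (\<lambda>x h. L (f' x h))"
  using assms unfolding C1_on_def
  by (auto intro: bounded_linear.has_derivative bounded_linear.continuous_on)

lemma C1_on_add:
  "C1_on U f f' \<Longrightarrow> C1_on U g g' \<Longrightarrow> C1_on U (\<lambda>x. f x + g x) (\<lambda>x h. f' x h + g' x h)"
  unfolding C1_on_def by (auto intro!: has_derivative_add continuous_intros)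

lemma C1_on_diff:
  "C1_on U f f' \<Longrightarrow> C1_on U g g' \<Longrightarrow> C1_on U (\<lambda>x. f x - g x) (\<lambda>x h. f' x h - g' x h)"
  unfolding C1_on_def by (auto intro!: has_derivative_diff continuous_intros)

lemma C1_on_bilinear:
  assumes "bounded_bilinear B" "C1_on U f f'" "C1_on U g g'"
  shows "C1_on U (\<lambda>x. B (f x) (g x)) (\<lambda>x h. B (f x) (g' x h) + B (f' x h) (g x))"
  unfolding C1_on_def
proof (intro conjI ballI allI)
  interpret bounded_bilinear B by fact
  show "((\<lambda>x. B (f x) (g x)) has_derivative (\<lambda>h. B (f x) (g' x h) + B (f' x h) (g x))) (at x)" if "x \<in> U" for x
    using assms that by (intro FDERIV) (auto simp: C1_on_def)
  show "continuous_on U (\<lambda>x. B (f x) (g' x h) + B (f' x h) (g x))" for h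
    using C1_on_cont[OF assms(2)] C1_on_cont[OF assms(3)] C1_on_cont_der[OF assms(2)] C1_on_cont_der[OF assms(3)]
    by (intro continuous_on_add continuous_on)
qed

lemmas C1_on_mult = C1_on_bilinear[OF bounded_bilinear_mult]
lemmas C1_on_scaleR = C1_on_bilinear[OF bounded_bilinear_scaleR]
lemmas C1_on_inner = C1_on_bilinear[OF bounded_bilinear_inner]

lemma C1_on_real_comp:
  fixes f :: "'a::euclidean_space \<Rightarrow> real"
  assumes f: "C1_on U f f'"
    and w: "\<And>x. x \<in> U \<Longrightarrow> (w has_real_derivative w' (f x)) (at (f x))"
    and w': "continuous_on (f ` U) w'"
  shows "C1_on U (\<lambda>x. w (f x)) (\<lambda>x h. w' (f x) * f' x h)"
  unfolding C1_on_def
proof (intro conjI ballI allI)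
  show "((\<lambda>x. w (f x)) has_derivative (\<lambda>h. w' (f x) * f' x h)) (at x)" if "x \<in> U" for x
    using has_derivative_compose[OF C1_on_der[OF f that] w[OF that, unfolded has_field_derivative_def]] .
  show "continuous_on U (\<lambda>x. w' (f x) * f' x h)" for h
    using w' C1_on_cont[OF f] C1_on_cont_der[OF f]
    by (intro continuous_on_mult) (auto intro: continuous_on_compose2)
qed

lemma C1_on_inverse:
  fixes f :: "'a::euclidean_space \<Rightarrow> real"
  assumes f: "C1_on U f f'" and nz: "\<And>x. x \<in> U \<Longrightarrow> f x \<noteq> 0"
  shows "C1_on U (\<lambda>x. inverse (f x)) (\<lambda>x h. - inverse ((f x)^2) * f' x h)"
proof (rule C1_on_real_comp[OF f])
  show "(inverse has_real_derivative - inverse ((f x)^2)) (at (f x))" if "x \<in> U" for x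
    using DERIV_inverse[OF nz[OF that]] by (simp add: power_inverse numeral_2_eq_2)
  show "continuous_on (f ` U) (\<lambda>y. - inverse (y^2))" using nz by (auto intro!: continuous_intros)
qed

lemma C1_on_exp:
  fixes f :: "'a::euclidean_space \<Rightarrow> real"
  assumes f: "C1_on U f f'"
  shows "C1_on U (\<lambda>x. exp (f x)) (\<lambda>x h. exp (f x) * f' x h)"
  by (rule C1_on_real_comp[OF f]) (auto intro!: continuous_intros derivative_eq_intros)

text \<open>The positive part has a corner at 0, its square does not. This makes the square a
  convenient C1 profile for the cutoffs.\<close>

lemma has_real_derivative_pos_part_square:
  "((\<lambda>y::real. (max 0 y)^2) has_real_derivative 2 * max 0 y) (at y)"
proof -
  consider "y < 0" | "0 < y" | "y = 0" by linarith
  then show ?thesis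
  proof cases
    case 1
    have "((\<lambda>y::real. 0) has_real_derivative 0) (at y)" by simp
    then have "((\<lambda>y::real. (max 0 y)^2) has_real_derivative 0) (at y)"
      by (rule has_field_derivative_transform_within_open[of _ _ _ "{..<0}"]) (use 1 in auto)
    then show ?thesis using 1 by simp
  next
    case 2
    have "((\<lambda>y::real. y^2) has_real_derivative 2 * y) (at y)" by (auto intro!: derivative_eq_intros)
    then have "((\<lambda>y::real. (max 0 y)^2) has_real_derivative 2 * y) (at y)"
      by (rule has_field_derivative_transform_within_open[of _ _ _ "{0<..}"]) (use 2 in auto)
    then show ?thesis using 2 by simp
  next
    case 3
    have "((\<lambda>h::real. (max 0 h)^2 / h) \<longlongrightarrow> 0) (at 0)"
    proof (rule Lim_null_comparison)
      show "\<forall>\<^sub>F h in at 0. norm ((max 0 h)\<^sup>2 / h) \<le> \<bar>h\<bar>"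
        by (intro always_eventually) (auto simp: max_def power2_eq_square)
      show "((\<lambda>h::real. \<bar>h\<bar>) \<longlongrightarrow> 0) (at 0)" by (auto intro!: tendsto_eq_intros)
    qed
    then show ?thesis using 3 by (simp add: DERIV_def)
  qed
qed

lemma C1_on_pos_part_square:
  fixes f :: "'a::euclidean_space \<Rightarrow> real"
  assumes f: "C1_on U f f'"
  shows "C1_on U (\<lambda>x. (max 0 (f x))^2) (\<lambda>x h. 2 * max 0 (f x) * f' x h)"
  by (rule C1_on_real_comp[OF f has_real_derivative_pos_part_square]) (auto intro!: continuous_intros)

text \<open>The integrand is the divergence of \<open>\<rho> G\<close> by the product rule; the
  coordinate sum over the gradient of \<open>\<rho>\<close> recombines into
  \<open>\<rho>' x (G x)\<close>. For a normal density that term is \<open>- \<rho>\<close> times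
  the inner product of \<open>G x\<close> with the precision-weighted residual, which gives Stein's
  identity. Compact support is asked of \<open>G\<close> alone.\<close>

lemma stein_identity_compact_support:
  fixes G :: "'a::euclidean_space \<Rightarrow> 'a" and \<rho> :: "'a \<Rightarrow> real"
  assumes U: "open U" and K: "compact K" "K \<subseteq> U"
    and G: "C1_on U G G'" and \<rho>: "C1_on U \<rho> \<rho>'"
    and zero: "\<And>x. x \<notin> K \<Longrightarrow> G x = 0"
  shows "integrable lborel (\<lambda>x. indicator U x * (\<rho> x * (\<Sum>b\<in>Basis. G' x b \<bullet> b) + \<rho>' x (G x)))" (is ?I)
    and "(\<integral>x. indicator U x * (\<rho> x * (\<Sum>b\<in>Basis. G' x b \<bullet> b) + \<rho>' x (G x)) \<partial>lborel) = 0" (is ?Z)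
proof -
  define f' where "f' b x h = \<rho> x * (G' x h \<bullet> b) + \<rho>' x h * (G x \<bullet> b)" for b x h
  have C: "C1_on U (\<lambda>x. \<rho> x * (G x \<bullet> b)) (f' b)" for b
    unfolding f'_def
    by (rule C1_on_mult[OF \<rho> C1_on_linear_comp[OF bounded_linear_inner_left G]])
  have *: "integrable lborel (\<lambda>x. indicator U x * f' b x b)" "(\<integral>x. indicator U x * f' b x b \<partial>lborel) = 0" for b
    by (rule integral_directional_derivative_zero[OF U K C1_on_der[OF C] C1_on_cont_der[OF C]], (use zero in auto)[2])+
  have eq: "indicator U x * (\<rho> x * (\<Sum>b\<in>Basis. G' x b \<bullet> b) + \<rho>' x (G x)) = (\<Sum>b\<in>Basis. indicator U x * f' b x b)" for x
  proof (cases "x \<in> U")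
    case True
    have l: "linear (\<rho>' x)" using has_derivative_linear[OF C1_on_der[OF \<rho> True]] .
    have "\<rho>' x (G x) = \<rho>' x (\<Sum>b\<in>Basis. (G x \<bullet> b) *\<^sub>R b)" by (simp add: euclidean_representation)
    also have "\<dots> = (\<Sum>b\<in>Basis. \<rho>' x b * (G x \<bullet> b))"
      using l by (simp add: linear_sum linear_cmul mult.commute)
    finally show ?thesis using True by (simp add: f'_def sum.distrib sum_distrib_left)
  qed simp
  show ?I unfolding eq using * by (intro Bochner_Integration.integrable_sum)
  show ?Z unfolding eq using * by (subst Bochner_Integration.integral_sum) auto
qed

subsection \<open>Diagonalization of symmetric matrices\<close>

text \<open>A maximiser of the Rayleigh quotient on the unit sphere of \<open>V\<close> is an
  eigenvector, and self-adjointness lets \<open>f\<close> restrict to its orthogonal complement in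
  \<open>V\<close>, which has smaller dimension.\<close>

lemma self_adjoint_orthonormal_eigenbasis:
  fixes f :: "'a::euclidean_space \<Rightarrow> 'a"
  assumes f: "linear f" and sa: "\<And>x y. f x \<bullet> y = x \<bullet> f y"
    and V: "subspace V" "f ` V \<subseteq> V"
  shows "\<exists>B. B \<subseteq> V \<and> pairwise orthogonal B \<and> (\<forall>b\<in>B. norm b = 1) \<and> span B = V \<and> (\<forall>b\<in>B. \<exists>\<mu>. f b = \<mu> *\<^sub>R b)"
  using V
proof (induction "dim V" arbitrary: V rule: less_induct)
  case less
  show ?case
  proof (cases "V = {0}")
    case True
    then show ?thesis by (intro exI[of _ "{}"]) auto
  next
    case False
    then obtain x0 where x0: "x0 \<in> V" "x0 \<noteq> 0"
      using subspace_0[OF less.prems(1)] by blast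
    have c1: "compact (sphere 0 1 \<inter> V)"
      using closed_subspace[OF less.prems(1)] by (intro compact_Int_closed) auto
    have "inverse (norm x0) *\<^sub>R x0 \<in> sphere 0 1 \<inter> V"
      using x0 less.prems(1) by (auto simp: subspace_scale)
    then have c2: "sphere 0 1 \<inter> V \<noteq> {}" by blast
    have c3: "continuous_on (sphere 0 1 \<inter> V) (\<lambda>x. x \<bullet> f x)"
      using f by (intro continuous_intros) (simp add: linear_continuous_on linear_conv_bounded_linear)
    obtain b where b: "b \<in> sphere 0 1 \<inter> V"
      and bmax: "\<And>x. x \<in> sphere 0 1 \<inter> V \<Longrightarrow> x \<bullet> f x \<le> b \<bullet> f b"
      using continuous_attains_sup[OF c1 c2 c3] by blast
    define \<mu> where "\<mu> = b \<bullet> f b"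
    have nb: "norm b = 1" "b \<bullet> b = 1" "b \<in> V" using b by (auto simp: norm_eq_1)
    have h: "0 \<le> \<mu> * (x \<bullet> x) - x \<bullet> f x" if "x \<in> V" for x
    proof (cases "x = 0")
      case True
      then show ?thesis using f by (simp add: linear_0)
    next
      case False
      have "inverse (norm x) *\<^sub>R x \<in> sphere 0 1 \<inter> V"
        using False that less.prems(1) by (auto simp: subspace_scale)
      from bmax[OF this] have "(x \<bullet> f x) / (norm x)^2 \<le> \<mu>"
        using f by (simp add: \<mu>_def linear_cmul power2_eq_square divide_simps)
      then show ?thesis using False by (simp add: divide_simps power2_norm_eq_inner)
    qed
    \<comment> \<open>The form in \<open>h\<close> is nonnegative on \<open>V\<close> and vanishes
      at \<open>b\<close>. Along \<open>b + t y\<close> it is a quadratic in \<open>t\<close>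
      without constant term, so its linear coefficient must be 0.\<close>
    have orth: "(\<mu> *\<^sub>R b - f b) \<bullet> y = 0" if y: "y \<in> V" for y
    proof (rule ccontr)
      define p where "p = (\<mu> *\<^sub>R b - f b) \<bullet> y"
      define q where "q = \<mu> * (y \<bullet> y) - y \<bullet> f y"
      assume "(\<mu> *\<^sub>R b - f b) \<bullet> y \<noteq> 0"
      then have p: "p \<noteq> 0" by (simp add: p_def)
      have q: "0 \<le> q" using h[OF y] by (simp add: q_def)
      have *: "0 \<le> 2 * t * p + t^2 * q" for t
      proof -
        have "b + t *\<^sub>R y \<in> V" using nb y less.prems(1) by (simp add: subspace_add subspace_scale)
        from h[OF this] have "0 \<le> \<mu> * ((b + t *\<^sub>R y) \<bullet> (b + t *\<^sub>R y)) - (b + t *\<^sub>R y) \<bullet> f (b + t *\<^sub>R y)" .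
        also have "\<dots> = 2 * t * p + t^2 * q"
        proof -
          have "(b + t *\<^sub>R y) \<bullet> (b + t *\<^sub>R y) = 1 + 2 * t * (b \<bullet> y) + t^2 * (y \<bullet> y)"
            using nb(2) inner_commute[of y b] by (simp add: inner_add power2_eq_square algebra_simps)
          moreover have "f (b + t *\<^sub>R y) = f b + t *\<^sub>R f y" using f by (simp add: linear_add linear_cmul)
          then have "(b + t *\<^sub>R y) \<bullet> f (b + t *\<^sub>R y) = \<mu> + 2 * t * (f b \<bullet> y) + t^2 * (y \<bullet> f y)"
            using sa[of b y] inner_commute[of y "f b"] by (simp add: inner_add power2_eq_square \<mu>_def algebra_simps)
          ultimately show ?thesis
            unfolding p_def q_def by (simp only: inner_diff_left inner_scaleR_left) (simp add: algebra_simps)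
        qed
        finally show ?thesis .
      qed
      \<comment> \<open>The choice \<open>t = - p / (q + 1)\<close> makes the quadratic negative;
        \<open>q + 1\<close> in place of \<open>q\<close> covers \<open>q = 0\<close> as
        well.\<close>
      define d where "d = q + 1"
      have d: "d \<noteq> 0" "q = d - 1" using q by (auto simp: d_def)
      have "0 \<le> 2 * (- p / d) * p + (- p / d)^2 * q" by (rule *)
      also have "\<dots> = p^2 * (- q - 2) / d^2"
        using d(1) unfolding d(2) by (simp add: field_simps power2_eq_square)
      also have "\<dots> < 0" using p q d by (intro divide_neg_pos mult_pos_neg) auto
      finally show False by simp
    qed
    have "\<mu> *\<^sub>R b - f b \<in> V"
      using nb less.prems by (auto intro!: subspace_diff subspace_scale)
    from orth[OF this] have fb: "f b = \<mu> *\<^sub>R b" by simp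
    define V' where "V' = {x \<in> V. x \<bullet> b = 0}"
    have V'sub: "subspace V'"
      using less.prems(1) by (auto simp: V'_def subspace_def inner_add)
    have "f ` V' \<subseteq> V'"
      using less.prems(2) by (auto simp: V'_def sa fb)
    moreover have "dim V' < dim V"
    proof (rule dim_psubset)
      have "b \<notin> V'" using nb by (simp add: V'_def)
      moreover have "V' \<subseteq> V" by (auto simp: V'_def)
      ultimately have "V' \<subset> V" using nb by blast
      then show "span V' \<subset> span V"
        using V'sub less.prems(1) by (simp add: span_eq_iff[THEN iffD2])
    qed
    ultimately obtain B where B: "B \<subseteq> V'" "pairwise orthogonal B" "\<forall>b\<in>B. norm b = 1" "span B = V'"
       "\<forall>b\<in>B. \<exists>\<mu>. f b = \<mu> *\<^sub>R b"
      using less.hyps[OF _ V'sub] by blast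
    have sp: "span (insert b B) = V"
    proof
      show "span (insert b B) \<subseteq> V"
        using B(1) nb less.prems(1) by (intro span_minimal) (auto simp: V'_def)
      show "V \<subseteq> span (insert b B)"
      proof
        fix x assume x: "x \<in> V"
        have "x - (x \<bullet> b) *\<^sub>R b \<in> V'"
          using x nb less.prems(1) by (auto simp: V'_def inner_diff intro!: subspace_diff subspace_scale)
        then have "x - (x \<bullet> b) *\<^sub>R b \<in> span B" using B(4) by simp
        then show "x \<in> span (insert b B)"
          unfolding span_insert by blast
      qed
    qed
    have orthB: "y \<bullet> b = 0" if "y \<in> B" for y using B(1) that by (auto simp: V'_def)
    have pw: "pairwise orthogonal (insert b B)"
      using B(2) orthB by (auto simp: pairwise_insert orthogonal_def inner_commute)
    show ?thesis
    proof (intro exI[of _ "insert b B"] conjI)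
      show "insert b B \<subseteq> V" using B(1) nb by (auto simp: V'_def)
      show "\<forall>b\<in>insert b B. norm b = 1" using B(3) nb by simp
      show "\<forall>b\<in>insert b B. \<exists>\<mu>. f b = \<mu> *\<^sub>R b" using B(5) fb by simp
    qed (fact pw sp)+
  qed
qed

section \<open>Diagonal matrices and the spectral theorem in matrix form\<close>

definition diag_mat :: "('p \<Rightarrow> real) \<Rightarrow> real^'p^'p" where
  "diag_mat l = (\<chi> i j. if i = j then l i else 0)"

lemma diag_mat_mult: "diag_mat l ** diag_mat k = diag_mat (\<lambda>i. l i * k i)"
proof -
  have "(\<Sum>k\<in>UNIV. (if i = k then l i else 0) * (if k = j then r k else 0)) = (if i = j then l i * r i else 0)"
    for i j and r :: "'a \<Rightarrow> real"
  proof -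
    have "(if i = k then l i else 0) * (if k = j then r k else 0) = (if k = i then (if i = j then l i * r i else 0) else 0)" for k
      by auto
    then show ?thesis by (simp only: sum.delta finite_class.finite_UNIV UNIV_I if_True)
  qed
  then show ?thesis by (simp add: diag_mat_def matrix_matrix_mult_def)
qed

lemma diag_mat_add: "diag_mat l + diag_mat k = diag_mat (\<lambda>i. l i + k i)"
  by (auto simp: diag_mat_def vec_eq_iff)

lemma scaleR_diag_mat: "r *\<^sub>R diag_mat l = diag_mat (\<lambda>i. r * l i)"
  by (auto simp: diag_mat_def vec_eq_iff)

lemma diag_mat_one: "diag_mat (\<lambda>i. 1) = mat 1"
  by (auto simp: diag_mat_def mat_def vec_eq_iff)

lemma trace_diag_mat: "trace (diag_mat l) = (\<Sum>i\<in>UNIV. l i)"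
  by (simp add: trace_def diag_mat_def)

lemma transpose_diag_mat: "transpose (diag_mat l) = diag_mat l"
  by (auto simp: transpose_def diag_mat_def vec_eq_iff)

lemma diag_mat_mult_axis: "diag_mat l *v axis i 1 = l i *\<^sub>R axis i 1"
  by (simp add: matrix_vector_mult_basis column_def) (auto simp: diag_mat_def axis_def vec_eq_iff)

text \<open>The axis vectors of the nonzero entries are independent and lie in the range. The bound
  serves to count the nonzero eigenvalues of \<open>W\<close>.\<close>

lemma rank_diag_mat: "card {i. l i \<noteq> 0} \<le> rank (diag_mat l)"
proof -
  let ?E = "(\<lambda>i. axis i (1::real)) ` {i. l i \<noteq> 0}"
  have "?E \<subseteq> range ((*v) (diag_mat l))"
  proof clarify
    fix i assume "l i \<noteq> 0"
    then have "axis i 1 = diag_mat l *v (inverse (l i) *\<^sub>R axis i 1)"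
      by (simp add: matrix_vector_mult_scaleR diag_mat_mult_axis)
    then show "axis i 1 \<in> range ((*v) (diag_mat l))" by blast
  qed
  moreover have "independent ?E"
    using independent_Basis by (rule independent_mono) (auto simp: Basis_vec_def)
  ultimately have "card ?E \<le> dim (range ((*v) (diag_mat l)))"
    by (rule independent_card_le_dim)
  moreover have "card ?E = card {i. l i \<noteq> 0}"
    by (rule card_image) (auto simp: inj_on_def axis_eq_axis)
  ultimately show ?thesis by (simp add: rank_dim_range)
qed

lemma symmetric_matrix_diagonalization:
  fixes G :: "real^'p^'p"
  assumes "transpose G = G"
  obtains P :: "real^'p^'p" and l where "orthogonal_matrix P" "G = P ** diag_mat l ** transpose P"
proof -
  have "(G *v x) \<bullet> y = x \<bullet> (G *v y)" for x y
    using dot_lmul_matrix[of x G y] transpose_matrix_vector[of G x] assms by simp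
  then obtain B where B: "pairwise orthogonal B" "\<forall>b\<in>B. norm b = 1" "span B = (UNIV :: (real^'p) set)"
       "\<forall>b\<in>B. \<exists>\<mu>. G *v b = \<mu> *\<^sub>R b"
    using self_adjoint_orthonormal_eigenbasis[OF matrix_vector_mul_linear[of G], of UNIV] by auto
  have "independent B"
    using B(1,2) by (intro pairwise_orthogonal_independent) auto
  then have "finite B" "card B = CARD('p)"
    using B(3) dim_eq_card_independent[of B] dim_span[of B] by (auto simp: independent_imp_finite)
  then obtain g where g: "bij_betw g (UNIV :: 'p set) B"
    using finite_same_card_bij[of "UNIV :: 'p set" B] by auto
  have gB: "g i \<in> B" for i using g by (auto simp: bij_betw_def)
  have ginj: "g i = g j \<longleftrightarrow> i = j" for i j using g by (auto simp: bij_betw_def inj_def)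
  define P :: "real^'p^'p" where "P = (\<chi> i j. g j $ i)"
  obtain l where l: "\<And>i. G *v g i = l i *\<^sub>R g i"
    using bchoice[of UNIV "\<lambda>i m. G *v g i = m *\<^sub>R g i"] B(4) gB by auto
  have colP: "column j P = g j" for j by (simp add: P_def column_def vec_eq_iff)
  have oP: "orthogonal_matrix P"
    unfolding orthogonal_matrix_orthonormal_columns colP
    using B(1,2) gB ginj by (auto simp: pairwise_def)
  have "G ** P = P ** diag_mat l"
  proof -
    have "(G ** P) $ i $ j = (P ** diag_mat l) $ i $ j" for i j
    proof -
      have "(G ** P) $ i $ j = (G *v g j) $ i"
        by (simp add: matrix_matrix_mult_def matrix_vector_mult_def P_def)
      also have "\<dots> = (P ** diag_mat l) $ i $ j"
        unfolding l by (simp add: matrix_matrix_mult_def diag_mat_def P_def if_distrib cong: if_cong)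
      finally show ?thesis .
    qed
    then show ?thesis by (simp add: vec_eq_iff)
  qed
  then have "G ** (P ** transpose P) = P ** diag_mat l ** transpose P"
    by (simp add: matrix_mul_assoc)
  then have "G = P ** diag_mat l ** transpose P"
    using oP by (simp add: orthogonal_matrix_def)
  with oP that show ?thesis by blast
qed

subsection \<open>Spectral form of the drift\<close>

lemma matrix_inv_unique_right:
  fixes A B :: "real^'p^'p"
  assumes "A ** B = mat 1"
  shows "matrix_inv A = B" "invertible A" "B ** A = mat 1"
proof -
  show BA: "B ** A = mat 1" using assms by (simp add: matrix_left_right_inverse)
  show inv: "invertible A" using assms BA unfolding invertible_def by blast
  have "matrix_inv A ** A = mat 1" using someI_ex[OF inv[unfolded invertible_def]] by (simp add: matrix_inv_def)
  then have "matrix_inv A ** (A ** B) = B" by (simp add: matrix_mul_assoc)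
  then show "matrix_inv A = B" using assms by simp
qed

lemma pos_def_mat_diagonalization:
  fixes S :: "real^'p^'p"
  assumes "pos_def_mat S"
  obtains P :: "real^'p^'p" and l where "orthogonal_matrix P" "S = P ** diag_mat l ** transpose P" "\<And>i. 0 < l i"
proof -
  obtain P :: "real^'p^'p" and l where P: "orthogonal_matrix P" and S: "S = P ** diag_mat l ** transpose P"
    using symmetric_matrix_diagonalization[of S] assms by (auto simp: pos_def_mat_def)
  have PP: "transpose P ** P = mat 1" "P ** transpose P = mat 1"
    using P by (auto simp: orthogonal_matrix_def)
  have SP: "transpose P ** (S ** P) = diag_mat l"
    unfolding S by (simp add: matrix_mul_assoc PP) (simp add: matrix_mul_assoc[symmetric] PP)
  have lpos: "0 < l i" for i
  proof -
    let ?e = "axis i 1 :: real^'p"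
    have "transpose P *v (P *v ?e) = ?e" by (simp add: matrix_vector_mul_assoc PP)
    then have "P *v ?e \<noteq> 0" by (metis axis_eq_0_iff matrix_vector_mult_0_right zero_neq_one)
    then have "0 < (P *v ?e) \<bullet> (S *v (P *v ?e))" using assms by (simp add: pos_def_mat_def)
    also have "\<dots> = ?e \<bullet> (transpose P *v (S *v (P *v ?e)))"
      by (metis dot_lmul_matrix vector_transpose_matrix)
    also have "transpose P *v (S *v (P *v ?e)) = diag_mat l *v ?e"
      by (simp add: matrix_vector_mul_assoc SP[symmetric] matrix_mul_assoc)
    finally show ?thesis by (simp add: diag_mat_mult_axis inner_axis_axis)
  qed
  with P S that show ?thesis by blast
qed

lemma conj_diag_mat_mult:
  assumes "Q ** P = mat 1"
  shows "(P ** diag_mat k ** Q) ** (P ** diag_mat k' ** Q) = P ** diag_mat (\<lambda>i. k i * k' i) ** Q"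
proof -
  have "(P ** diag_mat k ** Q) ** (P ** diag_mat k' ** Q) = P ** diag_mat k ** (Q ** P) ** diag_mat k' ** Q"
    by (simp only: matrix_mul_assoc)
  then show ?thesis by (simp add: assms diag_mat_mult matrix_mul_assoc[symmetric])
qed

text \<open>\<open>B\<close> whitens the observations: it turns the form of
  \<open>matrix_inv S\<close> into the Euclidean one and makes \<open>W\<close> similar to a Gram
  matrix.\<close>

lemma pos_def_mat_sqrt:
  fixes S :: "real^'p^'p"
  assumes "pos_def_mat S"
  obtains A B where "transpose A = A" "transpose B = B" "A ** B = mat 1" "B ** A = mat 1"
    "A ** A = S" "matrix_inv S = B ** B"
proof -
  obtain P :: "real^'p^'p" and l where P: "orthogonal_matrix P" and S: "S = P ** diag_mat l ** transpose P"
    and lpos: "\<And>i. 0 < l i" using pos_def_mat_diagonalization[OF assms] by blast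
  have PP: "transpose P ** P = mat 1" "P ** transpose P = mat 1"
    using P by (auto simp: orthogonal_matrix_def)
  define A where "A = P ** diag_mat (\<lambda>i. sqrt (l i)) ** transpose P"
  define B where "B = P ** diag_mat (\<lambda>i. 1 / sqrt (l i)) ** transpose P"
  note mul = conj_diag_mat_mult[OF PP(1)]
  have [simp]: "l i \<noteq> 0" "sqrt (l i) * sqrt (l i) = l i" "\<bar>l i\<bar> = l i" for i using lpos[of i] by auto
  have AA: "A ** A = S" unfolding A_def mul S by simp
  have AB: "A ** B = mat 1" unfolding A_def B_def mul by (simp add: diag_mat_one PP)
  have BA: "B ** A = mat 1" unfolding A_def B_def mul by (simp add: diag_mat_one PP)
  have "S ** (B ** B) = A ** (A ** B) ** B" by (simp add: AA[symmetric] matrix_mul_assoc)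
  then have SB: "S ** (B ** B) = mat 1" by (simp add: AB)
  show ?thesis
  proof (rule that[of A B])
    show "transpose A = A" "transpose B = B"
      unfolding A_def B_def by (simp_all add: matrix_transpose_mul transpose_diag_mat matrix_mul_assoc)
    show "matrix_inv S = B ** B" using SB by (rule matrix_inv_unique_right)
  qed (use AA AB BA in auto)
qed

lemma mean_mat_row: "(\<Sum>k\<in>UNIV. (X - mean_mat X) $ i $ k) = 0"
  by (simp add: mean_mat_def sum_subtractf)

text \<open>\<open>W\<close> need not be symmetric, but
  \<open>W = A ** (Y ** transpose Y) ** B\<close> with \<open>Y = B ** Z\<close> is similar to a
  Gram matrix. The eigenbasis \<open>R = A ** P\<close> need not be orthogonal; it serves for sums,
  products and traces of functions of \<open>W\<close>.\<close>

lemma W_mat_spectral: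
  fixes S :: "real^'p^'p" and X :: "real^'n^'p"
  assumes "pos_def_mat S"
  obtains R Ri :: "real^'p^'p" and l where "R ** Ri = mat 1" "Ri ** R = mat 1" "W_mat S X = R ** diag_mat l ** Ri"
    "\<And>i. 0 \<le> l i" "card {i. l i \<noteq> 0} \<le> CARD('n) - 1"
proof -
  obtain A B where A: "transpose A = A" "transpose B = B" "A ** B = mat 1" "B ** A = mat 1"
    "A ** A = S" and Q: "matrix_inv S = B ** B" using pos_def_mat_sqrt[OF assms] by metis
  define Z where "Z = X - mean_mat X"
  define Y where "Y = B ** Z"
  have tY: "transpose Y = transpose Z ** B" by (simp add: Y_def matrix_transpose_mul A)
  have "transpose (Y ** transpose Y) = Y ** transpose Y" by (simp add: matrix_transpose_mul)
  then obtain P :: "real^'p^'p" and l where P: "orthogonal_matrix P" and G: "Y ** transpose Y = P ** diag_mat l ** transpose P"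
    using symmetric_matrix_diagonalization by metis
  have PP: "transpose P ** P = mat 1" "P ** transpose P = mat 1"
    using P by (auto simp: orthogonal_matrix_def)
  have "transpose P ** (Y ** transpose Y) ** P = (transpose P ** P) ** diag_mat l ** (transpose P ** P)"
    unfolding G by (simp only: matrix_mul_assoc)
  then have dl: "diag_mat l = (transpose P ** Y) ** transpose (transpose P ** Y)"
    by (simp add: PP matrix_transpose_mul matrix_mul_assoc)
  have l0: "0 \<le> l i" for i
  proof -
    have "l i = diag_mat l $ i $ i" by (simp add: diag_mat_def)
    also have "\<dots> = (\<Sum>k\<in>UNIV. (transpose P ** Y) $ i $ k * (transpose P ** Y) $ i $ k)"
      unfolding dl by (simp add: matrix_matrix_mult_def[of "transpose P ** Y"] transpose_def[of "transpose P ** Y"])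
    also have "\<dots> \<ge> 0" by (intro sum_nonneg) simp
    finally show ?thesis .
  qed
  have rk: "card {i. l i \<noteq> 0} \<le> CARD('n) - 1"
  proof -
    have "card {i. l i \<noteq> 0} \<le> rank (diag_mat l)" by (rule rank_diag_mat)
    also have "\<dots> \<le> rank (transpose P ** Y)" unfolding dl by (rule rank_mul_le_left)
    also have "\<dots> \<le> rank Z" unfolding Y_def by (metis rank_mul_le_right order_trans)
    \<comment> \<open>The rows of \<open>Z\<close> sum to 0, so the vector of ones lies in its
      kernel; this is the origin of \<open>n - 1\<close>.\<close>
    also have "\<dots> < CARD('n)"
    proof -
      have "Z *v (\<chi> k. 1) = 0"
        using mean_mat_row[of X] by (simp add: matrix_vector_mult_def vec_eq_iff Z_def)
      moreover have "Z *v 0 = 0" by simp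
      moreover have "(\<chi> k. 1) \<noteq> (0 :: real^'n)" by (simp add: vec_eq_iff)
      ultimately have "\<not> inj ((*v) Z)" by (metis injD)
      then show ?thesis by (simp add: less_rank_noninjective)
    qed
    finally show ?thesis by simp
  qed
  show ?thesis
  proof (rule that[of "A ** P" "transpose P ** B" l])
    have "A ** P ** (transpose P ** B) = A ** (P ** transpose P) ** B" by (simp only: matrix_mul_assoc)
    then show "A ** P ** (transpose P ** B) = mat 1" by (simp add: PP A)
    have "transpose P ** B ** (A ** P) = transpose P ** (B ** A) ** P" by (simp only: matrix_mul_assoc)
    then show "transpose P ** B ** (A ** P) = mat 1" by (simp add: PP A)
    have "A ** P ** diag_mat l ** (transpose P ** B) = A ** (Y ** transpose Y) ** B"
      unfolding G by (simp only: matrix_mul_assoc)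
    also have "\<dots> = (A ** B) ** Z ** transpose Z ** (B ** B)" unfolding tY by (simp only: Y_def matrix_mul_assoc)
    also have "\<dots> = W_mat S X" by (simp add: A W_mat_def Q Z_def)
    finally show "W_mat S X = A ** P ** diag_mat l ** (transpose P ** B)" ..
  qed (use l0 rk in auto)
qed

text \<open>\<open>dt\<close>, \<open>dD\<close> and \<open>dN\<close> are the rates of
  \<open>t\<close>, \<open>D\<close> and \<open>Nn\<close> when each eigenvalue moves with speed
  \<open>2 * l * v\<close>, so that \<open>T\<close> moves with speed \<open>2 * K\<close>. Scaling
  by powers of \<open>\<alpha> = c * T\<close> turns everything into sums over
  \<open>x = \<alpha> * v\<close>, in which a zero eigenvalue has \<open>x = 1\<close>.\<close>

lemma spectral_drift_nonneg:
  fixes l :: "'p::finite \<Rightarrow> real" and N :: nat and c :: real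
  assumes l: "\<And>i. 0 \<le> l i" and T: "T = (\<Sum>i\<in>UNIV. l i)" "0 < T"
    and rk: "card {i. l i \<noteq> 0} \<le> N - 1" and N2: "2 \<le> N" and c: "0 < c"
    and p: "p = real CARD('p)" and n: "n = real N"
    and m: "m = min p (n - 1)" and A: "A = max p (n - 1) - m"
    and cond: "(m * A + m^2 - 16 + 4 / m) * c^2 + ((m + 1) * A + m^2 - 8 * m - 18) * c + A - 14 \<ge> 0"
    and v: "\<And>i. v i = 1 / (l i + c * T)"
    and t: "t = (\<Sum>i\<in>UNIV. v i)" and s: "s = (\<Sum>i\<in>UNIV. (v i)^2)"
    and K: "K = (\<Sum>i\<in>UNIV. l i * v i)" and D: "D = (\<Sum>i\<in>UNIV. l i * (v i)^2)"
    and E: "E = (\<Sum>i\<in>UNIV. l i * (v i)^3)" and H: "H = (\<Sum>i\<in>UNIV. (l i)^2 * (v i)^4)"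
    and dt: "dt = - 2 * E - 2 * c * K * s" and dD: "dD = 2 * E - 4 * H - 4 * c * K * E"
    and Nn: "Nn = (n - p - 1) * t + c * T * t^2"
    and dN: "dN = (n - p - 1) * dt + 2 * c * K * t^2 + 2 * c * T * t * dt"
  shows "0 < D" "0 \<le> (Nn / D - (2 * c + 1))^2 * D + 2 * ((dN * D - Nn * dD) / D^2)"
proof -
  define \<alpha> where "\<alpha> = c * T"
  have \<alpha>: "0 < \<alpha>" using c T by (simp add: \<alpha>_def)
  have vpos: "0 < v i" for i using l[of i] \<alpha> by (simp add: v \<alpha>_def add_nonneg_pos)
  define k where "k = min CARD('p) (N - 1)"
  have mk: "m = real k" using N2 by (auto simp: m k_def p n min_def)
  have m1: "1 \<le> m" using N2 unfolding mk k_def by (simp add: Suc_leI)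
  have "card {i. l i \<noteq> 0} \<le> k" using rk by (auto simp: k_def intro: card_mono)
  \<comment> \<open>\<open>I\<close> is padded to exactly \<open>k\<close> indices, possibly with
    zero eigenvalues: its size must be \<open>m\<close> whatever the actual rank of
    \<open>W\<close>, since \<open>harm\<close> and \<open>cond\<close> are stated with
    \<open>m\<close>.\<close>
  then obtain I where I: "{i. l i \<noteq> 0} \<subseteq> I" "card I = k"
    using exists_subset_between[of "{i. l i \<noteq> 0}" k UNIV] by (auto simp: k_def)
  define x where "x i = \<alpha> * v i" for i
  have x1: "x i = 1" if "i \<notin> I" for i
  proof -
    have "l i = 0" using that I by auto
    then show ?thesis using c T by (simp add: x_def v \<alpha>_def)
  qed
  have lx: "l i * v i = 1 - x i" for i
    using vpos[of i] unfolding x_def \<alpha>_def by (simp add: v field_simps)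
  have vx: "v i = x i / \<alpha>" for i using \<alpha> by (simp add: x_def)
  have split: "(\<Sum>i\<in>UNIV. f i) = (\<Sum>i\<in>I. f i) + (p - m) * f1"
    if "\<And>i. i \<notin> I \<Longrightarrow> f i = f1" for f :: "'p \<Rightarrow> real" and f1
  proof -
    have "(\<Sum>i\<in>UNIV. f i) = (\<Sum>i\<in>I. f i) + (\<Sum>i\<in>UNIV - I. f i)"
      by (subst sum.subset_diff[of I UNIV]) auto
    also have "(\<Sum>i\<in>UNIV - I. f i) = (\<Sum>i\<in>UNIV - I. f1)" using that by (intro sum.cong) auto
    also have "\<dots> = real (card (UNIV - I)) * f1" by simp
    also have "real (card (UNIV - I)) = p - m"
      using I by (simp add: card_Diff_subset p mk k_def of_nat_diff)
    finally show ?thesis by simp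
  qed
  define \<tau> where "\<tau> = (\<Sum>i\<in>I. x i)"
  define \<sigma> where "\<sigma> = (\<Sum>i\<in>I. (x i)^2)"
  define \<delta> where "\<delta> = (\<Sum>i\<in>I. x i * (1 - x i))"
  define \<kappa> where "\<kappa> = (\<Sum>i\<in>I. 1 - x i)"
  define \<epsilon> where "\<epsilon> = (\<Sum>i\<in>I. (x i)^2 * (1 - x i))"
  define \<phi> where "\<phi> = (\<Sum>i\<in>I. (x i)^3 * (1 - x i))"
  define \<nu> where "\<nu> = \<tau> * (A + \<tau>)"
  have st: "\<alpha> * t = \<tau> + (p - m)"
  proof -
    have "\<alpha> * t = (\<Sum>i\<in>UNIV. x i)" by (simp add: t x_def sum_distrib_left)
    then show ?thesis using split[of x 1] x1 by (simp add: \<tau>_def)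
  qed
  have ss: "\<alpha>^2 * s = \<sigma> + (p - m)"
  proof -
    have "\<alpha>^2 * s = (\<Sum>i\<in>UNIV. (x i)^2)" by (simp add: s x_def sum_distrib_left power_mult_distrib)
    then show ?thesis using split[of "\<lambda>i. (x i)^2" 1] x1 by (simp add: \<sigma>_def)
  qed
  have sK: "K = \<kappa>"
    using split[of "\<lambda>i. 1 - x i" 0] x1 by (simp add: \<kappa>_def K lx)
  have sD: "\<alpha> * D = \<delta>"
  proof -
    have "\<alpha> * D = (\<Sum>i\<in>UNIV. x i * (1 - x i))"
      unfolding D sum_distrib_left by (intro sum.cong refl, simp only: lx[symmetric]) (simp add: x_def power2_eq_square)
    then show ?thesis using split[of "\<lambda>i. x i * (1 - x i)" 0] x1 by (simp add: \<delta>_def)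
  qed
  have sE: "\<alpha>^2 * E = \<epsilon>"
  proof -
    have "\<alpha>^2 * E = (\<Sum>i\<in>UNIV. (x i)^2 * (1 - x i))"
      unfolding E sum_distrib_left by (intro sum.cong refl, simp only: lx[symmetric]) (simp add: x_def power2_eq_square power3_eq_cube)
    then show ?thesis using split[of "\<lambda>i. (x i)^2 * (1 - x i)" 0] x1 by (simp add: \<epsilon>_def)
  qed
  have sH: "\<alpha>^2 * H = \<epsilon> - \<phi>"
  proof -
    have "\<alpha>^2 * H = (\<Sum>i\<in>UNIV. (x i)^2 * (1 - x i)^2)"
      unfolding H sum_distrib_left by (intro sum.cong refl, simp only: lx[symmetric]) (simp add: x_def power_mult_distrib power2_eq_square power4_eq_xxxx)
    also have "\<dots> = (\<Sum>i\<in>I. (x i)^2 * (1 - x i)^2)" using split[of "\<lambda>i. (x i)^2 * (1 - x i)^2" 0] x1 by simp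
    also have "\<dots> = \<epsilon> - \<phi>"
      unfolding \<epsilon>_def \<phi>_def sum_subtractf[symmetric]
      by (intro sum.cong) (auto simp: power2_eq_square power3_eq_cube algebra_simps)
    finally show ?thesis .
  qed
  have "\<exists>i. l i \<noteq> 0" using T by (metis less_irrefl sum.neutral)
  then obtain i0 where "l i0 \<noteq> 0" by blast
  then have "0 < l i0 * (v i0)^2" using l[of i0] vpos[of i0] by (auto simp: less_le)
  then show D0: "0 < D"
    unfolding D using l by (intro sum_pos2[of UNIV i0]) auto
  have \<delta>0: "0 < \<delta>" using D0 \<alpha> by (simp add: sD[symmetric])
  have x01: "0 < x i \<and> x i \<le> 1" for i
    using lx[of i] l[of i] vpos[of i] \<alpha> mult_nonneg_nonneg[of "l i" "v i"] by (auto simp: x_def)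
  have harm: "(\<Sum>i\<in>I. 1 / x i) = m + 1 / c"
  proof -
    have "1 / x i = 1 + l i / \<alpha>" for i using \<alpha> by (simp add: x_def v \<alpha>_def[symmetric] add_divide_distrib)
    then have "(\<Sum>i\<in>I. 1 / x i) = m + (\<Sum>i\<in>I. l i) / \<alpha>"
      using I by (simp add: sum.distrib mk sum_divide_distrib)
    also have "(\<Sum>i\<in>I. l i) = T"
    proof -
      have "l i = 0" if "i \<notin> I" for i using that I by auto
      from split[of l 0, OF this] show ?thesis by (simp add: T)
    qed
    finally show ?thesis using T by (simp add: \<alpha>_def)
  qed
  have A0: "0 \<le> A" by (simp add: A m)
  have key: "0 \<le> (\<nu> / \<delta> - (2 * c + 1))^2 * \<delta>
    + 2 * ((A + 2 * \<tau>) * (- 2 * \<epsilon> - 2 * c * \<kappa> * \<sigma>) + 2 * c * \<kappa> * \<tau>^2) / \<delta>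
    + 4 * \<nu> * (\<epsilon> - 2 * \<phi> + 2 * c * \<kappa> * \<epsilon>) / \<delta>^2"
    by (rule shrinkage_inequality[of I m x c A])
      (use I mk m1 x01 c A0 harm cond in \<open>simp_all add: \<tau>_def \<sigma>_def \<delta>_def \<kappa>_def \<epsilon>_def \<phi>_def \<nu>_def\<close>)
  \<comment> \<open>If \<open>p > n - 1\<close>, then \<open>n - p - 1 = - A\<close>, but the
    \<open>p - m = A\<close> indices outside \<open>I\<close> shift \<open>\<alpha> * t\<close> by
    \<open>A\<close>, and \<open>- A (\<tau> + A) + (\<tau> + A)^2 = \<tau> (A + \<tau>)\<close>.
    Hence both cases lead to the same \<open>\<nu>\<close>, and the condition depends on the
    dimensions only through \<open>m\<close> and \<open>A\<close>.\<close>
  have cases: "(p = m \<and> n - p - 1 = A) \<or> (p - m = A \<and> n - p - 1 = - A)"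
    by (auto simp: A m)
  have sN: "\<alpha> * Nn = \<nu>"
  proof -
    have "\<alpha> * Nn = (n - p - 1) * (\<alpha> * t) + (\<alpha> * t)^2"
      by (simp add: Nn \<alpha>_def algebra_simps power2_eq_square)
    then show ?thesis unfolding st \<nu>_def using cases by (auto simp: algebra_simps power2_eq_square)
  qed
  have sdt: "\<alpha>^2 * dt = - 2 * \<epsilon> - 2 * c * \<kappa> * (\<sigma> + (p - m))"
    unfolding ss[symmetric] sE[symmetric] sK[symmetric] dt by (simp add: algebra_simps)
  have sdN: "\<alpha>^2 * dN = (A + 2 * \<tau>) * (- 2 * \<epsilon> - 2 * c * \<kappa> * \<sigma>) + 2 * c * \<kappa> * \<tau>^2"
  proof -
    have "\<alpha>^2 * dN = (n - p - 1) * (\<alpha>^2 * dt) + 2 * c * \<kappa> * (\<alpha> * t)^2 + 2 * (\<alpha> * t) * (\<alpha>^2 * dt)"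
      by (simp add: dN sK[symmetric] \<alpha>_def algebra_simps power2_eq_square)
    then show ?thesis unfolding st sdt using cases by (auto simp: algebra_simps power2_eq_square)
  qed
  have sdD: "\<alpha>^2 * dD = - 2 * (\<epsilon> - 2 * \<phi> + 2 * c * \<kappa> * \<epsilon>)"
  proof -
    have "\<alpha>^2 * dD = 2 * (\<alpha>^2 * E) - 4 * (\<alpha>^2 * H) - 4 * c * K * (\<alpha>^2 * E)"
      by (simp add: dD algebra_simps)
    then show ?thesis unfolding sE sH sK by (simp add: algebra_simps)
  qed
  have "\<alpha> * ((Nn / D - (2 * c + 1))^2 * D + 2 * ((dN * D - Nn * dD) / D^2))
     = ((\<alpha> * Nn) / (\<alpha> * D) - (2 * c + 1))^2 * (\<alpha> * D) + 2 * (\<alpha>^2 * dN) / (\<alpha> * D) - 2 * (\<alpha> * Nn) * (\<alpha>^2 * dD) / (\<alpha> * D)^2"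
  proof -
    have "\<alpha> * (2 * ((dN * D - Nn * dD) / D^2)) = 2 * (\<alpha>^2 * dN) / (\<alpha> * D) - 2 * (\<alpha> * Nn) * (\<alpha>^2 * dD) / (\<alpha> * D)^2"
      using \<alpha> D0 by (simp add: field_simps power2_eq_square)
    then show ?thesis using \<alpha> by (simp add: distrib_left)
  qed
  also have "\<dots> = (\<nu> / \<delta> - (2 * c + 1))^2 * \<delta>
    + 2 * ((A + 2 * \<tau>) * (- 2 * \<epsilon> - 2 * c * \<kappa> * \<sigma>) + 2 * c * \<kappa> * \<tau>^2) / \<delta>
    + 4 * \<nu> * (\<epsilon> - 2 * \<phi> + 2 * c * \<kappa> * \<epsilon>) / \<delta>^2"
  proof -
    have "a + b - 2 * \<nu> * (- 2 * e) / d = a + b + 4 * \<nu> * e / d" for a b e d :: real by simp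
    then show ?thesis unfolding sN sD sdN sdD .
  qed
  finally have "0 \<le> \<alpha> * ((Nn / D - (2 * c + 1))^2 * D + 2 * ((dN * D - Nn * dD) / D^2))"
    using key by simp
  then show "0 \<le> (Nn / D - (2 * c + 1))^2 * D + 2 * ((dN * D - Nn * dD) / D^2)"
    using \<alpha> by (simp add: zero_le_mult_iff)
qed

subsection \<open>The matrix normal density\<close>

lemma nn_integral_lborel_translate:
  fixes f :: "'a::euclidean_space \<Rightarrow> ennreal"
  assumes [measurable]: "f \<in> borel_measurable borel"
  shows "(\<integral>\<^sup>+x. f (x + a) \<partial>lborel) = (\<integral>\<^sup>+x. f x \<partial>lborel)"
proof -
  have "(\<integral>\<^sup>+x. f x \<partial>lborel) = (\<integral>\<^sup>+x. f x \<partial>distr lborel borel ((+) a))" by (simp add: lborel_distr_plus)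
  also have "\<dots> = (\<integral>\<^sup>+x. f (a + x) \<partial>lborel)" by (subst nn_integral_distr) auto
  finally show ?thesis by (simp add: add.commute)
qed

text \<open>The double integral of \<open>g (x + f y) * h (f y)\<close>, with \<open>h\<close> the indicator of the unit ball,
  is evaluated in both orders, as in the proof of uniqueness of Haar measure.\<close>

lemma nn_integral_lborel_isometry:
  fixes f :: "'a::euclidean_space \<Rightarrow> 'a" and g :: "'a \<Rightarrow> ennreal"
  assumes f: "orthogonal_transformation f" and g[measurable]: "g \<in> borel_measurable borel"
  shows "(\<integral>\<^sup>+x. g (f x) \<partial>lborel) = (\<integral>\<^sup>+x. g x \<partial>lborel)"
proof -
  have lin: "linear f" using f by (rule orthogonal_transformation_linear)
  have [measurable]: "f \<in> borel_measurable borel"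
    using lin by (simp add: borel_measurable_continuous_onI linear_continuous_on linear_conv_bounded_linear)
  obtain f' where f': "\<And>x. f (f' x) = x"
    using orthogonal_transformation_surj[OF f] by (metis surjD)
  define h where "h = (indicator (ball (0::'a) 1) :: 'a \<Rightarrow> ennreal)"
  have [measurable]: "h \<in> borel_measurable borel" unfolding h_def by (rule borel_measurable_indicator) simp
  have hf: "h (f y) = h y" for y
    using orthogonal_transformation_norm[OF f] by (simp add: h_def indicator_def)
  have hm: "h (a - x) = h (x + - a)" for a x by (simp add: h_def indicator_def norm_minus_commute)
  have "(\<integral>\<^sup>+x. g x \<partial>lborel) * (\<integral>\<^sup>+y. h y \<partial>lborel) = (\<integral>\<^sup>+y. (\<integral>\<^sup>+x. g x \<partial>lborel) * h (f y) \<partial>lborel)"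
    by (simp add: nn_integral_cmult hf)
  also have "\<dots> = (\<integral>\<^sup>+y. (\<integral>\<^sup>+x. g (x + f y) * h (f y) \<partial>lborel) \<partial>lborel)"
  proof (rule nn_integral_cong)
    fix y
    have "(\<integral>\<^sup>+x. g (x + f y) * h (f y) \<partial>lborel) = (\<integral>\<^sup>+x. g (x + f y) \<partial>lborel) * h (f y)"
      by (rule nn_integral_multc) measurable
    also have "(\<integral>\<^sup>+x. g (x + f y) \<partial>lborel) = (\<integral>\<^sup>+x. g x \<partial>lborel)"
      by (rule nn_integral_lborel_translate) measurable
    finally show "(\<integral>\<^sup>+x. g x \<partial>lborel) * h (f y) = (\<integral>\<^sup>+x. g (x + f y) * h (f y) \<partial>lborel)" ..
  qed
  also have "\<dots> = (\<integral>\<^sup>+x. (\<integral>\<^sup>+y. g (x + f y) * h (f y) \<partial>lborel) \<partial>lborel)"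
    by (rule lborel_pair.Fubini') measurable
  \<comment> \<open>For fixed \<open>x\<close>, translating \<open>y\<close> by \<open>f' x\<close>
    adds \<open>x\<close> to \<open>f y\<close>; this moves the shift from \<open>g\<close> to
    \<open>h\<close>.\<close>
  also have "\<dots> = (\<integral>\<^sup>+x. (\<integral>\<^sup>+y. g (f y) * h (f y - x) \<partial>lborel) \<partial>lborel)"
  proof (rule nn_integral_cong)
    fix x
    have "(\<integral>\<^sup>+y. g (f y) * h (f y - x) \<partial>lborel) = (\<integral>\<^sup>+y. g (f (y + f' x)) * h (f (y + f' x) - x) \<partial>lborel)"
      by (rule nn_integral_lborel_translate[symmetric]) measurable
    then show "(\<integral>\<^sup>+y. g (x + f y) * h (f y) \<partial>lborel) = (\<integral>\<^sup>+y. g (f y) * h (f y - x) \<partial>lborel)"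
      using lin f' by (simp add: linear_add add.commute)
  qed
  also have "\<dots> = (\<integral>\<^sup>+y. (\<integral>\<^sup>+x. g (f y) * h (f y - x) \<partial>lborel) \<partial>lborel)"
    by (rule lborel_pair.Fubini') measurable
  also have "\<dots> = (\<integral>\<^sup>+y. g (f y) * (\<integral>\<^sup>+x. h x \<partial>lborel) \<partial>lborel)"
  proof (rule nn_integral_cong)
    fix y
    have "(\<integral>\<^sup>+x. g (f y) * h (f y - x) \<partial>lborel) = g (f y) * (\<integral>\<^sup>+x. h (f y - x) \<partial>lborel)"
      by (rule nn_integral_cmult) measurable
    also have "(\<integral>\<^sup>+x. h (f y - x) \<partial>lborel) = (\<integral>\<^sup>+x. h x \<partial>lborel)"
      unfolding hm by (rule nn_integral_lborel_translate) measurable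
    finally show "(\<integral>\<^sup>+x. g (f y) * h (f y - x) \<partial>lborel) = g (f y) * (\<integral>\<^sup>+x. h x \<partial>lborel)" .
  qed
  also have "\<dots> = (\<integral>\<^sup>+y. g (f y) \<partial>lborel) * (\<integral>\<^sup>+x. h x \<partial>lborel)"
    by (simp add: nn_integral_multc)
  finally have *: "(\<integral>\<^sup>+x. g x \<partial>lborel) * (\<integral>\<^sup>+y. h y \<partial>lborel) = (\<integral>\<^sup>+y. g (f y) \<partial>lborel) * (\<integral>\<^sup>+x. h x \<partial>lborel)" .
  have "(\<integral>\<^sup>+x. h x \<partial>lborel) = emeasure lborel (ball (0::'a) 1)" by (simp add: h_def)
  moreover have "emeasure lborel (ball (0::'a) 1) \<noteq> \<infinity>"
    using emeasure_lborel_ball_finite[of "0::'a" 1] by simp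
  moreover have "emeasure lborel (ball (0::'a) 1) \<noteq> 0"
    using open_not_negligible[of "ball (0::'a) 1"] by (auto simp: negligible_iff_emeasure0)
  ultimately show ?thesis
    using * mult_divide_eq_ennreal[of "\<integral>\<^sup>+x. h x \<partial>lborel"] by (metis infinity_ennreal_def)
qed

section \<open>Matrices as a Euclidean space with the Frobenius inner product\<close>

abbreviation unit_mat :: "'p \<Rightarrow> 'n \<Rightarrow> real^'n^'p" where
  "unit_mat i j \<equiv> axis i (axis j 1)"

lemma Basis_mat: "(Basis :: (real^'n^'p) set) = (\<lambda>(i, j). unit_mat i j) ` UNIV"
  by (auto simp: Basis_vec_def image_iff)

lemma inj_unit_mat: "inj (\<lambda>(i, j). unit_mat i j :: real^'n^'p)"
  by (auto simp: inj_def axis_eq_axis)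

lemma prod_Basis_mat:
  "(\<Prod>b\<in>(Basis :: (real^'n^'p) set). f b) = (\<Prod>i\<in>UNIV. \<Prod>j\<in>UNIV. f (unit_mat i j))"
  unfolding Basis_mat by (subst prod.reindex[OF inj_unit_mat]) (simp add: prod.cartesian_product case_prod_unfold)

lemma sum_Basis_mat:
  "(\<Sum>b\<in>(Basis :: (real^'n^'p) set). f b) = (\<Sum>i\<in>UNIV. \<Sum>j\<in>UNIV. f (unit_mat i j))"
  unfolding Basis_mat by (subst sum.reindex[OF inj_unit_mat]) (simp add: sum.cartesian_product case_prod_unfold)

lemma inner_unit_mat: "X \<bullet> unit_mat i j = X $ i $ j" for X :: "real^'n^'p"
  by (simp add: inner_axis)

lemma inner_mat: "X \<bullet> Y = (\<Sum>i\<in>UNIV. \<Sum>j\<in>UNIV. X $ i $ j * Y $ i $ j)" for X Y :: "real^'n^'p"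
  by (simp add: inner_vec_def)

lemma inner_mat_columns: "X \<bullet> Y = (\<Sum>j\<in>UNIV. column j X \<bullet> column j Y)" for X Y :: "real^'n^'p"
  unfolding inner_mat by (subst sum.swap) (simp add: inner_vec_def column_def)

lemma inner_mat_trace: "X \<bullet> Y = trace (transpose X ** Y)" for X Y :: "real^'n^'p"
  unfolding inner_mat by (subst sum.swap) (simp add: trace_def matrix_matrix_mult_def transpose_def)

lemma inner_matrix_mult_left: "(A ** X) \<bullet> Y = X \<bullet> (transpose A ** Y)" for X :: "real^'n^'p" and A :: "real^'p^'q"
  by (simp add: inner_mat_trace matrix_transpose_mul matrix_mul_assoc)

lemma inner_matrix_mult_right: "(X ** A) \<bullet> Y = X \<bullet> (Y ** transpose A)" for X :: "real^'n^'p" and A :: "real^'q^'n"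
  by (simp add: inner_mat_trace matrix_transpose_mul matrix_mul_assoc[symmetric] trace_mul_sym[of "transpose A"])

lemma column_matrix_mult: "column j (A ** X) = A *v column j X" for X :: "real^'n^'p" and A :: "real^'p^'q"
  by (simp add: column_def matrix_matrix_mult_def matrix_vector_mult_def vec_eq_iff)

lemma orthogonal_transformation_matrix_mult:
  fixes P :: "real^'p^'p"
  assumes "orthogonal_matrix P"
  shows "orthogonal_transformation (\<lambda>X :: real^'n^'p. P ** X)"
  unfolding orthogonal_transformation_def
proof (intro conjI allI)
  show "linear (\<lambda>X :: real^'n^'p. P ** X)"
    by (intro linearI) (simp_all add: matrix_add_ldistrib matrix_scalar_ac scalar_matrix_assoc[symmetric])
  show "(P ** X) \<bullet> (P ** Y) = X \<bullet> Y" for X Y :: "real^'n^'p"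
    using assms by (simp add: inner_matrix_mult_left matrix_mul_assoc orthogonal_matrix_def)
qed

text \<open>The product of the column densities with the exponents collected into one Frobenius
  form, so that the gradient can be taken in the matrix space at once.\<close>

definition gauss_density :: "real^'p^'p \<Rightarrow> real^'n^'p \<Rightarrow> real^'n^'p \<Rightarrow> real" where
  "gauss_density S Th X = ((2 * pi) powr (- real CARD('p) / 2) * det S powr (- 1 / 2)) ^ CARD('n)
     * exp (- (1/2) * ((X - Th) \<bullet> (matrix_inv S ** (X - Th))))"

lemma prod_mvn_density:
  "(\<Prod>j\<in>UNIV. mvn_density S (column j Th) (column j X)) = gauss_density S Th X" for X Th :: "real^'n^'p"
proof -
  have "column j X - column j Th = column j (X - Th)" for j by (simp add: column_def vec_eq_iff)
  then show ?thesis
    by (simp add: mvn_density_def gauss_density_def prod.distrib exp_sum[symmetric] inner_mat_columns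
        column_matrix_mult sum_divide_distrib sum_negf)
qed

lemma data_measure_gauss: "data_measure S Th = density lborel (\<lambda>X. ennreal (gauss_density S Th X))"
  by (simp add: data_measure_def prod_mvn_density)

lemma gauss_density_nonneg: "0 \<le> gauss_density S Th X"
  by (simp add: gauss_density_def)

lemma bounded_bilinear_matrix_mult:
  "bounded_bilinear ((**) :: real^'n^'m \<Rightarrow> real^'k^'n \<Rightarrow> real^'k^'m)"
  unfolding bilinear_conv_bounded_bilinear[symmetric] bilinear_def
  by (auto intro!: linearI simp: matrix_add_ldistrib matrix_scalar_ac scalar_matrix_assoc[symmetric]
      vec_eq_iff matrix_matrix_mult_def distrib_right distrib_left sum.distrib sum_distrib_left mult_ac)

lemma diag_mat_mult_nth: "(diag_mat l ** Y) $ i $ j = l i * Y $ i $ j" for Y :: "real^'n^'p"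
proof -
  have "(if i = k then l i else 0) * Y $ k $ j = (if k = i then l i * Y $ i $ j else 0)" for k by auto
  then show ?thesis by (simp add: matrix_matrix_mult_def diag_mat_def)
qed

text \<open>Translating by \<open>Th\<close> and rotating by the eigenvectors of \<open>S\<close>
  makes the density a product of univariate normal densities, those for row \<open>i\<close> with
  variance \<open>l i\<close>. Both maps preserve Lebesgue measure.\<close>

lemma nn_integral_gauss_density:
  fixes S :: "real^'p^'p" and Th :: "real^'n^'p"
  assumes "pos_def_mat S"
  shows "(\<integral>\<^sup>+X. ennreal (gauss_density S Th X) \<partial>lborel) = 1"
proof -
  obtain P :: "real^'p^'p" and l where P: "orthogonal_matrix P" and S: "S = P ** diag_mat l ** transpose P"
    and lpos: "\<And>i. 0 < l i" using pos_def_mat_diagonalization[OF assms] by blast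
  have PP: "transpose P ** P = mat 1" "P ** transpose P = mat 1"
    using P by (auto simp: orthogonal_matrix_def)
  define Q where "Q = P ** diag_mat (\<lambda>i. 1 / l i) ** transpose P"
  have [simp]: "l i \<noteq> 0" for i using lpos[of i] by simp
  have "S ** Q = mat 1" unfolding S Q_def by (simp add: conj_diag_mat_mult[OF PP(1)] diag_mat_one PP)
  then have Qinv: "matrix_inv S = Q" by (rule matrix_inv_unique_right)
  have QP: "transpose P ** Q ** P = diag_mat (\<lambda>i. 1 / l i)"
  proof -
    have "transpose P ** Q ** P = (transpose P ** P) ** diag_mat (\<lambda>i. 1 / l i) ** (transpose P ** P)"
      unfolding Q_def by (simp only: matrix_mul_assoc)
    then show ?thesis by (simp add: PP)
  qed
  have detS: "det S = (\<Prod>i\<in>UNIV. l i)"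
  proof -
    have "det P * det (transpose P) = 1" using det_mul[of P "transpose P"] PP by simp
    moreover have "det (diag_mat l) = (\<Prod>i\<in>UNIV. l i)" by (subst det_diagonal) (auto simp: diag_mat_def)
    ultimately show ?thesis by (simp add: S det_mul)
  qed
  have const: "(2 * pi) powr (- real CARD('p) / 2) * det S powr (- 1 / 2) = (\<Prod>i\<in>UNIV. 1 / sqrt (2 * pi * (sqrt (l i))\<^sup>2))"
  proof -
    have "(\<Prod>i\<in>UNIV. 1 / sqrt (2 * pi * (sqrt (l i))\<^sup>2)) = (\<Prod>i\<in>UNIV. (2 * pi) powr (- 1 / 2) * l i powr (- 1 / 2))"
      using lpos by (intro prod.cong) (auto simp: less_imp_le powr_minus_divide powr_half_sqrt real_sqrt_mult)
    also have "\<dots> = ((2 * pi) powr (- 1 / 2)) ^ CARD('p) * det S powr (- 1 / 2)"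
      using lpos by (simp add: prod.distrib detS prod_powr_distrib less_imp_le)
    also have "((2 * pi) powr (- 1 / 2)) ^ CARD('p) = (2 * pi) powr (- real CARD('p) / 2)"
      by (simp add: powr_realpow[symmetric] powr_powr)
    finally show ?thesis ..
  qed
  \<comment> \<open>\<open>F b\<close> has to be a function of the basis matrix alone. For
    \<open>b\<close> a basis matrix the product has a single nontrivial factor, at the row of
    \<open>b\<close>, and so selects that row without a choice operator.\<close>
  define F where "F b y = (\<Prod>i\<in>UNIV. if \<exists>j. b = unit_mat i j then normal_density 0 (sqrt (l i)) y else 1)" for b :: "real^'n^'p" and y
  have F0: "0 \<le> F b y" for b y unfolding F_def by (intro prod_nonneg) auto
  have [measurable]: "F b \<in> borel_measurable borel" for b unfolding F_def by measurable
  have dens: "gauss_density S Th (P ** Y + Th) = (\<Prod>b\<in>Basis. F b (Y \<bullet> b))"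
    for Y :: "real^'n^'p"
  proof -
    have "(P ** Y) \<bullet> (Q ** (P ** Y)) = Y \<bullet> (diag_mat (\<lambda>i. 1 / l i) ** Y)"
      by (simp add: inner_matrix_mult_left matrix_mul_assoc QP)
    also have "\<dots> = (\<Sum>i\<in>UNIV. \<Sum>j\<in>UNIV. (Y $ i $ j)^2 / l i)"
      unfolding inner_mat diag_mat_mult_nth by (simp add: power2_eq_square)
    finally have e: "(P ** Y) \<bullet> (Q ** (P ** Y)) = (\<Sum>i\<in>UNIV. \<Sum>j\<in>UNIV. (Y $ i $ j)^2 / l i)" .
    have "(\<Prod>i\<in>UNIV. \<Prod>j\<in>UNIV. normal_density 0 (sqrt (l i)) (Y $ i $ j)) =
       (\<Prod>i\<in>UNIV. 1 / sqrt (2 * pi * (sqrt (l i))\<^sup>2)) ^ CARD('n) * exp (\<Sum>i\<in>UNIV. \<Sum>j\<in>UNIV. - ((Y $ i $ j)^2 / (2 * l i)))"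
      using lpos by (simp add: normal_density_def prod.distrib exp_sum less_imp_le power_one_over prod_dividef prod_power_distrib)
    also have "(\<Sum>i\<in>UNIV. \<Sum>j\<in>UNIV. - ((Y $ i $ j)^2 / (2 * l i))) = - (1/2) * ((P ** Y) \<bullet> (Q ** (P ** Y)))"
      unfolding e by (simp add: sum_distrib_left sum_negf mult.commute)
    finally have "gauss_density S Th (P ** Y + Th) = (\<Prod>i\<in>UNIV. \<Prod>j\<in>UNIV. normal_density 0 (sqrt (l i)) (Y $ i $ j))"
      unfolding gauss_density_def Qinv const by simp
    also have "\<dots> = (\<Prod>b\<in>Basis. F b (Y \<bullet> b))"
      unfolding prod_Basis_mat F_def by (intro prod.cong refl) (auto simp: axis_eq_axis inner_unit_mat)
    finally show ?thesis .
  qed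
  have [measurable]: "gauss_density S Th \<in> borel_measurable borel"
    unfolding gauss_density_def
    by (intro borel_measurable_continuous_onI continuous_intros
        bounded_bilinear.continuous_on[OF bounded_bilinear_matrix_mult])
  have "(\<integral>\<^sup>+X. ennreal (gauss_density S Th X) \<partial>lborel) = (\<integral>\<^sup>+X. ennreal (gauss_density S Th (X + Th)) \<partial>lborel)"
    by (rule nn_integral_lborel_translate[symmetric]) measurable
  also have "\<dots> = (\<integral>\<^sup>+Y. ennreal (gauss_density S Th (P ** Y + Th)) \<partial>lborel)"
    by (rule nn_integral_lborel_isometry[OF orthogonal_transformation_matrix_mult[OF P], symmetric]) measurable
  also have "\<dots> = (\<integral>\<^sup>+Y. (\<Prod>b\<in>Basis. ennreal (F b (Y \<bullet> b))) \<partial>lborel)"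
    unfolding dens by (intro nn_integral_cong) (simp add: prod_ennreal F0)
  also have "\<dots> = (\<Prod>b\<in>(Basis :: (real^'n^'p) set). (\<integral>\<^sup>+y. ennreal (F b y) \<partial>lborel))"
    by (rule nn_integral_lborel_prod) auto
  also have "\<dots> = 1"
  proof (rule prod.neutral, rule ballI)
    fix b :: "real^'n^'p" assume "b \<in> Basis"
    then obtain i0 j0 where b: "b = unit_mat i0 j0" by (auto simp: Basis_mat)
    have "F b y = normal_density 0 (sqrt (l i0)) y" for y
      by (simp add: F_def b axis_eq_axis)
    then show "(\<integral>\<^sup>+y. ennreal (F b y) \<partial>lborel) = 1"
      using lpos[of i0] by (simp add: nn_integral_eq_integral)
  qed
  finally show ?thesis .
qed

subsection \<open>Differentiation of matrix-valued maps\<close>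

lemma C1_on_cong:
  assumes "C1_on U f f'" "\<And>x h. x \<in> U \<Longrightarrow> f' x h = g' x h"
  shows "C1_on U f g'"
  unfolding C1_on_def
proof (intro conjI ballI allI)
  show "(f has_derivative g' x) (at x)" if "x \<in> U" for x
  proof -
    have "f' x = g' x" using assms(2)[OF that] by (rule ext)
    then show ?thesis using C1_on_der[OF assms(1) that] by simp
  qed
  show "continuous_on U (\<lambda>x. g' x h)" for h
    using C1_on_cont_der[OF assms(1)] by (rule continuous_on_eq) (rule assms(2))
qed

lemmas C1_on_matrix_mult = C1_on_bilinear[OF bounded_bilinear_matrix_mult]

text \<open>The resolvent identity; the continuity and the derivative of the inverse are both read
  off from it.\<close>

lemma matrix_inv_diff:
  fixes A B :: "real^'p^'p"
  assumes "invertible A" "invertible B"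
  shows "matrix_inv B - matrix_inv A = - (matrix_inv B ** ((B - A) ** matrix_inv A))"
proof -
  have inv: "A ** matrix_inv A = mat 1" "matrix_inv B ** B = mat 1"
    using someI_ex[OF assms(1)[unfolded invertible_def]] someI_ex[OF assms(2)[unfolded invertible_def]]
    by (auto simp: matrix_inv_def)
  interpret bounded_bilinear "(**) :: real^'p^'p \<Rightarrow> real^'p^'p \<Rightarrow> real^'p^'p" by (rule bounded_bilinear_matrix_mult)
  have "matrix_inv B ** ((B - A) ** matrix_inv A) = (matrix_inv B ** B) ** matrix_inv A - matrix_inv B ** (A ** matrix_inv A)"
    by (simp add: diff_left diff_right matrix_mul_assoc)
  then show ?thesis by (simp add: inv)
qed

text \<open>A bootstrap: near \<open>x\<close> the resolvent identity gives
  \<open>norm (V y) \<le> norm (V x) + norm (V y) / 2\<close>, so \<open>V\<close> stays bounded,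
  and the same identity then forces convergence.\<close>

lemma tendsto_matrix_inv:
  fixes M :: "'a::t2_space \<Rightarrow> real^'p^'p"
  assumes M: "(M \<longlongrightarrow> M x) (at x)" and inv: "invertible (M x)" "\<forall>\<^sub>F y in at x. invertible (M y)"
  shows "((\<lambda>y. matrix_inv (M y)) \<longlongrightarrow> matrix_inv (M x)) (at x)"
proof -
  interpret bounded_bilinear "(**) :: real^'p^'p \<Rightarrow> real^'p^'p \<Rightarrow> real^'p^'p" by (rule bounded_bilinear_matrix_mult)
  define V where "V y = matrix_inv (M y)" for y
  from pos_bounded obtain K where "K > 0 \<and> (\<forall>(A :: real^'p^'p) (B :: real^'p^'p). norm (A ** B) \<le> norm A * norm B * K)"
    by (elim exE) (rule that)
  then have K: "K > 0" "\<And>(A :: real^'p^'p) (B :: real^'p^'p). norm (A ** B) \<le> norm A * norm B * K" by auto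
  have D: "((\<lambda>y. (M y - M x) ** V x) \<longlongrightarrow> 0) (at x)"
    using tendsto_left_zero[of "\<lambda>y. M y - M x" "at x" "V x"] M by (simp add: LIM_zero_iff)
  have eq: "\<forall>\<^sub>F y in at x. V y - V x = - (V y ** ((M y - M x) ** V x))"
    using inv(2) by eventually_elim (simp add: V_def matrix_inv_diff inv(1))
  have "\<forall>\<^sub>F y in at x. norm ((M y - M x) ** V x) < 1 / (2 * K)"
    using D K by (intro order_tendstoD(2)[OF tendsto_norm_zero]) auto
  then have "\<forall>\<^sub>F y in at x. norm (V y) \<le> 2 * norm (V x)"
    using eq
  proof eventually_elim
    case (elim y)
    have "norm (V y) \<le> norm (V x) + norm (V y - V x)" by (metis add.commute norm_triangle_sub)
    also have "norm (V y - V x) \<le> norm (V y) * norm ((M y - M x) ** V x) * K"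
      unfolding elim(2) norm_minus_cancel by (rule K)
    also have "\<dots> \<le> norm (V y) * (1 / (2 * K)) * K"
      using K elim(1) by (intro mult_right_mono mult_left_mono) auto
    also have "\<dots> = norm (V y) / 2" using K by simp
    finally show ?case by simp
  qed
  then have "Bfun V (at x)" by (rule BfunI)
  then have "Zfun (\<lambda>y. V y ** ((M y - M x) ** V x)) (at x)"
    by (rule Bfun_prod_Zfun) (use D in \<open>simp add: tendsto_Zfun_iff\<close>)
  then have "((\<lambda>y. - (V y ** ((M y - M x) ** V x))) \<longlongrightarrow> 0) (at x)"
    by (intro tendsto_minus_cancel_left[THEN iffD1]) (simp add: tendsto_Zfun_iff)
  then have "((\<lambda>y. V y - V x) \<longlongrightarrow> 0) (at x)"
    using eq by (subst tendsto_cong)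
  then show ?thesis by (simp add: V_def LIM_zero_iff)
qed

text \<open>Splitting \<open>M y - M x\<close> in the resolvent identity into its linear part and a
  remainder leaves only errors that are small relative to \<open>norm (y - x)\<close>. Invertibility
  nearby is a hypothesis, immediate on an open set of invertibility.\<close>

lemma has_derivative_matrix_inv:
  fixes M :: "'a::real_normed_vector \<Rightarrow> real^'p^'p"
  assumes M: "(M has_derivative M') (at x)" and inv: "invertible (M x)" "\<forall>\<^sub>F y in at x. invertible (M y)"
  shows "((\<lambda>y. matrix_inv (M y)) has_derivative (\<lambda>h. - (matrix_inv (M x) ** M' h ** matrix_inv (M x)))) (at x)"
proof -
  interpret bounded_bilinear "(**) :: real^'p^'p \<Rightarrow> real^'p^'p \<Rightarrow> real^'p^'p" by (rule bounded_bilinear_matrix_mult)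
  define V where "V y = matrix_inv (M y)" for y
  have bl: "bounded_linear M'" using M by (rule has_derivative_bounded_linear)
  have cont: "(V \<longlongrightarrow> V x) (at x)"
    unfolding V_def using has_derivative_continuous[OF M] inv
    by (intro tendsto_matrix_inv) (auto simp: isCont_def)
  \<comment> \<open>Scaled by the distance, the remainder \<open>r\<close> tends to 0 while the
    linear part \<open>q\<close> is merely bounded. The error term with \<open>q\<close> is small
    because \<open>V y\<close> tends to \<open>V x\<close>.\<close>
  define r where "r y = ((M y - M x) - M' (y - x)) /\<^sub>R norm (y - x)" for y
  define q where "q y = M' (y - x) /\<^sub>R norm (y - x)" for y
  have r: "Zfun r (at x)" using M unfolding has_derivative_within r_def tendsto_Zfun_iff by (simp add: diff_diff_eq inverse_eq_divide)
  have q: "Bfun q (at x)"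
  proof -
    from bounded_linear.pos_bounded[OF bl] obtain B where "B > 0 \<and> (\<forall>h. norm (M' h) \<le> norm h * B)"
      by (elim exE) (rule that)
    then have B: "\<And>h. norm (M' h) \<le> norm h * B" "B > 0" by auto
    have "norm (q y) \<le> B" for y
    proof (cases "y = x")
      case True
      then show ?thesis using B by (simp add: q_def)
    next
      case False
      then show ?thesis using B(1)[of "y - x"] by (simp add: q_def divide_simps mult.commute)
    qed
    then show ?thesis by (intro BfunI[of _ B]) simp
  qed
  have V0: "Zfun (\<lambda>y. V y - V x) (at x)" using cont tendsto_Zfun_iff by blast
  have "Zfun (\<lambda>y. - ((V y - V x) ** r y ** V x + (V y - V x) ** q y ** V x + V x ** r y ** V x)) (at x)"
    by (intro Zfun_minus Zfun_add Zfun_left[OF Zfun[OF V0 r]] Zfun_left[OF Zfun_prod_Bfun[OF V0 q]]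
        Zfun_left[OF Zfun_right[OF r]])
  then have lim: "((\<lambda>y. - ((V y - V x) ** r y ** V x + (V y - V x) ** q y ** V x + V x ** r y ** V x)) \<longlongrightarrow> 0) (at x)"
    by (simp add: tendsto_Zfun_iff)
  have bl': "bounded_linear (\<lambda>h. - (V x ** M' h ** V x))"
    by (intro bounded_linear_minus bounded_linear_compose[OF bounded_linear_left] bounded_linear_compose[OF bounded_linear_right] bl)
  have "((\<lambda>y. (V y - V x - - (V x ** M' (y - x) ** V x)) /\<^sub>R norm (y - x)) \<longlongrightarrow> 0) (at x)"
  proof (rule Lim_transform_eventually[OF lim])
    show "\<forall>\<^sub>F y in at x. - ((V y - V x) ** r y ** V x + (V y - V x) ** q y ** V x + V x ** r y ** V x)
        = (V y - V x - - (V x ** M' (y - x) ** V x)) /\<^sub>R norm (y - x)"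
      using inv(2)
    proof eventually_elim
      case (elim y)
      have rq: "r y + q y = (M y - M x) /\<^sub>R norm (y - x)"
        by (simp add: r_def q_def scaleR_diff_right)
      have "(V y - V x) ** r y ** V x + (V y - V x) ** q y ** V x + V x ** r y ** V x
          = (V y - V x) ** (r y + q y) ** V x + V x ** r y ** V x"
        by (simp add: add_left add_right)
      also have "\<dots> = (V y ** (M y - M x) ** V x - V x ** M' (y - x) ** V x) /\<^sub>R norm (y - x)"
        unfolding rq unfolding r_def
        by (simp add: diff_left diff_right scaleR_left scaleR_right scaleR_diff_right)
      also have "V y ** (M y - M x) ** V x = - (V y - V x)"
        using matrix_inv_diff[OF inv(1) elim] by (simp add: V_def matrix_mul_assoc)
      finally show ?case by (simp add: scaleR_diff_right scaleR_add_right algebra_simps)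
    qed
  qed
  then show ?thesis
    using bl' unfolding has_derivative_within V_def[symmetric]
    by (simp add: diff_diff_eq diff_diff_eq2 diff_add_eq inverse_eq_divide)
qed

lemma C1_on_matrix_inv:
  fixes M :: "'a::euclidean_space \<Rightarrow> real^'p^'p"
  assumes U: "open U" and M: "C1_on U M M'" and inv: "\<And>x. x \<in> U \<Longrightarrow> invertible (M x)"
  shows "C1_on U (\<lambda>x. matrix_inv (M x)) (\<lambda>x h. - (matrix_inv (M x) ** M' x h ** matrix_inv (M x)))"
proof -
  have der: "((\<lambda>y. matrix_inv (M y)) has_derivative (\<lambda>h. - (matrix_inv (M x) ** M' x h ** matrix_inv (M x)))) (at x)"
    if "x \<in> U" for x
  proof (rule has_derivative_matrix_inv[OF C1_on_der[OF M that] inv[OF that]])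
    show "\<forall>\<^sub>F y in at x. invertible (M y)"
      using eventually_at_in_open'[OF U that] by eventually_elim (rule inv)
  qed
  then have "continuous_on U (\<lambda>x. matrix_inv (M x))"
    by (meson continuous_at_imp_continuous_on has_derivative_continuous)
  then show ?thesis
    unfolding C1_on_def using der C1_on_cont_der[OF M]
    by (auto intro!: continuous_on_minus bounded_bilinear.continuous_on[OF bounded_bilinear_matrix_mult])
qed

text \<open>The left side is the trace of the linear map taking \<open>b\<close> to
  \<open>A ** b ** B\<close>; divergences of matrix fields take this form.\<close>

lemma sum_Basis_inner_sandwich:
  fixes A :: "real^'p^'p" and B :: "real^'n^'n"
  shows "(\<Sum>b\<in>Basis. (A ** b ** B) \<bullet> b) = trace A * trace B"
proof -
  have "(A ** unit_mat i j ** B) $ i $ j = A $ i $ i * B $ j $ j" for i j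
  proof -
    have "(A ** unit_mat i j) $ i $ k = (if k = j then A $ i $ i else 0)" for k
    proof -
      have "A $ i $ m * unit_mat i j $ m $ k = (if m = i then (if k = j then A $ i $ i else 0) else 0)" for m
        by (auto simp: axis_def)
      then show ?thesis by (simp add: matrix_matrix_mult_def)
    qed
    then show ?thesis
      by (simp add: matrix_matrix_mult_def[of "A ** unit_mat i j"] if_distrib[of "\<lambda>z. z * _"] cong: if_cong)
  qed
  then show ?thesis
    unfolding sum_Basis_mat inner_unit_mat by (simp add: trace_def sum_product)
qed

text \<open>With \<open>b\<close> transposed the indices of \<open>A\<close> and \<open>B\<close>
  contract pairwise, so one inner product replaces the product of traces. Together the two formulas
  handle the two summands in the differential of \<open>W\<close>.\<close>

lemma sum_Basis_inner_sandwich_transpose: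
  fixes A B :: "real^'n^'p"
  shows "(\<Sum>b\<in>Basis. (A ** transpose b ** B) \<bullet> b) = A \<bullet> B"
proof -
  have "(A ** transpose (unit_mat i j :: real^'n^'p) ** B) $ i $ j = A $ i $ j * B $ i $ j" for i j
  proof -
    have "(A ** transpose (unit_mat i j :: real^'n^'p)) $ i $ k = (if k = i then A $ i $ j else 0)" for k
    proof -
      have "A $ i $ m * transpose (unit_mat i j :: real^'n^'p) $ m $ k = (if m = j then (if k = i then A $ i $ j else 0) else 0)" for m
        by (auto simp: axis_def transpose_def)
      then show ?thesis by (simp add: matrix_matrix_mult_def)
    qed
    then show ?thesis
      by (simp add: matrix_matrix_mult_def[of "A ** transpose (unit_mat i j :: real^'n^'p)"] if_distrib[of "\<lambda>z. z * _"] cong: if_cong)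
  qed
  then show ?thesis
    unfolding sum_Basis_mat inner_unit_mat by (simp add: inner_mat)
qed

lemma sum_Basis_linear_form:
  fixes L :: "'a::euclidean_space \<Rightarrow> real"
  assumes "linear L"
  shows "(\<Sum>b\<in>Basis. L b * (Y \<bullet> b)) = L Y"
proof -
  have "L Y = L (\<Sum>b\<in>Basis. (Y \<bullet> b) *\<^sub>R b)" by (simp add: euclidean_representation)
  also have "\<dots> = (\<Sum>b\<in>Basis. L b * (Y \<bullet> b))"
    using assms by (simp add: linear_sum linear_cmul mult.commute)
  finally show ?thesis ..
qed

section \<open>The centering projection\<close>

text \<open>Subtracting the row means is right multiplication by a symmetric idempotent of trace
  \<open>n - 1\<close>. In this form centering is linear and commutes with every left
  factor.\<close>

definition center_mat :: "real^'n^'n" where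
  "center_mat = mat 1 - (\<chi> i j. 1 / real CARD('n))"

lemma center_mat: "X - mean_mat X = X ** center_mat" for X :: "real^'n^'p"
proof -
  have "X ** (\<chi> i j. 1 / real CARD('n)) = mean_mat X"
    by (simp add: matrix_matrix_mult_def mean_mat_def vec_eq_iff sum_divide_distrib)
  then show ?thesis
    unfolding center_mat_def
    by (simp add: bounded_bilinear.diff_right[OF bounded_bilinear_matrix_mult])
qed

lemma transpose_center_mat: "transpose center_mat = center_mat"
  by (auto simp: center_mat_def transpose_def mat_def vec_eq_iff)

lemma center_mat_idem: "(center_mat :: real^'n^'n) ** center_mat = center_mat"
proof -
  let ?C = "center_mat :: real^'n^'n"
  have "mean_mat (?C) = 0"
  proof -
    have "(\<Sum>k\<in>UNIV. ?C $ i $ k) = 0" for i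
      by (simp add: center_mat_def mat_def sum_subtractf)
    then show ?thesis by (simp add: mean_mat_def vec_eq_iff)
  qed
  then show ?thesis using center_mat[of ?C] by simp
qed

lemma trace_center_mat: "trace (center_mat :: real^'n^'n) = real CARD('n) - 1"
  by (simp add: center_mat_def trace_def mat_def sum_subtractf field_simps)

lemma bounded_linear_trace: "bounded_linear (trace :: real^'p^'p \<Rightarrow> real)"
  unfolding linear_conv_bounded_linear[symmetric] trace_def
  by (auto intro!: linearI simp: sum.distrib sum_distrib_left)

lemma bounded_linear_transpose: "bounded_linear (transpose :: real^'n^'p \<Rightarrow> real^'p^'n)"
  unfolding linear_conv_bounded_linear[symmetric]
  by (auto intro!: linearI simp: transpose_def vec_eq_iff)

subsection \<open>Derivatives of the shrinkage statistics\<close>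

lemmas matrix_mult_linear =
  bounded_bilinear.add_left[OF bounded_bilinear_matrix_mult]
  bounded_bilinear.add_right[OF bounded_bilinear_matrix_mult]
  bounded_bilinear.minus_left[OF bounded_bilinear_matrix_mult]
  bounded_bilinear.minus_right[OF bounded_bilinear_matrix_mult]
  bounded_bilinear.diff_left[OF bounded_bilinear_matrix_mult]
  bounded_bilinear.diff_right[OF bounded_bilinear_matrix_mult]
  bounded_bilinear.scaleR_left[OF bounded_bilinear_matrix_mult]
  bounded_bilinear.scaleR_right[OF bounded_bilinear_matrix_mult]

lemmas trace_linear =
  linear_0[OF bounded_linear.linear[OF bounded_linear_trace]]
  linear_diff[OF bounded_linear.linear[OF bounded_linear_trace]]
  linear_add[OF bounded_linear.linear[OF bounded_linear_trace]]
  linear_cmul[OF bounded_linear.linear[OF bounded_linear_trace]]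
  linear_neg[OF bounded_linear.linear[OF bounded_linear_trace]]

lemma transpose_scaleR: "transpose (r *\<^sub>R A) = r *\<^sub>R transpose A" for A :: "real^'n^'p"
  by (simp add: transpose_def vec_eq_iff)

lemma transpose_add: "transpose (A + B) = transpose A + transpose B" for A :: "real^'n^'p"
  by (simp add: transpose_def vec_eq_iff)

lemma transpose_mat_one: "transpose (mat 1 :: real^'p^'p) = mat 1"
  by (auto simp: transpose_def mat_def vec_eq_iff)

lemma conj_diag_mat_add:
  "P ** diag_mat k ** Q + P ** diag_mat k' ** Q = P ** diag_mat (\<lambda>i. k i + k' i) ** Q"
  by (simp add: diag_mat_add[symmetric] matrix_mult_linear)

lemma scaleR_conj_diag_mat:
  "r *\<^sub>R (P ** diag_mat k ** Q) = P ** diag_mat (\<lambda>i. r * k i) ** Q"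
  by (simp add: scaleR_diag_mat[symmetric] matrix_mult_linear)

lemma trace_conj_diag_mat:
  "Q ** P = mat 1 \<Longrightarrow> trace (P ** diag_mat k ** Q) = (\<Sum>i\<in>UNIV. k i)"
  by (simp add: trace_mul_sym[of "P ** diag_mat k"] matrix_mul_assoc trace_diag_mat)

section \<open>The statistics \<open>W\<close>, \<open>T\<close>, \<open>V\<close> and the set where
  they are smooth\<close>

locale shrinkage =
  fixes S :: "real^'p^'p" and c :: real and Th :: "real^'n^'p" and m A0 :: real
  assumes pd: "pos_def_mat S" and c0: "0 < c" and n2: "2 \<le> CARD('n)"
    and m: "m = min (real CARD('p)) (real CARD('n) - 1)"
    and A0: "A0 = max (real CARD('p)) (real CARD('n) - 1) - m"
    and cond: "(m * A0 + m^2 - 16 + 4 / m) * c^2 + ((m + 1) * A0 + m^2 - 8 * m - 18) * c + A0 - 14 \<ge> 0"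
begin

abbreviation "Q \<equiv> matrix_inv S"
abbreviation W :: "real^'n^'p \<Rightarrow> real^'p^'p" where "W \<equiv> W_mat S"
abbreviation V :: "real^'n^'p \<Rightarrow> real^'p^'p" where "V \<equiv> V_mat c S"
definition Z :: "real^'n^'p \<Rightarrow> real^'n^'p" where "Z X = X ** center_mat"
definition T :: "real^'n^'p \<Rightarrow> real" where "T X = trace (W X)"
text \<open>\<open>T X\<close> is a positive definite quadratic form in \<open>Z X\<close>, so this
  is the open set of matrices whose columns are not all equal.\<close>

definition U :: "(real^'n^'p) set" where "U = {X. 0 < T X}"

lemma Z_eq: "X - mean_mat X = Z X" by (simp add: Z_def center_mat)

lemma Z_idem: "Z (Z X) = Z X"
  by (simp add: Z_def matrix_mul_assoc[symmetric] center_mat_idem)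

lemma Z_matrix_mult: "Z (A ** X) = A ** Z X"
  by (simp add: Z_def matrix_mul_assoc)

lemma inner_Z: "Z X \<bullet> Y = X \<bullet> Z Y"
  by (simp add: Z_def inner_matrix_mult_right transpose_center_mat)

text \<open>One centered factor suffices, as the projection is symmetric and idempotent. Hence the
  derivative of \<open>W\<close> can be written with \<open>h\<close> in place of
  \<open>Z h\<close>.\<close>

lemma Z_mult_transpose: "Z X ** transpose (Z Y) = X ** transpose (Z Y)"
proof -
  have "Z X ** transpose (Z Y) = X ** (center_mat ** center_mat) ** transpose Y"
    by (simp only: Z_def matrix_transpose_mul transpose_center_mat matrix_mul_assoc)
  also have "\<dots> = X ** transpose (Z Y)"
    by (simp add: center_mat_idem Z_def matrix_transpose_mul transpose_center_mat matrix_mul_assoc)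
  finally show ?thesis .
qed

lemma bounded_linear_Z: "bounded_linear Z"
  unfolding Z_def by (rule bounded_bilinear.bounded_linear_left[OF bounded_bilinear_matrix_mult])

lemma Q_sym: "transpose Q = Q"
proof -
  obtain A B where "transpose B = B" "matrix_inv S = B ** B"
    using pos_def_mat_sqrt[OF pd] by metis
  then show ?thesis by (simp add: matrix_transpose_mul)
qed

lemma W_eq: "W X = Z X ** transpose (Z X) ** Q"
  by (simp add: W_mat_def Z_eq)

text \<open>Cyclicity of the trace, with \<open>Q\<close> symmetric. It turns the inner products of
  the risk estimate into traces of functions of \<open>W\<close>.\<close>

lemma inner_QZ: "(M ** Z X) \<bullet> (Q ** Z X) = trace (M ** W X)"
proof -
  have "(M ** Z X) \<bullet> (Q ** Z X) = (Q ** Z X) \<bullet> (M ** Z X)" by (rule inner_commute)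
  also have "\<dots> = trace (transpose (Z X) ** (Q ** (M ** Z X)))"
    by (simp add: inner_mat_trace matrix_transpose_mul Q_sym matrix_mul_assoc)
  also have "\<dots> = trace (Q ** (M ** Z X) ** transpose (Z X))" by (rule trace_mul_sym)
  also have "\<dots> = trace (Q ** (M ** Z X ** transpose (Z X)))" by (simp only: matrix_mul_assoc)
  also have "\<dots> = trace (M ** Z X ** transpose (Z X) ** Q)" by (rule trace_mul_sym)
  finally show ?thesis by (simp only: W_eq matrix_mul_assoc)
qed

definition W' :: "real^'n^'p \<Rightarrow> real^'n^'p \<Rightarrow> real^'p^'p" where
  "W' X h = (h ** transpose (Z X) + Z X ** transpose h) ** Q"

definition T' :: "real^'n^'p \<Rightarrow> real^'n^'p \<Rightarrow> real" where
  "T' X h = 2 * (h \<bullet> (Q ** Z X))"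

lemma trace_W': "trace (W' X h) = T' X h"
proof -
  have "trace (h ** transpose (Z X) ** Q) = (Q ** Z X) \<bullet> h"
    by (simp add: inner_mat_trace matrix_transpose_mul Q_sym matrix_mul_assoc[symmetric] trace_mul_sym[of h])
  moreover have "trace (Z X ** transpose h ** Q) = h \<bullet> (Q ** Z X)"
    by (simp add: inner_mat_trace matrix_mul_assoc[symmetric] trace_mul_sym[of "Z X"])
  ultimately show ?thesis
    by (simp add: W'_def T'_def matrix_mult_linear trace_linear inner_commute)
qed

lemma C1_W: "C1_on A W W'"
proof -
  have "C1_on A (\<lambda>X. Z X ** transpose (Z X)) (\<lambda>X h. Z X ** transpose (Z h) + Z h ** transpose (Z X))"
    by (intro C1_on_matrix_mult C1_on_linear_comp[OF bounded_linear_transpose] C1_on_linear bounded_linear_Z)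
  then have "C1_on A (\<lambda>X. Z X ** transpose (Z X) ** Q) (\<lambda>X h. (Z X ** transpose (Z h) + Z h ** transpose (Z X)) ** Q)"
    by (rule C1_on_linear_comp[OF bounded_bilinear.bounded_linear_left[OF bounded_bilinear_matrix_mult]])
  then have "C1_on A W (\<lambda>X h. (Z X ** transpose (Z h) + Z h ** transpose (Z X)) ** Q)"
    by (simp add: W_eq[abs_def])
  then show ?thesis
  proof (rule C1_on_cong)
    fix X h
    have "Z X ** transpose (Z h) = transpose (Z h ** transpose (Z X))" by (simp add: matrix_transpose_mul)
    also have "\<dots> = Z X ** transpose h" unfolding Z_mult_transpose by (simp add: matrix_transpose_mul)
    finally show "(Z X ** transpose (Z h) + Z h ** transpose (Z X)) ** Q = W' X h"
      by (simp add: W'_def Z_mult_transpose add.commute)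
  qed
qed

lemma C1_T: "C1_on A T T'"
  using C1_on_linear_comp[OF bounded_linear_trace C1_W, of A] by (simp add: trace_W' T_def[abs_def])

lemma open_U: "open U"
  unfolding U_def using C1_on_cont[OF C1_T[of UNIV]] by (intro open_Collect_less) auto

definition M :: "real^'n^'p \<Rightarrow> real^'p^'p" where "M X = W X + (c * T X) *\<^sub>R mat 1"
definition M' :: "real^'n^'p \<Rightarrow> real^'n^'p \<Rightarrow> real^'p^'p" where "M' X h = W' X h + (c * T' X h) *\<^sub>R mat 1"
definition V' :: "real^'n^'p \<Rightarrow> real^'n^'p \<Rightarrow> real^'p^'p" where "V' X h = - (V X ** M' X h ** V X)"

lemma V_eq: "V X = matrix_inv (M X)"
  by (simp add: V_mat_def M_def T_def)

text \<open>\<open>V\<close> is a function of \<open>W\<close>, so one basis diagonalizes both; on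
  \<open>U\<close> the ridge is positive and \<open>M\<close> is invertible even if \<open>W\<close>
  is singular.\<close>

lemma spectral:
  assumes "X \<in> U"
  obtains R Ri :: "real^'p^'p" and l v where "R ** Ri = mat 1" "Ri ** R = mat 1"
    "W X = R ** diag_mat l ** Ri" "V X = R ** diag_mat v ** Ri" "M X ** V X = mat 1" "invertible (M X)"
    "\<And>i. 0 \<le> l i" "card {i. l i \<noteq> 0} \<le> CARD('n) - 1" "T X = (\<Sum>i\<in>UNIV. l i)" "0 < T X"
    "\<And>i. v i = 1 / (l i + c * T X)"
proof -
  obtain R Ri :: "real^'p^'p" and l where R: "R ** Ri = mat 1" "Ri ** R = mat 1"
    and W: "W X = R ** diag_mat l ** Ri" and l: "\<And>i. 0 \<le> l i" "card {i. l i \<noteq> 0} \<le> CARD('n) - 1"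
    using W_mat_spectral[OF pd] by blast
  have T0: "0 < T X" using assms by (simp add: U_def)
  define v where "v i = 1 / (l i + c * T X)" for i
  have pos: "l i + c * T X \<noteq> 0" for i
    using add_nonneg_pos[OF l(1)[of i] mult_pos_pos[OF c0 T0]] by simp
  have one: "mat 1 = R ** diag_mat (\<lambda>i. 1) ** Ri" by (simp add: diag_mat_one R)
  have "M X = R ** diag_mat (\<lambda>i. l i + c * T X) ** Ri"
    unfolding M_def W one scaleR_conj_diag_mat conj_diag_mat_add by simp
  then have MV: "M X ** (R ** diag_mat v ** Ri) = mat 1"
    using pos by (simp add: conj_diag_mat_mult[OF R(2)] v_def one)
  have "V X = R ** diag_mat v ** Ri" unfolding V_eq using MV by (rule matrix_inv_unique_right)
  with R W MV l T0 v_def that[of R Ri l v] matrix_inv_unique_right(2)[OF MV] show ?thesis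
    by (simp add: T_def trace_conj_diag_mat)
qed

lemma C1_M: "C1_on A M M'"
  unfolding M_def[abs_def] M'_def[abs_def]
proof (intro C1_on_add C1_W)
  have "bounded_linear (\<lambda>r. (c * r) *\<^sub>R (mat 1 :: real^'p^'p))"
    by (intro bounded_linear_scaleR_const bounded_linear_mult_right)
  then show "C1_on A (\<lambda>x. (c * T x) *\<^sub>R (mat 1 :: real^'p^'p)) (\<lambda>x h. (c * T' x h) *\<^sub>R mat 1)"
    by (rule C1_on_linear_comp[OF _ C1_T])
qed

lemma C1_V: "C1_on U V V'"
  unfolding V_eq[abs_def] V'_def[abs_def]
  by (rule C1_on_matrix_inv[OF open_U C1_M]) (use spectral in blast)

text \<open>\<open>W\<close> is self-adjoint for the inner product weighted by \<open>Q\<close>,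
  hence so are \<open>M\<close> and its inverse \<open>V\<close>.\<close>

lemma V_transpose: assumes "X \<in> U" shows "transpose (V X) ** Q = Q ** V X"
proof -
  have MV: "M X ** V X = mat 1" using spectral[OF assms] by blast
  have "transpose (W X) ** Q = Q ** W X"
    by (simp add: W_eq matrix_transpose_mul Q_sym matrix_mul_assoc)
  then have "transpose (M X) ** Q = Q ** M X"
    by (simp add: M_def transpose_add transpose_scaleR transpose_mat_one matrix_mult_linear)
  then have "transpose (V X) ** (transpose (M X) ** Q) ** V X = transpose (V X) ** Q ** (M X ** V X)"
    by (simp add: matrix_mul_assoc)
  moreover have "transpose (V X) ** (transpose (M X) ** Q) ** V X = transpose (M X ** V X) ** Q ** V X"
    by (simp add: matrix_transpose_mul matrix_mul_assoc)
  ultimately show ?thesis by (simp add: MV transpose_mat_one)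
qed

end

subsection \<open>Unbiased estimate of the risk difference\<close>

context shrinkage
begin

definition t where "t X = trace (V X)"
definition t' where "t' X h = trace (V' X h)"
definition D where "D X = trace (V X ** V X ** W X)"
definition D' where "D' X h = trace (V X ** V X ** W' X h + (V X ** V' X h + V' X h ** V X) ** W X)"
definition K where "K X = trace (V X ** W X)"
definition K' where "K' X h = trace (V X ** W' X h + V' X h ** W X)"
text \<open>Products in place of powers and \<open>inverse\<close> in place of division let the
  primed definitions follow the shape that the product and inverse rules for \<open>C1_on\<close>
  produce.\<close>

definition N where "N X = (real CARD('n) - real CARD('p) - 1) * t X + (c * T X) * (t X * t X)"
definition N' where "N' X h = (real CARD('n) - real CARD('p) - 1) * t' X h
    + ((c * T X) * (t X * t' X h + t' X h * t X) + (c * T' X h) * (t X * t X))"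
definition a where "a X = N X * inverse (D X) - (2 * c + 1)"
definition a' where "a' X h = N X * (- inverse ((D X)^2) * D' X h) + N' X h * inverse (D X)"
definition q where "q = (real CARD('n) - 1) * real CARD('p) - 2"
definition b where "b X = q - K X * a X"
definition b' where "b' X h = - (K X * a' X h + K' X h * a X)"
definition g where "g X = b X * inverse (T X)"
definition g' where "g' X h = b X * (- inverse ((T X)^2) * T' X h) + b' X h * inverse (T X)"
definition G where "G X = a X *\<^sub>R V X + g X *\<^sub>R mat 1"
definition G' where "G' X h = (a X *\<^sub>R V' X h + a' X h *\<^sub>R V X) + g' X h *\<^sub>R mat 1"
definition Phi where "Phi X = G X ** Z X"
definition Phi' where "Phi' X h = G X ** Z h + G' X h ** Z X"

lemma double_shrink_est_eq: "double_shrink_est c S X = X - Phi X"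
proof -
  have "a_S c S X = a X"
    by (simp add: a_S_def Let_def a_def N_def D_def t_def T_def divide_inverse power2_eq_square)
  moreover from this have "b_S c S X = b X"
    by (simp add: b_S_def b_def q_def K_def)
  ultimately show ?thesis
    by (simp add: double_shrink_est_def RLS_est_def Phi_def G_def g_def Z_eq T_def divide_inverse)
qed

text \<open>Moving \<open>X\<close> along \<open>V X ** Z X\<close> moves each eigenvalue \<open>l\<close> of \<open>W X\<close> with speed \<open>2 * l * v\<close>,
  which turns the drift term into the expression of \<open>spectral_drift_nonneg\<close>.\<close>

lemma drift_nonneg:
  assumes X: "X \<in> U"
  shows "0 < D X" "0 \<le> (a X)^2 * D X + 2 * a' X (V X ** Z X)"
proof -
  obtain R Ri :: "real^'p^'p" and l v where R: "R ** Ri = mat 1" "Ri ** R = mat 1"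
    and W: "W X = R ** diag_mat l ** Ri" and V: "V X = R ** diag_mat v ** Ri"
    and "M X ** V X = mat 1" "invertible (M X)"
    and l: "\<And>i. 0 \<le> l i" "card {i. l i \<noteq> 0} \<le> CARD('n) - 1" and T: "T X = (\<Sum>i\<in>UNIV. l i)" "0 < T X"
    and v: "\<And>i. v i = 1 / (l i + c * T X)"
    by (rule spectral[OF X], rule that)
  note conj = conj_diag_mat_mult[OF R(2)] trace_conj_diag_mat[OF R(2)] conj_diag_mat_add scaleR_conj_diag_mat
  have one: "mat 1 = R ** diag_mat (\<lambda>i. 1) ** Ri" by (simp add: diag_mat_one R)
  have neg: "- (R ** diag_mat k ** Ri) = R ** diag_mat (\<lambda>i. - 1 * k i) ** Ri" for k
    using scaleR_conj_diag_mat[of "- 1" R k Ri] by simp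
  let ?h = "V X ** Z X"
  have tX: "t X = (\<Sum>i\<in>UNIV. v i)" by (simp add: t_def V conj)
  have KX: "K X = (\<Sum>i\<in>UNIV. l i * v i)" by (simp add: K_def V W conj mult.commute)
  have DX: "D X = (\<Sum>i\<in>UNIV. l i * (v i)^2)" by (simp add: D_def V W conj power2_eq_square mult_ac)
  \<comment> \<open>Moving the transposed \<open>V\<close> through \<open>Q\<close> gives
    \<open>V ** W + W ** V\<close>, so the derivative stays diagonal in the basis of
    \<open>W\<close>, and all later ones do too.\<close>
  have Wh: "W' X ?h = R ** diag_mat (\<lambda>i. 2 * (l i * v i)) ** Ri"
  proof -
    have "W' X ?h = V X ** (Z X ** transpose (Z X) ** Q) + Z X ** transpose (Z X) ** (transpose (V X) ** Q)"
      by (simp add: W'_def matrix_transpose_mul matrix_mult_linear matrix_mul_assoc)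
    also have "\<dots> = V X ** W X + W X ** V X"
      unfolding V_transpose[OF X] by (simp add: W_eq matrix_mul_assoc)
    also have "\<dots> = R ** diag_mat (\<lambda>i. 2 * (l i * v i)) ** Ri"
    proof -
      have "(\<lambda>i. v i * l i + l i * v i) = (\<lambda>i. 2 * (l i * v i))" by (simp add: fun_eq_iff mult.commute)
      then show ?thesis by (simp only: V W conj)
    qed
    finally show ?thesis .
  qed
  have Th: "T' X ?h = 2 * K X"
    unfolding trace_W'[symmetric] unfolding Wh unfolding conj KX by (simp add: sum_distrib_left)
  have Vh: "V' X ?h = R ** diag_mat (\<lambda>i. - (v i * (2 * (l i * v i) + 2 * c * K X) * v i)) ** Ri"
  proof -
    have "M' X ?h = R ** diag_mat (\<lambda>i. 2 * (l i * v i) + c * (2 * K X) * 1) ** Ri"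
      unfolding M'_def unfolding Wh Th unfolding one unfolding conj ..
    then have "V' X ?h = - (R ** diag_mat (\<lambda>i. v i * (2 * (l i * v i) + c * (2 * K X) * 1) * v i) ** Ri)"
      unfolding V'_def by (simp only: V conj)
    also have "\<dots> = R ** diag_mat (\<lambda>i. - (v i * (2 * (l i * v i) + 2 * c * K X) * v i)) ** Ri"
      unfolding neg by (simp add: mult_ac)
    finally show ?thesis .
  qed
  define s where "s = (\<Sum>i\<in>UNIV. (v i)^2)"
  define E where "E = (\<Sum>i\<in>UNIV. l i * (v i)^3)"
  define H where "H = (\<Sum>i\<in>UNIV. (l i)^2 * (v i)^4)"
  have th: "t' X ?h = - 2 * E - 2 * c * K X * s"
  proof -
    have "t' X ?h = (\<Sum>i\<in>UNIV. - 2 * (l i * (v i)^3) - 2 * c * K X * (v i)^2)"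
      unfolding t'_def unfolding Vh unfolding conj
      by (intro sum.cong) (simp_all add: algebra_simps power2_eq_square power3_eq_cube)
    also have "\<dots> = - 2 * E - 2 * c * K X * s"
      unfolding E_def s_def sum_distrib_left sum_subtractf[symmetric] by simp
    finally show ?thesis .
  qed
  have Dh: "D' X ?h = 2 * E - 4 * H - 4 * c * K X * E"
  proof -
    have "D' X ?h = (\<Sum>i\<in>UNIV. 2 * (l i * (v i)^3) - 4 * ((l i)^2 * (v i)^4) - 4 * c * K X * (l i * (v i)^3))"
      unfolding D'_def unfolding Vh Wh unfolding V W unfolding conj
      by (intro sum.cong) (simp_all add: algebra_simps power2_eq_square power3_eq_cube power4_eq_xxxx)
    also have "\<dots> = 2 * E - 4 * H - 4 * c * K X * E"
      unfolding E_def H_def sum_distrib_left sum_subtractf[symmetric] by simp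
    finally show ?thesis .
  qed
  note sd = spectral_drift_nonneg[where N = "CARD('n)", OF l(1) T l(2) n2 c0 refl refl m A0 cond v tX s_def KX DX E_def H_def th Dh]
  have N: "N X = (real CARD('n) - real CARD('p) - 1) * t X + c * T X * (t X)^2"
    by (simp add: N_def power2_eq_square)
  have N': "N' X ?h = (real CARD('n) - real CARD('p) - 1) * t' X ?h + 2 * c * K X * (t X)^2 + 2 * c * T X * t X * t' X ?h"
    by (simp add: N'_def Th power2_eq_square algebra_simps)
  show D0: "0 < D X" by (rule sd(1)[OF N N'])
  have "a X = N X / D X - (2 * c + 1)" by (simp add: a_def divide_inverse)
  moreover have "a' X ?h = (N' X ?h * D X - N X * D' X ?h) / (D X)^2"
    using D0 by (simp add: a'_def field_simps power2_eq_square)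
  ultimately show "0 \<le> (a X)^2 * D X + 2 * a' X ?h"
    using sd(2)[OF N N'] by simp
qed

lemma C1_t: "C1_on U t t'"
  using C1_on_linear_comp[OF bounded_linear_trace C1_V] by (simp add: t_def[abs_def] t'_def[abs_def])

lemma C1_D: "C1_on U D D'"
  unfolding D_def[abs_def] D'_def[abs_def]
  by (intro C1_on_linear_comp[OF bounded_linear_trace] C1_on_matrix_mult C1_V C1_W)

lemma C1_K: "C1_on U K K'"
  unfolding K_def[abs_def] K'_def[abs_def]
  by (intro C1_on_linear_comp[OF bounded_linear_trace] C1_on_matrix_mult C1_V C1_W)

lemma C1_N: "C1_on U N N'"
  unfolding N_def[abs_def] N'_def[abs_def]
  by (intro C1_on_add C1_on_mult C1_t C1_on_linear_comp[OF bounded_linear_mult_right C1_t]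
      C1_on_linear_comp[OF bounded_linear_mult_right C1_T])

lemma C1_on_diff_const: "C1_on A f f' \<Longrightarrow> C1_on A (\<lambda>x. f x - k) f'"
  using C1_on_diff[OF _ C1_on_const] by fastforce

lemma C1_a: "C1_on U a a'"
  unfolding a_def[abs_def] a'_def[abs_def]
  by (intro C1_on_diff_const C1_on_mult C1_N C1_on_inverse C1_D) (use drift_nonneg in force)

lemma C1_b: "C1_on U b b'"
proof -
  have "C1_on U (\<lambda>X. q - K X * a X) (\<lambda>X h. 0 - (K X * a' X h + K' X h * a X))"
    by (intro C1_on_diff C1_on_const C1_on_mult C1_K C1_a)
  then show ?thesis by (simp add: b_def[abs_def] b'_def[abs_def])
qed

lemma C1_g: "C1_on U g g'"
  unfolding g_def[abs_def] g'_def[abs_def]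
  by (intro C1_on_mult C1_b C1_on_inverse C1_T) (simp add: U_def)

lemma C1_Phi: "C1_on U Phi Phi'"
  unfolding Phi_def[abs_def] Phi'_def[abs_def] G_def[abs_def] G'_def[abs_def]
  by (intro C1_on_matrix_mult C1_on_add C1_on_scaleR C1_a C1_V
      C1_on_linear_comp[OF bounded_linear_scaleR_left C1_g] C1_on_linear bounded_linear_Z)

lemma linear_T': "linear (T' X)"
  using has_derivative_linear[OF C1_on_der[OF C1_T[of UNIV]]] by simp

lemma V_M: assumes "X \<in> U" shows "V X ** M X = mat 1" "M X ** V X = mat 1"
proof -
  show "M X ** V X = mat 1" by (rule spectral[OF assms])
  then show "V X ** M X = mat 1" by (simp add: matrix_left_right_inverse)
qed

text \<open>\<open>V ** M = 1\<close> means \<open>V ** W = 1 - c T V\<close>. The relation turns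
  \<open>(n - 1) t - t K\<close> into the numerator \<open>N\<close> of the fraction in
  \<open>a\<close>.\<close>

lemma K_eq: assumes "X \<in> U" shows "K X = real CARD('p) - c * T X * t X"
proof -
  have "W X = M X - (c * T X) *\<^sub>R mat 1" by (simp add: M_def)
  then have "V X ** W X = mat 1 - (c * T X) *\<^sub>R V X"
    by (simp add: matrix_mult_linear V_M[OF assms])
  then show ?thesis by (simp add: K_def trace_sub trace_I trace_linear t_def)
qed

text \<open>Euler's relation: in \<open>Z\<close>, the matrices \<open>W\<close> and
  \<open>M\<close> have degree 2, \<open>V\<close>, \<open>t\<close>, \<open>D\<close>,
  \<open>N\<close> and \<open>g\<close> degree -2, and \<open>K\<close>, \<open>a\<close>,
  \<open>b\<close> degree 0.\<close>

lemma radial_derivatives: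
  assumes X: "X \<in> U"
  shows "a' X (Z X) = 0" "b' X (Z X) = 0" "g' X (Z X) = - 2 * g X"
proof -
  have W: "W' X (Z X) = 2 *\<^sub>R W X"
    by (simp only: W'_def W_eq matrix_mult_linear scaleR_2)
  have T: "T' X (Z X) = 2 * T X" unfolding trace_W'[symmetric] W by (simp add: trace_linear T_def)
  have "M' X (Z X) = 2 *\<^sub>R M X" by (simp add: M'_def M_def W T scaleR_add_right)
  then have V: "V' X (Z X) = - 2 *\<^sub>R V X"
    by (simp add: V'_def matrix_mult_linear V_M[OF X])
  have t: "t' X (Z X) = - 2 * t X" by (simp add: t'_def t_def V trace_linear)
  have K: "K' X (Z X) = 0"
    by (simp add: K'_def V W matrix_mult_linear trace_linear)
  have D: "D' X (Z X) = - 2 * D X"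
    by (simp add: D'_def D_def V W matrix_mult_linear trace_linear)
  have N: "N' X (Z X) = - 2 * N X" by (simp add: N'_def N_def t T algebra_simps)
  have D0: "0 < D X" using drift_nonneg(1)[OF X] .
  show a: "a' X (Z X) = 0" using D0 by (simp add: a'_def N D field_simps power2_eq_square)
  show b: "b' X (Z X) = 0" by (simp add: b'_def a K)
  have "0 < T X" using X by (simp add: U_def)
  then show "g' X (Z X) = - 2 * g X" by (simp add: g'_def g_def b T field_simps power2_eq_square)
qed

text \<open>The differential of \<open>M\<close> has three parts: the one with \<open>h\<close>
  yields the product of traces \<open>t K\<close>, the one with \<open>transpose h\<close> the
  contraction \<open>D\<close>, and the ridge \<open>2 c D\<close>, because the gradient of
  \<open>T\<close> is \<open>2 Q Z\<close>.\<close>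

lemma divergence_V_Z:
  assumes X: "X \<in> U"
  shows "(\<Sum>B\<in>Basis. (V' X B ** Z X) \<bullet> B) = - (t X * K X) - (2 * c + 1) * D X"
proof -
  have eq: "(V' X B ** Z X) \<bullet> B = - ((V X ** B ** (transpose (Z X) ** (Q ** V X ** Z X))) \<bullet> B
      + ((V X ** Z X) ** transpose B ** (Q ** V X ** Z X)) \<bullet> B
      + c * (T' X B * ((V X ** V X ** Z X) \<bullet> B)))" for B
  proof -
    have "V' X B ** Z X = - (V X ** B ** (transpose (Z X) ** (Q ** V X ** Z X))
      + (V X ** Z X) ** transpose B ** (Q ** V X ** Z X)
      + (c * T' X B) *\<^sub>R (V X ** V X ** Z X))"
      by (simp add: V'_def M'_def W'_def matrix_mult_linear matrix_mul_assoc)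
    then show ?thesis by (simp add: inner_add_left inner_diff_left)
  qed
  have "(\<Sum>B\<in>Basis. (V' X B ** Z X) \<bullet> B) = - ((\<Sum>B\<in>Basis. (V X ** B ** (transpose (Z X) ** (Q ** V X ** Z X))) \<bullet> B)
      + (\<Sum>B\<in>Basis. ((V X ** Z X) ** transpose B ** (Q ** V X ** Z X)) \<bullet> B)
      + c * (\<Sum>B\<in>Basis. T' X B * ((V X ** V X ** Z X) \<bullet> B)))"
    by (simp only: eq sum.distrib sum_negf sum_distrib_left)
  also have "(\<Sum>B\<in>Basis. (V X ** B ** (transpose (Z X) ** (Q ** V X ** Z X))) \<bullet> B) = t X * K X"
  proof -
    have "trace (transpose (Z X) ** (Q ** V X ** Z X)) = Z X \<bullet> (transpose Q ** (V X ** Z X))"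
      by (simp add: inner_mat_trace matrix_mul_assoc Q_sym)
    also have "\<dots> = (V X ** Z X) \<bullet> (Q ** Z X)"
      unfolding inner_matrix_mult_left[symmetric] by (rule inner_commute)
    finally have "trace (transpose (Z X) ** (Q ** V X ** Z X)) = (V X ** Z X) \<bullet> (Q ** Z X)" .
    then show ?thesis by (simp add: sum_Basis_inner_sandwich t_def K_def inner_QZ)
  qed
  also have "(\<Sum>B\<in>Basis. ((V X ** Z X) ** transpose B ** (Q ** V X ** Z X)) \<bullet> B) = D X"
  proof -
    have "(V X ** Z X) \<bullet> (Q ** V X ** Z X) = (V X ** Z X) \<bullet> (transpose (V X) ** (Q ** Z X))"
      by (simp add: matrix_mul_assoc V_transpose[OF X])
    also have "\<dots> = (V X ** V X ** Z X) \<bullet> (Q ** Z X)"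
      unfolding inner_matrix_mult_left[symmetric] by (simp add: matrix_mul_assoc)
    finally show ?thesis by (simp add: sum_Basis_inner_sandwich_transpose D_def inner_QZ)
  qed
  also have "(\<Sum>B\<in>Basis. T' X B * ((V X ** V X ** Z X) \<bullet> B)) = 2 * D X"
    unfolding sum_Basis_linear_form[OF linear_T'] by (simp add: T'_def inner_QZ D_def)
  finally show ?thesis by (simp add: algebra_simps)
qed

text \<open>The radial derivative \<open>- 2 g\<close> lowers \<open>(n - 1) p\<close> to
  \<open>q\<close>, and the remaining multiples of \<open>a\<close> add up to \<open>a (a D)\<close>
  by the definition of \<open>a\<close>.\<close>

lemma divergence_Phi:
  assumes X: "X \<in> U"
  shows "(\<Sum>B\<in>Basis. Phi' X B \<bullet> B) = (a X)^2 * D X + a' X (V X ** Z X) + g X * q"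
proof -
  have la: "linear (a' X)" and lg: "linear (g' X)"
    using has_derivative_linear[OF C1_on_der[OF C1_a X]] has_derivative_linear[OF C1_on_der[OF C1_g X]] by auto
  have eq: "Phi' X B \<bullet> B = a X * ((V X ** B ** center_mat) \<bullet> B) + g X * ((mat 1 ** B ** center_mat) \<bullet> B)
      + a X * ((V' X B ** Z X) \<bullet> B) + a' X B * ((V X ** Z X) \<bullet> B) + g' X B * (Z X \<bullet> B)" for B
    by (simp add: Phi'_def G_def G'_def Z_def[of B] matrix_mult_linear matrix_mul_assoc inner_add_left)
  have "(\<Sum>B\<in>Basis. Phi' X B \<bullet> B) = a X * (\<Sum>B\<in>(Basis :: (real^'n^'p) set). (V X ** B ** center_mat) \<bullet> B)
      + g X * (\<Sum>B\<in>(Basis :: (real^'n^'p) set). ((mat 1 :: real^'p^'p) ** B ** center_mat) \<bullet> B)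
      + a X * (\<Sum>B\<in>Basis. (V' X B ** Z X) \<bullet> B) + (\<Sum>B\<in>Basis. a' X B * ((V X ** Z X) \<bullet> B))
      + (\<Sum>B\<in>Basis. g' X B * (Z X \<bullet> B))"
    by (simp only: eq sum.distrib sum_distrib_left)
  also have "\<dots> = a X * (t X * (real CARD('n) - 1)) + g X * (real CARD('p) * (real CARD('n) - 1))
      + a X * (- (t X * K X) - (2 * c + 1) * D X) + a' X (V X ** Z X) - 2 * g X"
    unfolding sum_Basis_linear_form[OF la] sum_Basis_linear_form[OF lg] radial_derivatives[OF X]
      divergence_V_Z[OF X] sum_Basis_inner_sandwich trace_center_mat
    by (simp add: t_def trace_I)
  also have "\<dots> = a X * (t X * (real CARD('n) - 1) - t X * K X - (2 * c + 1) * D X) + a' X (V X ** Z X) + g X * q"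
    by (simp add: q_def algebra_simps)
  also have "t X * (real CARD('n) - 1) - t X * K X = N X"
    by (simp add: K_eq[OF X] N_def algebra_simps)
  also have "N X - (2 * c + 1) * D X = a X * D X"
    using drift_nonneg(1)[OF X] by (simp add: a_def field_simps)
  finally show ?thesis by (simp add: power2_eq_square)
qed

text \<open>This is what \<open>b = q - K a\<close> achieves: \<open>a K + (b / T) T = q\<close>,
  independently of \<open>X\<close>.\<close>

lemma inner_Phi_QZ:
  assumes "X \<in> U" shows "Phi X \<bullet> (Q ** Z X) = q"
proof -
  have "Phi X \<bullet> (Q ** Z X) = a X * K X + g X * T X"
    unfolding Phi_def inner_QZ by (simp add: G_def matrix_mult_linear trace_linear K_def T_def)
  also have "\<dots> = q" using assms by (simp add: g_def b_def U_def field_simps)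
  finally show ?thesis .
qed

text \<open>\<open>Phi X\<close> is centered, so the pairing only sees the centered part of
  \<open>X\<close>. This form is needed for the term \<open>sq X\<close> of the cutoff.\<close>

lemma inner_Phi_QX:
  assumes "X \<in> U" shows "Phi X \<bullet> (Q ** X) = q"
proof -
  have "Phi X = Z (Phi X)" by (simp add: Phi_def Z_matrix_mult Z_idem)
  then have "Phi X \<bullet> (Q ** X) = Phi X \<bullet> (Q ** Z X)" by (metis inner_Z Z_matrix_mult)
  then show ?thesis using inner_Phi_QZ[OF assms] by simp
qed

lemma unbiased_risk_difference_nonpos:
  assumes X: "X \<in> U"
  shows "Phi X \<bullet> (Q ** Phi X) - 2 * (\<Sum>B\<in>Basis. Phi' X B \<bullet> B) \<le> 0"
proof -
  have T0: "0 < T X" using X by (simp add: U_def)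
  have GQ: "transpose (G X) ** Q = Q ** G X"
    by (simp add: G_def transpose_add transpose_scaleR transpose_mat_one matrix_mult_linear V_transpose[OF X])
  have "Phi X \<bullet> (Q ** Phi X) = (G X ** Z X) \<bullet> (transpose (G X) ** (Q ** Z X))"
    by (simp add: Phi_def matrix_mul_assoc GQ)
  also have "\<dots> = trace (G X ** G X ** W X)"
    unfolding inner_matrix_mult_left[symmetric] unfolding matrix_mul_assoc inner_QZ ..
  also have "\<dots> = (a X)^2 * D X + 2 * (a X * g X * K X) + (g X)^2 * T X"
  proof -
    have "trace (G X ** Y) = a X * trace (V X ** Y) + g X * trace Y" for Y
      by (simp add: G_def matrix_mult_linear trace_linear)
    moreover have "trace (V X ** (G X ** Y)) = a X * trace (V X ** V X ** Y) + g X * trace (V X ** Y)" for Y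
      by (simp add: G_def matrix_mult_linear trace_linear matrix_mul_assoc)
    ultimately have "trace (G X ** (G X ** W X)) = a X * (a X * D X + g X * K X) + g X * (a X * K X + g X * T X)"
      by (simp only: D_def K_def T_def)
    then show ?thesis by (simp add: matrix_mul_assoc power2_eq_square algebra_simps)
  qed
  finally have "Phi X \<bullet> (Q ** Phi X) - 2 * (\<Sum>B\<in>Basis. Phi' X B \<bullet> B)
      = - ((a X)^2 * D X + 2 * a' X (V X ** Z X)) + g X * (2 * a X * K X + g X * T X - 2 * q)"
    by (simp add: divergence_Phi[OF X] power2_eq_square algebra_simps)
  \<comment> \<open>Since \<open>g T = b\<close> and \<open>a K + b = q\<close>, the bracket equals
    \<open>- b\<close>.\<close>
  also have "g X * (2 * a X * K X + g X * T X - 2 * q) = - ((b X)^2 / T X)"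
    using T0 by (simp add: g_def b_def field_simps power2_eq_square)
  finally show ?thesis
    using drift_nonneg(2)[OF X] T0 zero_le_power2[of "b X"] by (smt (verit) divide_nonneg_pos)
qed

end

subsection \<open>Truncation and the risk bound\<close>

context shrinkage
begin

section \<open>Total mass and second moment of the normal density\<close>

definition rho where "rho X = gauss_density S Th X"
definition r0 where "r0 X = (X - Th) \<bullet> (Q ** (X - Th))"

lemma bounded_linear_matrix_mult_left: "bounded_linear (\<lambda>X :: real^'n^'p. A ** X)" for A :: "real^'p^'p"
  by (rule bounded_bilinear.bounded_linear_right[OF bounded_bilinear_matrix_mult])

lemma C1_quadratic_form:
  "C1_on A (\<lambda>X. (X - Y) \<bullet> (Q ** (X - Y))) (\<lambda>X h. 2 * (h \<bullet> (Q ** (X - Y))))" for Y :: "real^'n^'p"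
proof -
  have id: "C1_on A (\<lambda>X. X - Y) (\<lambda>X h. h - 0)"
    by (intro C1_on_diff C1_on_const C1_on_linear bounded_linear_ident)
  have "C1_on A (\<lambda>X. (X - Y) \<bullet> (Q ** (X - Y))) (\<lambda>X h. (X - Y) \<bullet> (Q ** (h - 0)) + (h - 0) \<bullet> (Q ** (X - Y)))"
    by (intro C1_on_inner id C1_on_linear_comp[OF bounded_linear_matrix_mult_left id])
  then show ?thesis
  proof (rule C1_on_cong)
    fix X h
    have "(X - Y) \<bullet> (Q ** h) = h \<bullet> (transpose Q ** (X - Y))"
      by (simp add: inner_matrix_mult_left[symmetric] inner_commute)
    then show "(X - Y) \<bullet> (Q ** (h - 0)) + (h - 0) \<bullet> (Q ** (X - Y)) = 2 * (h \<bullet> (Q ** (X - Y)))"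
      by (simp add: Q_sym)
  qed
qed

lemma C1_rho: "C1_on A rho (\<lambda>X h. - (rho X * (h \<bullet> (Q ** (X - Th)))))"
proof -
  define k where "k = ((2 * pi) powr (- real CARD('p) / 2) * det S powr (- 1 / 2)) ^ CARD('n)"
  have "C1_on A (\<lambda>X. k * exp ((- (1/2)) * ((X - Th) \<bullet> (Q ** (X - Th)))))
     (\<lambda>X h. k * (exp ((- (1/2)) * ((X - Th) \<bullet> (Q ** (X - Th)))) * ((- (1/2)) * (2 * (h \<bullet> (Q ** (X - Th)))))))"
    by (intro C1_on_linear_comp[OF bounded_linear_mult_right] C1_on_exp C1_quadratic_form)
  then show ?thesis by (simp add: rho_def[abs_def] gauss_density_def k_def mult.assoc)
qed

lemma rho_nonneg: "0 \<le> rho X"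
  by (simp add: rho_def gauss_density_nonneg)

lemma rho_measurable[measurable]: "rho \<in> borel_measurable borel"
  using C1_on_cont[OF C1_rho[of UNIV]] by (rule borel_measurable_continuous_onI)

lemma rho_integral: "integrable lborel rho" "(\<integral>X. rho X \<partial>lborel) = 1"
proof -
  have "(\<integral>\<^sup>+X. ennreal (rho X) \<partial>lborel) = ennreal 1"
    using nn_integral_gauss_density[OF pd, of Th] by (simp add: rho_def)
  then have "has_bochner_integral lborel rho 1"
    by (intro has_bochner_integral_nn_integral) (auto simp: rho_nonneg)
  then show "integrable lborel rho" "(\<integral>X. rho X \<partial>lborel) = 1"
    by (auto simp: has_bochner_integral_iff)
qed

text \<open>With \<open>Q = B ** B\<close> the form is \<open>norm (B ** Y) ^ 2\<close>, and
  \<open>A\<close> undoes \<open>B\<close> at the cost of a bounded factor. Coercivity makes the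
  supports of the cutoffs compact.\<close>

lemma quadratic_form_bounds:
  obtains k where "\<And>Y :: real^'n^'p. 0 \<le> Y \<bullet> (Q ** Y)" "\<And>Y :: real^'n^'p. norm Y ^ 2 \<le> k * (Y \<bullet> (Q ** Y))"
proof -
  obtain A B where AB: "transpose B = B" "A ** B = mat 1" "matrix_inv S = B ** B"
    using pos_def_mat_sqrt[OF pd] by metis
  have eq: "Y \<bullet> (Q ** Y) = norm (B ** Y) ^ 2" for Y :: "real^'n^'p"
    by (simp add: AB(3) power2_norm_eq_inner inner_matrix_mult_left AB(1) matrix_mul_assoc)
  have "bounded_linear (\<lambda>Y :: real^'n^'p. A ** Y)" by (rule bounded_linear_matrix_mult_left)
  then obtain k where k: "\<And>Y :: real^'n^'p. norm (A ** Y) \<le> norm Y * k"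
    using bounded_linear.bounded by blast
  have "norm Y ^ 2 \<le> k^2 * (Y \<bullet> (Q ** Y))" for Y :: "real^'n^'p"
  proof -
    have "norm Y = norm (A ** (B ** Y))" by (simp add: matrix_mul_assoc AB)
    also have "\<dots> \<le> norm (B ** Y) * k" by (rule k)
    finally have "norm Y ^ 2 \<le> (norm (B ** Y) * k)^2" by (rule power_mono) simp
    then show ?thesis by (simp add: eq power_mult_distrib mult.commute)
  qed
  then show ?thesis using that[of "k^2"] eq by simp
qed

lemma quadratic_form_nonneg: "0 \<le> Y \<bullet> (Q ** Y)" for Y :: "real^'n^'p"
  using quadratic_form_bounds by metis

lemma quadratic_form_zero: "Y \<bullet> (Q ** Y) = 0 \<Longrightarrow> Y = 0" for Y :: "real^'n^'p"
proof -
  obtain k where "norm Y ^ 2 \<le> k * (Y \<bullet> (Q ** Y))" using quadratic_form_bounds by metis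
  then show "Y \<bullet> (Q ** Y) = 0 \<Longrightarrow> Y = 0" by simp
qed

lemma bounded_sublevel: "bounded {X. (X - Y) \<bullet> (Q ** (X - Y)) \<le> e}" for Y :: "real^'n^'p"
proof -
  obtain k where k: "\<And>Y :: real^'n^'p. norm Y ^ 2 \<le> k * (Y \<bullet> (Q ** Y))" using quadratic_form_bounds by metis
  have "dist Y X \<le> sqrt (\<bar>k\<bar> * \<bar>e\<bar>)" if "(X - Y) \<bullet> (Q ** (X - Y)) \<le> e" for X
  proof -
    have "norm (X - Y) ^ 2 \<le> k * ((X - Y) \<bullet> (Q ** (X - Y)))" by (rule k)
    also have "\<dots> \<le> \<bar>k\<bar> * \<bar>e\<bar>"
      using that quadratic_form_nonneg[of "X - Y"] by (intro mult_mono) auto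
    finally show ?thesis by (simp add: real_le_rsqrt dist_norm norm_minus_commute)
  qed
  then show ?thesis by (intro boundedI[where B = "norm Y + sqrt (\<bar>k\<bar> * \<bar>e\<bar>)"])
    (smt (verit) dist_norm mem_Collect_eq norm_triangle_sub norm_minus_commute)
qed

text \<open>Only \<open>n = 2\<close>, \<open>p = 1\<close> could give a negative \<open>q\<close>.
  There \<open>m = 1\<close> and \<open>A0 = 0\<close>, and the condition becomes
  \<open>- 11 c^2 - 25 c - 14 \<ge> 0\<close>, impossible for \<open>c > 0\<close>.\<close>

lemma q_nonneg: "0 \<le> q"
proof (rule ccontr)
  assume "\<not> 0 \<le> q"
  then have "(CARD('n) - 1) * CARD('p) < 2" using n2
    by (simp add: q_def of_nat_diff flip: of_nat_less_iff[where 'a = real])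
  moreover have "0 < CARD('p)" by simp
  ultimately have "CARD('n) = 2" "CARD('p) = 1"
    using n2 by (cases "CARD('n) - 1"; cases "CARD('p)"; auto simp: less_2_cases_iff)+
  then have "m = 1" "A0 = 0" by (simp_all add: m A0)
  then have "- 11 * c^2 - 25 * c - 14 \<ge> 0" using cond by simp
  moreover have "0 \<le> c^2" by simp
  ultimately show False using c0 by linarith
qed

lemma r0_nonneg: "0 \<le> r0 X"
  unfolding r0_def by (rule quadratic_form_nonneg)

lemma C1_r0: "C1_on A r0 (\<lambda>X h. 2 * (h \<bullet> (Q ** (X - Th))))"
  unfolding r0_def[abs_def] by (rule C1_quadratic_form)

lemma r0_measurable[measurable]: "r0 \<in> borel_measurable borel"
  using C1_on_cont[OF C1_r0[of UNIV]] by (rule borel_measurable_continuous_onI)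

text \<open>Stein's identity for the radial field \<open>X - Th\<close>, cut off to compact support,
  expresses the truncated moment through a divergence, so no Gaussian integral has to be
  evaluated.\<close>

lemma nn_integral_truncated_second_moment:
  assumes e: "0 < e"
  shows "(\<integral>\<^sup>+X. ennreal (rho X * ((max 0 (1 - e * r0 X))^2 * r0 X)) \<partial>lborel) \<le> ennreal (real CARD('n) * real CARD('p))"
proof -
  define u where "u X = 1 - e * r0 X" for X
  define x where "x X = (max 0 (u X))^2" for X
  define x' where "x' X h = 2 * max 0 (u X) * (0 - e * (2 * (h \<bullet> (Q ** (X - Th)))))" for X and h :: "real^'n^'p"
  have C1x: "C1_on UNIV x x'"
    unfolding x_def[abs_def] x'_def[abs_def] u_def[abs_def]
    by (intro C1_on_pos_part_square C1_on_diff C1_on_const C1_on_linear_comp[OF bounded_linear_mult_right C1_r0])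
  have C1F: "C1_on UNIV (\<lambda>X. x X *\<^sub>R (X - Th)) (\<lambda>X h. x X *\<^sub>R (h - 0) + x' X h *\<^sub>R (X - Th))"
    by (intro C1_on_scaleR C1x C1_on_diff C1_on_const C1_on_linear bounded_linear_ident)
  have K: "compact {X. r0 X \<le> 1 / e}"
  proof -
    have "closed {X. r0 X \<le> 1 / e}" using C1_on_cont[OF C1_r0[of UNIV]] by (intro closed_Collect_le) auto
    moreover have "bounded {X. r0 X \<le> 1 / e}" unfolding r0_def by (rule bounded_sublevel)
    ultimately show ?thesis by (simp add: compact_eq_bounded_closed)
  qed
  have zero: "x X *\<^sub>R (X - Th) = 0" if "X \<notin> {X. r0 X \<le> 1 / e}" for X
    using that e by (simp add: x_def u_def field_simps)
  define f where "f X = indicator UNIV X * (rho X * (\<Sum>b\<in>Basis. (x X *\<^sub>R (b - 0) + x' X b *\<^sub>R (X - Th)) \<bullet> b)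
      + - (rho X * ((x X *\<^sub>R (X - Th)) \<bullet> (Q ** (X - Th)))))" for X
  have f: "integrable lborel f" "(\<integral>X. f X \<partial>lborel) = 0"
    unfolding f_def using stein_identity_compact_support[OF open_UNIV K subset_UNIV C1F C1_rho zero] by auto
  have lx': "linear (x' X)" for X using has_derivative_linear[OF C1_on_der[OF C1x]] by simp
  have f_eq: "f X = rho X * (x X * (real CARD('n) * real CARD('p)) + x' X (X - Th)) - rho X * (x X * r0 X)" for X
  proof -
    have "(\<Sum>b\<in>Basis. (x X *\<^sub>R (b - 0) + x' X b *\<^sub>R (X - Th)) \<bullet> b)
        = (\<Sum>b\<in>(Basis :: (real^'n^'p) set). x X) + (\<Sum>b\<in>Basis. x' X b * ((X - Th) \<bullet> b))"
      unfolding sum.distrib[symmetric] by (intro sum.cong) (auto simp: inner_add_left inner_diff_left)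
    then show ?thesis
      unfolding f_def by (simp add: sum_Basis_linear_form[OF lx'] r0_def mult_ac)
  qed
  have "rho X * (x X * r0 X) \<le> (real CARD('n) * real CARD('p)) * rho X - f X" for X
  proof -
    have "u X \<le> 1" using e r0_nonneg[of X] by (simp add: u_def)
    then have "x X \<le> 1" by (simp add: x_def power_le_one)
    then have "x X * (real CARD('n) * real CARD('p)) \<le> 1 * (real CARD('n) * real CARD('p))"
      by (intro mult_right_mono) auto
    \<comment> \<open>The cutoff decreases in the radial direction, so its derivative has the sign
      that may be dropped from an upper bound.\<close>
    moreover have "x' X (X - Th) = - (4 * max 0 (u X) * e * r0 X)" by (simp add: x'_def r0_def)
    then have "x' X (X - Th) \<le> 0" using e r0_nonneg[of X] by simp
    ultimately have "rho X * (x X * (real CARD('n) * real CARD('p)) + x' X (X - Th)) \<le> rho X * (real CARD('n) * real CARD('p))"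
      using rho_nonneg[of X] by (intro mult_left_mono) linarith+
    then show ?thesis unfolding f_eq by (simp add: mult.commute)
  qed
  then have "(\<integral>\<^sup>+X. ennreal (rho X * (x X * r0 X)) \<partial>lborel)
      \<le> (\<integral>\<^sup>+X. ennreal ((real CARD('n) * real CARD('p)) * rho X - f X) \<partial>lborel)"
    by (intro nn_integral_mono ennreal_leI)
  also have "\<dots> = ennreal (\<integral>X. (real CARD('n) * real CARD('p)) * rho X - f X \<partial>lborel)"
  proof (rule nn_integral_eq_integral)
    show "integrable lborel (\<lambda>X. (real CARD('n) * real CARD('p)) * rho X - f X)"
      using f rho_integral by simp
    have "0 \<le> rho X * (x X * r0 X)" for X using rho_nonneg[of X] r0_nonneg[of X] by (simp add: x_def)
    then show "AE X in lborel. 0 \<le> (real CARD('n) * real CARD('p)) * rho X - f X"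
      using \<open>\<And>X. rho X * (x X * r0 X) \<le> _\<close> by (intro AE_I2) (meson order_trans)
  qed
  also have "(\<integral>X. (real CARD('n) * real CARD('p)) * rho X - f X \<partial>lborel) = real CARD('n) * real CARD('p)"
    using f rho_integral by simp
  finally show ?thesis by (simp add: x_def u_def)
qed

text \<open>The truncation is removed by Fatou's lemma, which yields an inequality only; an upper
  bound for the risk asks for no more.\<close>

lemma second_moment:
  "integrable lborel (\<lambda>X. rho X * r0 X)" "(\<integral>X. rho X * r0 X \<partial>lborel) \<le> real CARD('n) * real CARD('p)"
proof -
  define e where "e k = 1 / (real k + 1)" for k :: nat
  have e: "0 < e k" for k by (simp add: e_def)
  have elim: "e \<longlonglongrightarrow> 0"
    unfolding e_def using LIMSEQ_inverse_real_of_nat by (simp add: inverse_eq_divide add.commute)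
  have lim: "(\<lambda>k. ennreal (rho X * ((max 0 (1 - e k * r0 X))^2 * r0 X))) \<longlonglongrightarrow> ennreal (rho X * r0 X)" for X
  proof -
    have "(\<lambda>k. rho X * ((max 0 (1 - e k * r0 X))^2 * r0 X)) \<longlonglongrightarrow> rho X * ((max 0 (1 - 0 * r0 X))^2 * r0 X)"
      by (intro tendsto_intros elim)
    then show ?thesis by (intro tendsto_ennrealI) simp
  qed
  have "(\<integral>\<^sup>+X. ennreal (rho X * r0 X) \<partial>lborel)
      = (\<integral>\<^sup>+X. liminf (\<lambda>k. ennreal (rho X * ((max 0 (1 - e k * r0 X))^2 * r0 X))) \<partial>lborel)"
    by (intro nn_integral_cong lim_imp_Liminf[symmetric] lim) simp
  also have "\<dots> \<le> liminf (\<lambda>k. \<integral>\<^sup>+X. ennreal (rho X * ((max 0 (1 - e k * r0 X))^2 * r0 X)) \<partial>lborel)"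
    by (rule nn_integral_liminf) measurable
  also have "\<dots> \<le> ennreal (real CARD('n) * real CARD('p))"
    by (intro Liminf_le always_eventually allI nn_integral_truncated_second_moment e) simp
  finally have *: "(\<integral>\<^sup>+X. ennreal (rho X * r0 X) \<partial>lborel) \<le> ennreal (real CARD('n) * real CARD('p))" .
  then show "integrable lborel (\<lambda>X. rho X * r0 X)"
    using rho_nonneg r0_nonneg
    by (intro integrableI_nonneg) (auto intro: le_less_trans)
  then show "(\<integral>X. rho X * r0 X \<partial>lborel) \<le> real CARD('n) * real CARD('p)"
    using * rho_nonneg r0_nonneg by (subst (asm) nn_integral_eq_integral) auto
qed

section \<open>The truncated estimator and the passage to the limit\<close>

text \<open>\<open>T X = 0\<close> forces \<open>Z X = 0\<close> by positive definiteness, and the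
  factor \<open>Z X\<close> kills whatever values \<open>V\<close> and the inverses take
  there.\<close>

lemma Phi_outside_U: assumes "X \<notin> U" shows "Phi X = 0"
proof -
  have T: "T X = Z X \<bullet> (Q ** Z X)" using inner_QZ[of "mat 1" X] by (simp add: T_def)
  then have "Z X \<bullet> (Q ** Z X) = 0" using assms quadratic_form_nonneg[of "Z X"] by (simp add: U_def)
  then have "Z X = 0" by (rule quadratic_form_zero)
  then show ?thesis by (simp add: Phi_def)
qed

lemma Phi_measurable[measurable]: "Phi \<in> borel_measurable borel"
proof -
  have "(\<lambda>X. if X \<in> U then Phi X else 0) \<in> borel_measurable borel"
    using open_U C1_on_cont[OF C1_Phi] by (intro borel_measurable_continuous_on_if) auto
  also have "(\<lambda>X. if X \<in> U then Phi X else 0) = Phi" using Phi_outside_U by auto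
  finally show ?thesis .
qed

lemma T_measurable[measurable]: "T \<in> borel_measurable borel"
  using C1_on_cont[OF C1_T[of UNIV]] by (rule borel_measurable_continuous_onI)

abbreviation sq :: "real^'n^'p \<Rightarrow> real" where "sq Y \<equiv> Y \<bullet> (Q ** Y)"

lemma C1_sq: "C1_on A sq (\<lambda>X h. 2 * (h \<bullet> (Q ** X)))"
  using C1_quadratic_form[of A 0] by simp

lemma sq_measurable[measurable]: "sq \<in> borel_measurable borel"
  using C1_on_cont[OF C1_sq[of UNIV]] by (rule borel_measurable_continuous_onI)

text \<open>\<open>T\<close> does not see the mean of the columns, so the term \<open>sq X\<close>
  is what bounds the support, while \<open>inverse (T X)\<close> keeps it away from the complement
  of \<open>U\<close> as far as \<open>Phi\<close> is concerned.\<close>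

definition cutoff :: "real \<Rightarrow> real^'n^'p \<Rightarrow> real" where
  "cutoff e X = (max 0 ((1 - e * inverse (T X)) - e * sq X))^2"

lemma cutoff_measurable[measurable]: "cutoff e \<in> borel_measurable borel"
  unfolding cutoff_def[abs_def] by measurable

lemma sq_diff: "sq (X - Y) = sq X - 2 * (Y \<bullet> (Q ** X)) + sq Y"
proof -
  have "X \<bullet> (Q ** Y) = Y \<bullet> (transpose Q ** X)"
    by (simp add: inner_matrix_mult_left[symmetric] inner_commute)
  then show ?thesis by (simp add: matrix_mult_linear inner_diff_left inner_diff_right Q_sym)
qed

text \<open>The cutoff removes the singularity of \<open>Phi\<close> at \<open>T X = 0\<close>. Its gradient pairs with \<open>Phi\<close> to
  \<open>4 * max 0 u * e * q * (1 / T^2 - 1)\<close>, whose singular part has the favourable sign.\<close>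

lemma truncated_risk:
  assumes e: "0 < e"
  shows "(\<integral>\<^sup>+X. ennreal (rho X * sq (X - Th - cutoff e X *\<^sub>R Phi X)) \<partial>lborel)
    \<le> ennreal (real CARD('n) * real CARD('p) + 8 * e * q)"
proof -
  define u where "u X = (1 - e * inverse (T X)) - e * sq X" for X
  define u' where "u' X h = (0 - e * (- inverse ((T X)^2) * T' X h)) - e * (2 * (h \<bullet> (Q ** X)))" for X h
  define x where "x = cutoff e"
  define x' where "x' X h = 2 * max 0 (u X) * u' X h" for X h
  have x: "x X = (max 0 (u X))^2" for X by (simp add: x_def cutoff_def u_def)
  have C1x: "C1_on U x x'"
    unfolding x[abs_def] x'_def[abs_def] u_def[abs_def] u'_def[abs_def]
    by (intro C1_on_pos_part_square C1_on_diff C1_on_const C1_on_linear_comp[OF bounded_linear_mult_right]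
        C1_sq C1_on_inverse C1_T) (simp add: U_def)
  have C1F: "C1_on U (\<lambda>X. x X *\<^sub>R Phi X) (\<lambda>X h. x X *\<^sub>R Phi' X h + x' X h *\<^sub>R Phi X)"
    by (intro C1_on_scaleR C1x C1_Phi)
  let ?K = "{X. e \<le> T X} \<inter> {X. sq X \<le> 1 / e}"
  have K: "compact ?K"
  proof -
    have "closed {X. e \<le> T X}" using C1_on_cont[OF C1_T[of UNIV]] by (intro closed_Collect_le) auto
    moreover have "closed {X. sq X \<le> 1 / e}"
      using C1_on_cont[OF C1_sq[of UNIV]] by (intro closed_Collect_le) auto
    ultimately show ?thesis
      using bounded_sublevel[of 0 "1 / e"] by (simp add: compact_eq_bounded_closed bounded_Int closed_Int)
  qed
  have KU: "?K \<subseteq> U" using e by (auto simp: U_def)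
  \<comment> \<open>On \<open>U\<close> but outside \<open>?K\<close> one of the two subtracted
    terms of \<open>u\<close> is at least 1; off \<open>U\<close> the field \<open>Phi\<close>
    itself is 0.\<close>
  have zero: "x X *\<^sub>R Phi X = 0" if "X \<notin> ?K" for X
  proof (cases "X \<in> U")
    case True
    then have T0: "0 < T X" by (simp add: U_def)
    have "u X \<le> 0"
    proof (cases "e \<le> T X")
      case True
      then have "1 / e < sq X" using that by auto
      then have "1 < e * sq X" using e by (simp add: field_simps)
      moreover have "0 \<le> e * inverse (T X)" using e T0 by simp
      ultimately show ?thesis by (simp add: u_def)
    next
      case False
      then have "1 \<le> e * inverse (T X)" using T0 by (simp add: field_simps)
      moreover have "0 \<le> e * sq X"
        using e quadratic_form_nonneg[of X] by simp
      ultimately show ?thesis by (simp add: u_def)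
    qed
    then show ?thesis by (simp add: x)
  qed (simp add: Phi_outside_U)
  define f where "f X = indicator U X * (rho X * (\<Sum>b\<in>Basis. (x X *\<^sub>R Phi' X b + x' X b *\<^sub>R Phi X) \<bullet> b)
      + - (rho X * ((x X *\<^sub>R Phi X) \<bullet> (Q ** (X - Th)))))" for X
  have f: "integrable lborel f" "(\<integral>X. f X \<partial>lborel) = 0"
    unfolding f_def using stein_identity_compact_support[OF open_U K KU C1F C1_rho zero] by auto
  \<comment> \<open>Here \<open>f\<close> has integral 0, and \<open>8 * e * q\<close> is twice the
    largest loss \<open>4 * e * q\<close> caused by the derivative of the cutoff along
    \<open>Phi\<close>.\<close>
  have bound: "rho X * sq (X - Th - x X *\<^sub>R Phi X) \<le> rho X * r0 X + 2 * f X + 8 * e * q * rho X" for X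
  proof (cases "X \<in> U")
    case False
    then show ?thesis using e q_nonneg rho_nonneg[of X] by (simp add: f_def Phi_outside_U r0_def)
  next
    case True
    then have T0: "0 < T X" by (simp add: U_def)
    have lx': "linear (x' X)" using has_derivative_linear[OF C1_on_der[OF C1x True]] .
    let ?div = "\<Sum>b\<in>Basis. Phi' X b \<bullet> b"
    have "(\<Sum>b\<in>Basis. (x X *\<^sub>R Phi' X b + x' X b *\<^sub>R Phi X) \<bullet> b) = x X * ?div + x' X (Phi X)"
      using sum_Basis_linear_form[OF lx', of "Phi X"]
      by (simp add: inner_add_left sum.distrib sum_distrib_left)
    then have fX: "f X = rho X * (x X * ?div + x' X (Phi X) - x X * (Phi X \<bullet> (Q ** (X - Th))))"
      using True by (simp add: f_def algebra_simps)
    have u1: "u X \<le> 1"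
    proof -
      have "0 \<le> e * inverse (T X)" "0 \<le> e * sq X"
        using e T0 quadratic_form_nonneg[of X] by auto
      then show ?thesis by (simp add: u_def)
    qed
    then have x1: "0 \<le> x X" "x X \<le> 1" by (auto simp: x power_le_one)
    have "u' X (Phi X) = 2 * e * q * inverse ((T X)^2) - 2 * e * q"
      by (simp add: u'_def T'_def inner_Phi_QZ[OF True] inner_Phi_QX[OF True])
    then have "- (2 * e * q) \<le> u' X (Phi X)" using e q_nonneg by simp
    then have "max 0 (u X) * (- (2 * e * q)) \<le> max 0 (u X) * u' X (Phi X)" by (intro mult_left_mono) auto
    moreover have "max 0 (u X) * (2 * e * q) \<le> 1 * (2 * e * q)" using u1 e q_nonneg by (intro mult_right_mono) auto
    ultimately have x': "- 4 * e * q \<le> x' X (Phi X)" by (simp add: x'_def)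
    \<comment> \<open>A cutoff with values in \<open>[0, 1]\<close> satisfies
      \<open>x^2 \<le> x\<close>, so the truncated quadratic term is covered by \<open>x\<close>
      times the unbiased estimate, which is nonpositive.\<close>
    have "(x X)^2 * sq (Phi X) - 2 * (x X * ?div) \<le> x X * (sq (Phi X) - 2 * ?div)"
    proof -
      have "(x X)^2 * sq (Phi X) \<le> x X * sq (Phi X)"
        using x1 quadratic_form_nonneg[of "Phi X"] by (intro mult_right_mono) (auto simp: power2_eq_square mult_left_le_one_le)
      then show ?thesis by (simp add: algebra_simps)
    qed
    also have "\<dots> \<le> 0" using x1 unbiased_risk_difference_nonpos[OF True] by (simp add: mult_nonneg_nonpos)
    finally have "sq (X - Th - x X *\<^sub>R Phi X)
        \<le> r0 X + 2 * (x X * ?div + x' X (Phi X) - x X * (Phi X \<bullet> (Q ** (X - Th)))) + 8 * e * q"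
      using x' unfolding sq_diff[of "X - Th"] r0_def by (simp add: matrix_mult_linear power2_eq_square mult.assoc)
    then have "rho X * sq (X - Th - x X *\<^sub>R Phi X)
        \<le> rho X * (r0 X + 2 * (x X * ?div + x' X (Phi X) - x X * (Phi X \<bullet> (Q ** (X - Th)))) + 8 * e * q)"
      using rho_nonneg by (rule mult_left_mono)
    then show ?thesis unfolding fX by (simp add: algebra_simps)
  qed
  have int: "integrable lborel (\<lambda>X. rho X * r0 X + 2 * f X + 8 * e * q * rho X)"
    using f second_moment rho_integral by auto
  have "(\<integral>\<^sup>+X. ennreal (rho X * sq (X - Th - x X *\<^sub>R Phi X)) \<partial>lborel)
      \<le> (\<integral>\<^sup>+X. ennreal (rho X * r0 X + 2 * f X + 8 * e * q * rho X) \<partial>lborel)"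
    by (intro nn_integral_mono ennreal_leI bound)
  also have "\<dots> = ennreal (\<integral>X. rho X * r0 X + 2 * f X + 8 * e * q * rho X \<partial>lborel)"
  proof (rule nn_integral_eq_integral[OF int AE_I2])
    fix X
    have "0 \<le> rho X * sq (X - Th - x X *\<^sub>R Phi X)" using rho_nonneg quadratic_form_nonneg by simp
    also note bound
    finally show "0 \<le> rho X * r0 X + 2 * f X + 8 * e * q * rho X" .
  qed
  also have "\<dots> \<le> ennreal (real CARD('n) * real CARD('p) + 8 * e * q)"
    using f second_moment rho_integral by (intro ennreal_leI) simp
  finally show ?thesis by (simp add: x_def)
qed

lemma loss_eq: "loss S Th (X - Y) = sq (X - Th - Y) / (real CARD('n) * real CARD('p))"
proof -
  have "X - Y - Th = X - Th - Y" by simp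
  then show ?thesis by (simp only: loss_def inner_mat_trace matrix_mul_assoc)
qed

lemma risk_le_one: "risk S Th (double_shrink_est c S) \<le> 1"
proof -
  let ?np = "real CARD('n) * real CARD('p)"
  have np: "0 < ?np" by simp
  define e where "e k = 1 / (real k + 1)" for k :: nat
  have e: "0 < e k" for k by (simp add: e_def)
  have elim: "e \<longlonglongrightarrow> 0"
    unfolding e_def using LIMSEQ_inverse_real_of_nat by (simp add: inverse_eq_divide add.commute)
  \<comment> \<open>Convergence holds at every \<open>X\<close>: where \<open>T X = 0\<close>, the
    convention \<open>inverse 0 = 0\<close> removes the singular term.\<close>
  have lim: "(\<lambda>k. ennreal (rho X * sq (X - Th - cutoff (e k) X *\<^sub>R Phi X))) \<longlonglongrightarrow> ennreal (rho X * sq (X - Th - Phi X))" for X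
  proof -
    have "(\<lambda>k. cutoff (e k) X) \<longlonglongrightarrow> (max 0 ((1 - 0 * inverse (T X)) - 0 * sq X))^2"
      unfolding cutoff_def by (intro tendsto_intros elim)
    then have "(\<lambda>k. cutoff (e k) X) \<longlonglongrightarrow> 1" by simp
    then have "(\<lambda>k. rho X * sq (X - Th - cutoff (e k) X *\<^sub>R Phi X)) \<longlonglongrightarrow> rho X * sq (X - Th - 1 *\<^sub>R Phi X)"
      by (intro tendsto_intros bounded_linear.tendsto[OF bounded_linear_matrix_mult_left])
    then show ?thesis by (intro tendsto_ennrealI) simp
  qed
  have "(\<integral>\<^sup>+X. ennreal (rho X * sq (X - Th - Phi X)) \<partial>lborel)
      = (\<integral>\<^sup>+X. liminf (\<lambda>k. ennreal (rho X * sq (X - Th - cutoff (e k) X *\<^sub>R Phi X))) \<partial>lborel)"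
    by (intro nn_integral_cong lim_imp_Liminf[symmetric] lim) simp
  also have "\<dots> \<le> liminf (\<lambda>k. \<integral>\<^sup>+X. ennreal (rho X * sq (X - Th - cutoff (e k) X *\<^sub>R Phi X)) \<partial>lborel)"
    by (rule nn_integral_liminf) measurable
  also have "\<dots> \<le> liminf (\<lambda>k. ennreal (?np + 8 * e k * q))"
    by (intro Liminf_mono always_eventually allI truncated_risk e)
  also have "\<dots> = ennreal ?np"
  proof (rule lim_imp_Liminf)
    have "(\<lambda>k. ?np + 8 * e k * q) \<longlonglongrightarrow> ?np + 8 * 0 * q" by (intro tendsto_intros elim)
    then show "(\<lambda>k. ennreal (?np + 8 * e k * q)) \<longlonglongrightarrow> ennreal ?np" by (intro tendsto_ennrealI) simp
  qed simp
  finally have main: "(\<integral>\<^sup>+X. ennreal (rho X * sq (X - Th - Phi X)) \<partial>lborel) \<le> ennreal ?np" .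
  have "risk S Th (double_shrink_est c S) = (\<integral>\<^sup>+X. ennreal (sq (X - Th - Phi X) / ?np) \<partial>density lborel (\<lambda>X. ennreal (rho X)))"
    by (simp add: risk_def data_measure_gauss rho_def double_shrink_est_eq loss_eq)
  also have "\<dots> = (\<integral>\<^sup>+X. ennreal (rho X) * ennreal (sq (X - Th - Phi X) / ?np) \<partial>lborel)"
    by (rule nn_integral_density) measurable
  also have "\<dots> = (\<integral>\<^sup>+X. ennreal (1 / ?np) * ennreal (rho X * sq (X - Th - Phi X)) \<partial>lborel)"
    by (intro nn_integral_cong) (simp add: ennreal_mult'[symmetric] ennreal_mult[symmetric] rho_nonneg mult.commute)
  also have "\<dots> = ennreal (1 / ?np) * (\<integral>\<^sup>+X. ennreal (rho X * sq (X - Th - Phi X)) \<partial>lborel)"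
    by (rule nn_integral_cmult) measurable
  also have "\<dots> \<le> ennreal (1 / ?np) * ennreal ?np" by (intro mult_left_mono main) simp
  also have "\<dots> = 1" using np by (simp add: ennreal_mult'[symmetric] del: of_nat_mult)
  finally show ?thesis .
qed

end

theorem theorem3:
  fixes S :: "real^'p^'p" and c :: real
  assumes n2: "CARD('n) \<ge> 2"
    and pd: "pos_def_mat S"
    and cond:
      "let n = real CARD('n); p = real CARD('p);
           m = min p (n - 1); M = max p (n - 1); A0 = M - m
       in (c > 0 \<and>
             (m * A0 + m^2 - 16 + 4 / m) * c^2 + ((m + 1) * A0 + m^2 - 8 * m - 18) * c
               + A0 - 14 \<ge> 0)
          \<or> (c = 1 / m \<and>
             A0 \<ge> (- (m^4) + 21 * m^3 + 18 * m^2 + 16 * m - 4) / (2 * m^2 * (m + 1)))"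
  shows "\<forall>Th :: real^'n^'p. risk S Th (double_shrink_est c S) \<le> 1"
proof
  fix Th :: "real^'n^'p"
  define m where "m = min (real CARD('p)) (real CARD('n) - 1)"
  define A0 where "A0 = max (real CARD('p)) (real CARD('n) - 1) - m"
  define F where "F c = (m * A0 + m^2 - 16 + 4 / m) * c^2 + ((m + 1) * A0 + m^2 - 8 * m - 18) * c + A0 - 14" for c
  have m1: "1 \<le> m" using n2 by (simp add: m_def Suc_leI)
  have "(c > 0 \<and> F c \<ge> 0) \<or> (c = 1 / m \<and> A0 \<ge> (- (m^4) + 21 * m^3 + 18 * m^2 + 16 * m - 4) / (2 * m^2 * (m + 1)))"
    using cond by (simp add: Let_def m_def A0_def F_def)
  moreover have "F (1 / m) \<ge> 0" if "A0 \<ge> (- (m^4) + 21 * m^3 + 18 * m^2 + 16 * m - 4) / (2 * m^2 * (m + 1))"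
  proof -
    \<comment> \<open>Multiplication by \<open>m^3\<close> clears all denominators, and
      \<open>A0\<close> then has the coefficient \<open>2 * m^2 * (m + 1)\<close>.\<close>
    have "F (1 / m) = (A0 * (2 * m^2 * (m + 1)) - (- (m^4) + 21 * m^3 + 18 * m^2 + 16 * m - 4)) / m^3"
      using m1 by (simp add: F_def field_simps power2_eq_square power3_eq_cube power4_eq_xxxx)
    moreover have "0 < 2 * m^2 * (m + 1)" using m1 by simp
    then have "- (m^4) + 21 * m^3 + 18 * m^2 + 16 * m - 4 \<le> A0 * (2 * m^2 * (m + 1))"
      using that by (simp add: pos_divide_le_eq)
    ultimately show ?thesis using m1 by simp
  qed
  ultimately have "0 < c" "F c \<ge> 0" using m1 by auto
  then interpret shrinkage S c Th m A0
    using n2 pd by unfold_locales (simp_all add: m_def A0_def F_def)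
  show "risk S Th (double_shrink_est c S) \<le> 1" by (rule risk_le_one)
qed

end
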